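(* Let $X$ be a large positive parameter, and let $\alpha\in\mathbb{R}$ have the property that whenever $|\alpha-a/q|\le 1/(qX^{2/3})$ for coprime $q\in\mathbb{N}$ and $a\in\mathbb{Z}$, one has $q>X^{1/3}$. Writing $\rho=\exp(-1/X)$, as $X\to\infty$ one has $$\Psi(\rho e(\alpha),f)=O(X/\log X),$$ uniformly among multiplicative functions $f:\mathbb{N}\to\mathbb{C}$ with $|f|\le1$.
   Context: $e(\alpha)=\exp(2\pi i\alpha)$. For $f:\mathbb{N}\to\mathbb{C}$ with $|f|\le1$ and $|z|<1$, $\Psi(z,f)=\sum_{k=1}^\infty\sum_{n=1}^\infty \frac{f(n)^k}{k}z^{nk}$ (absolutely convergent), so that $\exp\Psi(z,f)=\prod_{n\ge1}(1-f(n)z^n)^{-1}$. *)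

theory Defs
  imports "HOL-Analysis.Analysis"
begin

(* Arithmetic functions live on the positive integers; the value at 0 is junk and is
   neither constrained by the predicates below nor used in Psi. *)

definition multiplicative :: "(nat \<Rightarrow> complex) \<Rightarrow> bool" where
  "multiplicative f \<longleftrightarrow>
     f 1 = 1 \<and> (\<forall>m n. m > 0 \<and> n > 0 \<and> coprime m n \<longrightarrow> f (m * n) = f m * f n)"

definition unit_bounded :: "(nat \<Rightarrow> complex) \<Rightarrow> bool" where
  "unit_bounded f \<longleftrightarrow> (\<forall>n\<ge>1. norm (f n) \<le> 1)"

definition ee :: "real \<Rightarrow> complex" where
  "ee \<alpha> = exp (2 * of_real pi * \<i> * of_real \<alpha>)"

(* infsum is 0 on non-summable families; for norm z < 1 and unit_bounded f both the
   inner and the outer series converge absolutely, so this is the usual double series. *)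
definition Psi :: "complex \<Rightarrow> (nat \<Rightarrow> complex) \<Rightarrow> complex" where
  "Psi z f = (\<Sum>\<^sub>\<infinity>k\<in>{1..}. \<Sum>\<^sub>\<infinity>n\<in>{1..}. f n ^ k / of_nat k * z ^ (n * k))"

definition minor_arc :: "real \<Rightarrow> real \<Rightarrow> bool" where
  "minor_arc X \<alpha> \<longleftrightarrow>
     (\<forall>(q::nat) (a::int). q > 0 \<and> coprime a (int q) \<and>
        \<bar>\<alpha> - of_int a / real q\<bar> \<le> 1 / (real q * X powr (2 / 3))
        \<longrightarrow> real q > X powr (1 / 3))"

end

theory Submission
  imports Defs "HOL-Number_Theory.Number_Theory" "HOL-Computational_Algebra.Squarefree"
    "HOL-Real_Asymp.Real_Asymp"
begin

text \<open>
  The method is that of Montgomery and Vaughan. For \<open>k\<close> beyond a small power of \<open>X\<close> the trivial bound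
  \<open>X / k\<^sup>2\<close> for the \<open>k\<close>-th term suffices. For smaller \<open>k\<close>, multiply the inner sum over \<open>n\<close> by \<open>ln X\<close>, replace
  \<open>ln X\<close> by the sum of \<open>ln p\<close> over the primes \<open>p\<close> dividing \<open>n\<close> and use multiplicativity; up to \<open>O(X / k)\<close> this
  leaves a bilinear sum over \<open>p\<close> and \<open>m = n / p\<close>, which is cut into dyadic blocks.
  If \<open>p\<close> is not too large, apply Cauchy--Schwarz with \<open>m\<close> outside; the diagonal of the block
  \<open>p \<approx> P\<close> contributes \<open>(X / k) ln P / sqrt P\<close>, which is summable over powers of two.
  If \<open>p\<close> is large, then \<open>m\<close> is much smaller than the denominator \<open>q\<close>. Apply Cauchy--Schwarz with \<open>p\<close> outside and majorise
  the indicator of the primes by Selberg's weights: the factor \<open>1 / ln X\<close> gained from the sieve compensates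
  \<open>ln p\<close>, and the diagonals are again summable. Off the diagonal the geometric sums are controlled by the
  spacing of the multiples of \<open>\<alpha>\<close>, with a power of \<open>X\<close> to spare.
\<close>

section \<open>Selberg weights\<close>

text \<open>The difficulty is a single logarithm. After multiplication by \<open>ln X\<close> an
  error of order \<open>X / k\<close> has to remain, although there are about \<open>ln X\<close>
  dyadic blocks and \<open>ln p\<close> itself can be as large as \<open>ln X\<close>. For large
  \<open>p\<close>, letting the outer variable of Cauchy--Schwarz run over all integers would lose a
  factor \<open>ln X\<close>; the sieve enters both factors of the inequality, so its full saving
  survives the square root. The outer variable has to change: with \<open>m\<close> outside, the
  off-diagonal terms of a block grow like \<open>k * P\<close>, too much once \<open>P\<close> comes
  close to \<open>X\<close>. With \<open>p\<close> outside, all indices that occur, including the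
  moduli of the sieve, stay below \<open>q / 2\<close>, where no multiple of \<open>\<alpha>\<close>
  comes nearer to an integer than \<open>1 / (2 * q)\<close>. Rational approximations to
  \<open>k * \<alpha>\<close> are never sought: its multiples are treated as multiples of
  \<open>\<alpha>\<close>, at the cost of a factor \<open>k\<close>. The exponent 96 is a multiple
  of 3 that makes \<open>X powr (1/3)\<close> and \<open>X powr (2/3)\<close> equal to
  \<open>U ^ 32\<close> and \<open>U ^ 64\<close>, with room for all losses in powers of
  \<open>U\<close>.\<close>

definition moebius :: "nat \<Rightarrow> real" where
  "moebius n = (if squarefree n then (- 1) ^ card (prime_factors n) else 0)"

lemma moebius_1 [simp]: "moebius 1 = 1" "moebius (Suc 0) = 1"
  by (simp_all add: moebius_def)

lemma abs_moebius_le: "\<bar>moebius n\<bar> \<le> 1"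
  by (simp add: moebius_def power_abs)

lemma moebius_square: "moebius n ^ 2 = (if squarefree n then 1 else 0)"
  by (simp add: moebius_def power_mult [symmetric] mult.commute [of _ 2] power_mult)

lemma moebius_prime_mult:
  assumes "prime p" "squarefree d" "\<not> p dvd d"
  shows "moebius (p * d) = - moebius d"
proof -
  have "d \<noteq> 0" using assms(2) by (metis not_squarefree_0)
  have cop: "coprime p d" using assms by (simp add: prime_imp_coprime)
  have sq: "squarefree (p * d)"
    using cop assms by (intro squarefree_mult_coprime) (auto intro: squarefree_prime)
  have "prime_factors (p * d) = insert p (prime_factors d)"
    using assms \<open>d \<noteq> 0\<close> by (subst prime_factors_product) (auto simp: prime_prime_factors)
  moreover have "p \<notin> prime_factors d" using assms by auto
  ultimately show ?thesis using sq assms by (simp add: moebius_def)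
qed

text \<open>Fix a prime \<open>p\<close> dividing \<open>n\<close>. The squarefree divisors of
  \<open>n\<close> fall into pairs \<open>d\<close>, \<open>p * d\<close> with \<open>p\<close> not
  dividing \<open>d\<close>, and \<open>moebius\<close> takes opposite values on each pair.\<close>

lemma sum_moebius_divisors:
  assumes "n > 0"
  shows "(\<Sum>d | d dvd n. moebius d) = (if n = 1 then 1 else 0)"
proof (cases "n = 1")
  case True
  then show ?thesis by simp
next
  case False
  then obtain p where p: "prime p" "p dvd n" using prime_factor_nat by blast
  define S where "S = {d. d dvd n \<and> squarefree d}"
  define S0 where "S0 = {d\<in>S. \<not> p dvd d}"
  have fin: "finite {d. d dvd n}" using assms by simp
  then have finS: "finite S" unfolding S_def by (rule rev_finite_subset) auto
  have split: "S = S0 \<union> (*) p ` S0"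
  proof (intro equalityI subsetI)
    fix d assume d: "d \<in> S"
    show "d \<in> S0 \<union> (*) p ` S0"
    proof (cases "p dvd d")
      case True
      then obtain e where e: "d = p * e" by auto
      have sq: "squarefree (p * e)" using d e by (simp add: S_def)
      have "\<not> p dvd e"
      proof
        assume "p dvd e"
        then have "p ^ 2 dvd p * e" by (simp add: power2_eq_square)
        then have "p dvd 1" using sq squarefreeD by blast
        then show False using p by auto
      qed
      moreover have "squarefree e" using sq squarefree_multD by blast
      moreover have "e dvd n" using d e by (auto simp: S_def intro: dvd_mult_right)
      ultimately show ?thesis using e by (auto simp: S0_def S_def)
    qed (use d in \<open>auto simp: S0_def\<close>)
  next
    fix d assume "d \<in> S0 \<union> (*) p ` S0"
    then consider "d \<in> S0" | e where "e \<in> S0" "d = p * e" by auto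
    then show "d \<in> S"
    proof cases
      case 2
      have cop: "coprime p e" using 2 p by (simp add: prime_imp_coprime S0_def)
      then have "p * e dvd n" using 2 p by (auto simp: S0_def S_def intro: divides_mult)
      moreover have "squarefree (p * e)" using cop 2 p
        by (intro squarefree_mult_coprime) (auto simp: S0_def S_def intro: squarefree_prime)
      ultimately show ?thesis using 2 by (auto simp: S_def)
    qed (auto simp: S0_def)
  qed
  have "p > 0" using p by (simp add: prime_gt_0_nat)
  have "(\<Sum>d | d dvd n. moebius d) = (\<Sum>d\<in>S. moebius d)"
    using fin by (intro sum.mono_neutral_right) (auto simp: S_def moebius_def)
  also have "\<dots> = (\<Sum>d\<in>S0. moebius d) + (\<Sum>d\<in>(*) p ` S0. moebius d)"
    using finS by (subst split, intro sum.union_disjoint) (auto simp: S0_def)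
  also have "(\<Sum>d\<in>(*) p ` S0. moebius d) = (\<Sum>d\<in>S0. moebius (p * d))"
    using \<open>p > 0\<close> by (subst sum.reindex) (auto simp: inj_on_def)
  also have "\<dots> = (\<Sum>d\<in>S0. - moebius d)"
    by (intro sum.cong) (auto simp: S0_def S_def moebius_prime_mult p)
  finally show ?thesis using False by (simp add: sum_negf)
qed

lemma sum_moebius_cofactors:
  assumes "l > 0" "m > 0" "l dvd m"
  shows "(\<Sum>d | l dvd d \<and> d dvd m. moebius (m div d)) = (if m = l then 1 else 0)"
proof -
  have "(\<Sum>d | l dvd d \<and> d dvd m. moebius (m div d)) = (\<Sum>e | e dvd m div l. moebius e)"
  proof (rule sum.reindex_bij_witness [where i = "\<lambda>e. m div e" and j = "\<lambda>d. m div d"])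
    fix d assume d: "d \<in> {d. l dvd d \<and> d dvd m}"
    then show "m div (m div d) = d" using assms by (auto elim!: dvdE)
    show "m div d \<in> {e. e dvd m div l}" using d assms by (auto elim!: dvdE)
  next
    fix e assume e: "e \<in> {e. e dvd m div l}"
    then obtain c where c: "m = l * (e * c)" using assms by (auto elim!: dvdE)
    then have "m div e = l * c" "l * c > 0" using assms by (auto simp: div_mult_swap)
    then show "m div (m div e) = e" using c assms by (simp add: mult.left_commute)
    show "m div e \<in> {d. l dvd d \<and> d dvd m}" using \<open>m div e = l * c\<close> c by simp
  qed simp
  also have "\<dots> = (if m div l = 1 then 1 else 0)"
    using assms by (intro sum_moebius_divisors) (auto elim!: dvdE)
  also have "m div l = 1 \<longleftrightarrow> m = l" using assms by (auto elim!: dvdE)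
  finally show ?thesis by simp
qed

text \<open>Moebius inversion over multiples instead of divisors, cut off at \<open>D\<close>. It
  lets the variables \<open>y\<close> that diagonalise the sieve form be prescribed freely, the
  coefficients being recovered from them.\<close>

lemma moebius_dual_inversion:
  fixes y :: "nat \<Rightarrow> real"
  assumes l: "l \<in> {1..D}"
  shows "(\<Sum>d\<in>{d\<in>{1..D}. l dvd d}. \<Sum>m\<in>{m\<in>{1..D}. d dvd m}. moebius (m div d) * y m) = y l"
proof -
  have "(\<Sum>d\<in>{d\<in>{1..D}. l dvd d}. \<Sum>m\<in>{m\<in>{1..D}. d dvd m}. moebius (m div d) * y m)
      = (\<Sum>m\<in>{1..D}. \<Sum>d\<in>{d\<in>{d\<in>{1..D}. l dvd d}. d dvd m}. moebius (m div d) * y m)"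
    by (rule sum.swap_restrict) auto
  also have "\<dots> = (\<Sum>m\<in>{1..D}. if m = l then y m else 0)"
  proof (rule sum.cong)
    fix m assume m: "m \<in> {1..D}"
    have "{d\<in>{d\<in>{1..D}. l dvd d}. d dvd m} = {d. l dvd d \<and> d dvd m}"
      using m by (auto dest: dvd_imp_le intro: Suc_leI dvd_pos_nat)
    moreover have "(\<Sum>d | l dvd d \<and> d dvd m. moebius (m div d)) = (if m = l then 1 else 0)"
    proof (cases "l dvd m")
      case True
      then show ?thesis using l m by (intro sum_moebius_cofactors) auto
    next
      case False
      then have "{d. l dvd d \<and> d dvd m} = {}" using dvd_trans by blast
      then show ?thesis using False by (metis dvd_refl sum.empty)
    qed
    ultimately show "(\<Sum>d\<in>{d\<in>{d\<in>{1..D}. l dvd d}. d dvd m}. moebius (m div d) * y m)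
        = (if m = l then y m else 0)"
      by (simp add: sum_distrib_right [symmetric])
  qed simp
  also have "\<dots> = y l" using l by simp
  finally show ?thesis .
qed

text \<open>Since \<open>d * e / lcm d e = gcd d e\<close> and \<open>gcd d e\<close> is the sum of
  \<open>totient l\<close> over the common divisors \<open>l\<close>, the form becomes a sum of
  squares. The coefficients are written as \<open>d * a d\<close> so that exactly this quotient
  appears.\<close>

lemma lcm_form_diagonal:
  fixes a :: "nat \<Rightarrow> real"
  shows "(\<Sum>d\<in>{1..D}. \<Sum>e\<in>{1..D}. (real d * a d) * (real e * a e) / real (lcm d e))
       = (\<Sum>l\<in>{1..D}. real (totient l) * (\<Sum>d\<in>{d\<in>{1..D}. l dvd d}. a d) ^ 2)"
proof -
  have gcd: "real (gcd d e) = (\<Sum>l\<in>{1..D}. if l dvd d \<and> l dvd e then real (totient l) else 0)"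
    if "d \<in> {1..D}" "e \<in> {1..D}" for d e
  proof -
    have "{l. l dvd gcd d e} = {l\<in>{1..D}. l dvd d \<and> l dvd e}"
      using that by (auto dest: dvd_imp_le intro: Suc_leI dvd_pos_nat)
    then have "gcd d e = (\<Sum>l\<in>{l\<in>{1..D}. l dvd d \<and> l dvd e}. totient l)"
      using totient_divisor_sum [of "gcd d e"] by simp
    then have "real (gcd d e) = (\<Sum>l\<in>{l\<in>{1..D}. l dvd d \<and> l dvd e}. real (totient l))"
      by (simp only: of_nat_sum)
    then show ?thesis
      by (simp only: sum.inter_filter [OF finite_atLeastAtMost])
  qed
  have "(real d * a d) * (real e * a e) / real (lcm d e)
      = (\<Sum>l\<in>{1..D}. real (totient l) * ((if l dvd d then a d else 0) * (if l dvd e then a e else 0)))"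
    if "d \<in> {1..D}" "e \<in> {1..D}" for d e
  proof -
    have gl: "real d * real e = real (gcd d e) * real (lcm d e)"
      by (metis of_nat_mult prod_gcd_lcm_nat)
    have "real (lcm d e) \<noteq> 0" using that by simp
    have "(real d * a d) * (real e * a e) / real (lcm d e)
        = (real (gcd d e) * real (lcm d e)) * (a d * a e) / real (lcm d e)"
      unfolding gl [symmetric] by (simp add: ac_simps)
    also have "\<dots> = real (gcd d e) * (a d * a e)"
      using \<open>real (lcm d e) \<noteq> 0\<close> by simp
    also have "\<dots> = (\<Sum>l\<in>{1..D}. real (totient l) * ((if l dvd d then a d else 0) * (if l dvd e then a e else 0)))"
      unfolding gcd [OF that] sum_distrib_right by (intro sum.cong) auto
    finally show ?thesis .
  qed
  then have "(\<Sum>d\<in>{1..D}. \<Sum>e\<in>{1..D}. (real d * a d) * (real e * a e) / real (lcm d e))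
      = (\<Sum>d\<in>{1..D}. \<Sum>e\<in>{1..D}. \<Sum>l\<in>{1..D}. real (totient l) * ((if l dvd d then a d else 0) * (if l dvd e then a e else 0)))"
    by (intro sum.cong refl) auto
  also have "\<dots> = (\<Sum>l\<in>{1..D}. \<Sum>d\<in>{1..D}. \<Sum>e\<in>{1..D}. real (totient l) * ((if l dvd d then a d else 0) * (if l dvd e then a e else 0)))"
  proof -
    have "(\<Sum>d\<in>{1..D}. \<Sum>e\<in>{1..D}. \<Sum>l\<in>{1..D}. h d e l) = (\<Sum>l\<in>{1..D}. \<Sum>d\<in>{1..D}. \<Sum>e\<in>{1..D}. h d e l)"
      for h :: "nat \<Rightarrow> nat \<Rightarrow> nat \<Rightarrow> real"
    proof -
      have "(\<Sum>d\<in>{1..D}. \<Sum>e\<in>{1..D}. \<Sum>l\<in>{1..D}. h d e l) = (\<Sum>d\<in>{1..D}. \<Sum>l\<in>{1..D}. \<Sum>e\<in>{1..D}. h d e l)"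
        by (rule sum.cong [OF refl], rule sum.swap)
      also have "\<dots> = (\<Sum>l\<in>{1..D}. \<Sum>d\<in>{1..D}. \<Sum>e\<in>{1..D}. h d e l)"
        by (rule sum.swap)
      finally show ?thesis .
    qed
    then show ?thesis .
  qed
  also have "\<dots> = (\<Sum>l\<in>{1..D}. real (totient l) * (\<Sum>d\<in>{d\<in>{1..D}. l dvd d}. a d) ^ 2)"
    by (simp only: sum_distrib_left [symmetric] sum_distrib_right [symmetric] power2_eq_square
        sum.inter_filter [OF finite_atLeastAtMost])
  finally show ?thesis .
qed

lemma sum_inverse_squares_le: "(\<Sum>s\<in>{1..n::nat}. 1 / real s ^ 2) \<le> 2"
proof -
  have "(\<Sum>s\<in>{1..Suc n}. 1 / real s ^ 2) \<le> 2 - 1 / real (Suc n)" for n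
  proof (induction n)
    case (Suc n)
    have "1 / real (Suc (Suc n)) ^ 2 \<le> 1 / real (Suc n) - 1 / real (Suc (Suc n))"
      by (simp add: divide_simps power2_eq_square)
    with Suc show ?case by (simp add: sum.cl_ivl_Suc)
  qed simp
  from this [of "n - 1"] show ?thesis by (cases n) (auto intro: order_trans)
qed

text \<open>Each \<open>n \<le> D\<close> is \<open>l * s^2\<close> with \<open>l\<close>
  squarefree, and \<open>l\<close>, \<open>s\<close> are again at most \<open>D\<close>. So the
  harmonic sum is at most the squarefree sum times the sum of \<open>1 / s^2\<close>, and the latter
  is at most 2.\<close>

lemma squarefree_reciprocal_sum_ge:
  "ln (real D + 1) / 2 \<le> (\<Sum>l\<in>{1..D}. (if squarefree l then 1 else 0) / real l)"
proof -
  define A where "A = {l\<in>{1..D}. squarefree l}"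
  have eq: "real n = real (squarefree_part n) * real (square_part n) ^ 2" for n :: nat
    by (metis of_nat_mult of_nat_power squarefree_decompose)
  have "ln (real D + 1) \<le> (\<Sum>n\<in>{1..D}. 1 / real n)"
    using ln_le_harm [of D] by (simp add: harm_def inverse_eq_divide)
  also have "\<dots> = (\<Sum>n\<in>{1..D}. (\<lambda>(l, s). 1 / (real l * real s ^ 2)) (squarefree_part n, square_part n))"
    by (simp only: prod.case eq [symmetric])
  also have "\<dots> = (\<Sum>(l, s)\<in>(\<lambda>n. (squarefree_part n, square_part n)) ` {1..D}. 1 / (real l * real s ^ 2))"
    by (rule sum.reindex_cong [symmetric, where l = "\<lambda>n. (squarefree_part n, square_part n)"])
       (auto intro!: inj_onI, metis squarefree_decompose)
  also have "\<dots> \<le> (\<Sum>(l, s)\<in>A \<times> {1..D}. 1 / (real l * real s ^ 2))"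
  proof (rule sum_mono2)
    show "(\<lambda>n. (squarefree_part n, square_part n)) ` {1..D} \<subseteq> A \<times> {1..D}"
    proof (clarsimp simp: A_def, intro conjI)
      fix n assume n: "Suc 0 \<le> n" "n \<le> D"
      have nz: "squarefree_part n \<noteq> 0" "square_part n \<noteq> 0" using n by auto
      have d: "squarefree_part n dvd n" "square_part n dvd n"
        by (metis dvd_triv_left squarefree_decompose)
           (metis dvd_mult dvd_mult2 dvd_refl power2_eq_square squarefree_decompose)
      show "Suc 0 \<le> squarefree_part n" "Suc 0 \<le> square_part n" using nz by linarith+
      show "squarefree_part n \<le> D" "square_part n \<le> D"
        using d n by (meson dvd_imp_le le_trans less_eq_Suc_le)+
    qed
  qed (auto simp: A_def)
  also have "\<dots> = (\<Sum>l\<in>A. 1 / real l) * (\<Sum>s\<in>{1..D}. 1 / real s ^ 2)"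
    by (simp add: sum_product sum.cartesian_product)
  also have "\<dots> \<le> (\<Sum>l\<in>A. 1 / real l) * 2"
    by (intro mult_left_mono sum_inverse_squares_le sum_nonneg) auto
  also have "(\<Sum>l\<in>A. 1 / real l) = (\<Sum>l\<in>{1..D}. (if squarefree l then 1 else 0) / real l)"
    unfolding A_def sum.inter_filter [OF finite_atLeastAtMost] by (intro sum.cong) auto
  finally show ?thesis by simp
qed

text \<open>In the diagonal variables one minimises the sum of \<open>totient l * y l ^ 2\<close>
  under the condition \<open>c 1 = 1\<close>, which reads: the sum of \<open>moebius m * y m\<close>
  is 1. By Cauchy--Schwarz the minimum is \<open>1 / G\<close>, attained at the \<open>y\<close>
  chosen here, and \<open>G\<close> is at least half a logarithm because
  \<open>totient l \<le> l\<close>. The bound \<open>D^2\<close> for the coefficients is crude but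
  costs only powers of the level \<open>D\<close>.\<close>

lemma selberg_weights_exist:
  assumes D: "D \<ge> 1"
  shows "\<exists>c::nat \<Rightarrow> real. c 1 = 1 \<and> (\<forall>d\<in>{1..D}. \<bar>c d\<bar> \<le> real D ^ 2) \<and>
           (\<Sum>d\<in>{1..D}. \<Sum>e\<in>{1..D}. c d * c e / real (lcm d e)) \<le> 2 / ln (real D + 1)"
proof -
  define G where "G = (\<Sum>l\<in>{1..D}. moebius l ^ 2 / real (totient l))"
  define y where "y m = moebius m / (real (totient m) * G)" for m
  define a where "a d = (\<Sum>m\<in>{m\<in>{1..D}. d dvd m}. moebius (m div d) * y m)" for d
  define L where "L d = real d * a d" for d
  have "moebius 1 ^ 2 / real (totient 1) \<le> G"
    unfolding G_def using D by (intro member_le_sum) auto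
  then have G1: "G \<ge> 1" by simp
  have Gln: "ln (real D + 1) / 2 \<le> G"
  proof -
    have "(\<Sum>l\<in>{1..D}. (if squarefree l then 1 else 0) / real l) \<le> G"
      unfolding G_def moebius_square
      by (intro sum_mono) (auto intro!: divide_left_mono simp: totient_le)
    then show ?thesis using squarefree_reciprocal_sum_ge [of D] by linarith
  qed
  have sq: "moebius m * y m = moebius m ^ 2 / real (totient m) / G" for m
    by (simp add: y_def power2_eq_square)
  have "L 1 = (\<Sum>m\<in>{1..D}. moebius m * y m)"
  proof -
    have "{m\<in>{1..D}. 1 dvd m} = {1..D}" by auto
    then show ?thesis by (simp only: L_def a_def of_nat_1 mult_1 div_by_1)
  qed
  also have "\<dots> = G / G" unfolding sq sum_divide_distrib [symmetric] G_def [symmetric] ..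
  finally have L1: "L 1 = 1" using G1 by simp
  have y1: "\<bar>y m\<bar> \<le> 1" if "m \<in> {1..D}" for m
  proof -
    have "1 * 1 \<le> real (totient m) * G"
      using that G1 by (intro mult_mono) (auto simp: Suc_le_eq)
    then show ?thesis using abs_moebius_le [of m] G1
      by (simp add: y_def abs_mult divide_simps)
  qed
  have Lb: "\<bar>L d\<bar> \<le> real D ^ 2" if "d \<in> {1..D}" for d
  proof -
    have "\<bar>a d\<bar> \<le> (\<Sum>m\<in>{m\<in>{1..D}. d dvd m}. 1)"
      unfolding a_def
    proof (rule order_trans [OF sum_abs], rule sum_mono)
      fix m assume "m \<in> {m\<in>{1..D}. d dvd m}"
      then have "\<bar>moebius (m div d)\<bar> * \<bar>y m\<bar> \<le> 1 * 1"
        using y1 abs_moebius_le by (intro mult_mono) auto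
      then show "\<bar>moebius (m div d) * y m\<bar> \<le> 1" by (simp add: abs_mult)
    qed
    also have "\<dots> \<le> (\<Sum>m\<in>{1..D}. 1)" by (intro sum_mono2) auto
    finally have "\<bar>a d\<bar> \<le> real D" by simp
    then have "real d * \<bar>a d\<bar> \<le> real D * real D" using that by (intro mult_mono) auto
    then show ?thesis by (simp add: L_def abs_mult power2_eq_square)
  qed
  have "(\<Sum>d\<in>{1..D}. \<Sum>e\<in>{1..D}. L d * L e / real (lcm d e))
      = (\<Sum>l\<in>{1..D}. real (totient l) * (\<Sum>d\<in>{d\<in>{1..D}. l dvd d}. a d) ^ 2)"
    unfolding L_def by (rule lcm_form_diagonal)
  also have "\<dots> = (\<Sum>l\<in>{1..D}. real (totient l) * y l ^ 2)"
    by (intro sum.cong refl) (simp only: a_def moebius_dual_inversion)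
  also have "\<dots> = (\<Sum>l\<in>{1..D}. moebius l ^ 2 / real (totient l)) / G ^ 2"
    unfolding sum_divide_distrib using G1
    by (intro sum.cong refl) (auto simp: y_def power_divide power_mult_distrib divide_simps power2_eq_square)
  also have "\<dots> = 1 / G" using G1 unfolding G_def [symmetric] by (simp add: power2_eq_square)
  also have "\<dots> \<le> 1 / (ln (real D + 1) / 2)"
    using D Gln G1 by (intro divide_left_mono) auto
  finally have "(\<Sum>d\<in>{1..D}. \<Sum>e\<in>{1..D}. L d * L e / real (lcm d e)) \<le> 2 / ln (real D + 1)"
    by simp
  with L1 Lb show ?thesis by blast
qed

section \<open>Geometric sums and the bilinear Cauchy--Schwarz inequality\<close>

definition nint_dist :: "real \<Rightarrow> real" where
  "nint_dist t = \<bar>t - of_int (round t)\<bar>"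

lemma nint_dist_le: "nint_dist t \<le> \<bar>t - of_int n\<bar>"
  unfolding nint_dist_def by (rule round_diff_minimal)

lemma nint_dist_nonneg: "nint_dist t \<ge> 0"
  by (simp add: nint_dist_def)

lemma nint_dist_minus: "nint_dist (- t) = nint_dist t"
proof -
  have "nint_dist (- t) \<le> nint_dist t" for t
    using nint_dist_le [of "- t" "- round t"] by (simp add: nint_dist_def abs_minus_commute)
  from this [of t] this [of "- t"] show ?thesis by simp
qed

lemma ee_add: "ee (a + b) = ee a * ee b"
  by (simp add: ee_def distrib_left exp_add)

lemma ee_eq_cis: "ee a = cis (2 * pi * a)"
  by (simp add: ee_def cis_conv_exp ac_simps)

lemma ee_power: "ee a ^ n = ee (real n * a)"
  unfolding ee_eq_cis Complex.DeMoivre by (simp add: ac_simps)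

lemma norm_ee [simp]: "norm (ee a) = 1"
  by (simp add: ee_eq_cis)

lemma cnj_ee: "cnj (ee a) = ee (- a)"
  by (simp add: ee_eq_cis cis_cnj)

lemma ee_of_int: "ee (of_int n) = 1"
  using cis_multiple_2pi [of "of_int n"] by (simp add: ee_eq_cis)

text \<open>Taylor expansion gives \<open>sin x \<ge> x - x^3 / 6\<close>, and
  \<open>x^2 \<le> 4\<close>. The interval up to 2 contains \<open>pi / 2\<close> because
  \<open>pi < 4\<close>, and the loss of a factor 3 is later made good by
  \<open>pi > 3\<close>.\<close>

lemma sin_ge_third:
  fixes x :: real
  assumes "0 \<le> x" "x \<le> 2"
  shows "x / 3 \<le> sin x"
proof -
  have "\<bar>sin x - (\<Sum>m<3. sin_coeff m * x ^ m)\<bar> \<le> inverse (fact 3) * \<bar>x\<bar> ^ 3"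
    by (rule Maclaurin_sin_bound)
  then have "\<bar>sin x - x\<bar> \<le> x ^ 3 / 6"
    using assms by (simp add: eval_nat_numeral sin_coeff_def)
  moreover have "x ^ 2 * x \<le> 2 ^ 2 * x" using assms by (intro mult_right_mono power_mono) auto
  then have "x ^ 3 \<le> 4 * x" by (simp add: power2_eq_square power3_eq_cube)
  ultimately show ?thesis by linarith
qed

lemma norm_one_minus_ee_ge: "2 * nint_dist \<theta> \<le> norm (1 - ee \<theta>)"
proof -
  define \<delta> where "\<delta> = \<theta> - of_int (round \<theta>)"
  have d: "\<bar>\<delta>\<bar> \<le> 1 / 2"
    unfolding \<delta>_def using of_int_round_abs_le [of \<theta>] by (simp add: abs_minus_commute)
  have "ee \<theta> = ee \<delta>"
    using ee_add [of \<delta> "of_int (round \<theta>)"] by (simp add: \<delta>_def ee_of_int)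
  have "(norm (1 - ee \<delta>))\<^sup>2 = (1 - cos (2 * (pi * \<delta>)))\<^sup>2 + (sin (2 * (pi * \<delta>)))\<^sup>2"
    by (simp add: ee_eq_cis cmod_power2 mult.assoc)
  also have "\<dots> = 2 - 2 * cos (2 * (pi * \<delta>))"
    using sin_cos_squared_add [of "2 * (pi * \<delta>)"] by (simp add: power2_diff)
  also have "\<dots> = (2 * sin (pi * \<bar>\<delta>\<bar>))\<^sup>2"
    by (simp add: cos_double_sin power_mult_distrib abs_if)
  finally have sq: "(norm (1 - ee \<delta>))\<^sup>2 = (2 * sin (pi * \<bar>\<delta>\<bar>))\<^sup>2" .
  have "pi * \<bar>\<delta>\<bar> \<le> 4 * (1 / 2)" using d pi_less_4 by (intro mult_mono) auto
  then have "pi * \<bar>\<delta>\<bar> / 3 \<le> sin (pi * \<bar>\<delta>\<bar>)" by (intro sin_ge_third) auto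
  moreover have "3 * \<bar>\<delta>\<bar> \<le> pi * \<bar>\<delta>\<bar>" using pi_gt3 by (intro mult_right_mono) auto
  ultimately have le: "2 * \<bar>\<delta>\<bar> \<le> 2 * sin (pi * \<bar>\<delta>\<bar>)" by linarith
  then have "0 \<le> 2 * sin (pi * \<bar>\<delta>\<bar>)" using abs_ge_zero [of \<delta>] by linarith
  with sq have "norm (1 - ee \<delta>) = 2 * sin (pi * \<bar>\<delta>\<bar>)"
    using power2_eq_imp_eq norm_ge_zero by blast
  with le show ?thesis by (simp only: \<open>ee \<theta> = ee \<delta>\<close> nint_dist_def \<delta>_def)
qed

text \<open>Replacing radius 1 by \<open>s\<close> moves the point by \<open>1 - s\<close>, which is
  itself at most \<open>norm (1 - of_real s * ee \<theta>)\<close>. So damping at most halves the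
  bound, and the factor 2 of the undamped case pays for it.\<close>

lemma norm_one_minus_scaled_ee_ge:
  assumes "0 \<le> s" "s \<le> 1"
  shows "nint_dist \<theta> \<le> norm (1 - of_real s * ee \<theta>)"
proof -
  have "1 - ee \<theta> = (1 - of_real s * ee \<theta>) + of_real (s - 1) * ee \<theta>"
    by (simp add: left_diff_distrib)
  then have "norm (1 - ee \<theta>) \<le> norm (1 - of_real s * ee \<theta>) + norm (of_real (s - 1) * ee \<theta>)"
    by (metis norm_triangle_ineq)
  moreover have "norm (of_real (s - 1) * ee \<theta>) = 1 - s"
    using assms by (simp add: norm_mult del: of_real_diff)
  moreover have "1 - s \<le> norm (1 - of_real s * ee \<theta>)"
    using norm_triangle_ineq2 [of 1 "of_real s * ee \<theta>"] assms by (simp add: norm_mult)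
  ultimately show ?thesis using norm_one_minus_ee_ge [of \<theta>] by linarith
qed

lemma norm_geometric_sum_le:
  fixes v :: complex
  assumes "norm v \<le> 1" "v \<noteq> 1"
  shows "norm (\<Sum>j\<in>{1..n}. v ^ j) \<le> 2 / norm (1 - v)"
proof (cases "n \<ge> 1")
  case True
  have "norm ((1 - v) * (\<Sum>j\<in>{1..n}. v ^ j)) = norm (v ^ 1 - v ^ Suc n)"
    using True by (subst sum_gp_multiplied) auto
  also have "\<dots> \<le> norm (v ^ 1) + norm (v ^ Suc n)" by (rule norm_triangle_ineq4)
  also have "\<dots> \<le> 1 + 1"
    using assms power_le_one [of "norm v" "Suc n"] by (intro add_mono) (simp_all only: norm_power, auto)
  finally have "norm (1 - v) * norm (\<Sum>j\<in>{1..n}. v ^ j) \<le> 2" by (simp only: norm_mult one_add_one)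
  then show ?thesis using assms by (subst pos_le_divide_eq) (auto simp: mult.commute)
qed auto

lemma norm_geometric_sum_nint_dist:
  assumes "norm v = s" "s \<le> 1" "v = of_real s * ee \<theta>" "nint_dist \<theta> > 0"
  shows "norm (\<Sum>j\<in>{1..n}. v ^ j) \<le> 2 / nint_dist \<theta>"
proof -
  have s: "0 \<le> s" using assms(1) norm_ge_zero by blast
  have *: "nint_dist \<theta> \<le> norm (1 - v)"
    using norm_one_minus_scaled_ee_ge [of s \<theta>] assms s by simp
  then have "v \<noteq> 1" using assms by auto
  then have "norm (\<Sum>j\<in>{1..n}. v ^ j) \<le> 2 / norm (1 - v)"
    using assms by (intro norm_geometric_sum_le) auto
  also have "\<dots> \<le> 2 / nint_dist \<theta>"
    using * assms by (intro divide_left_mono mult_pos_pos) auto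
  finally show ?thesis .
qed

lemma exp_geometric_sum_le:
  fixes u :: real
  assumes "u > 0"
  shows "(\<Sum>j\<in>{1..n}. exp (- u) ^ j) \<le> 1 / u"
proof (cases "n \<ge> 1")
  case True
  have "exp u * exp (- u) = 1" by (simp add: exp_minus)
  have "(1 - exp (- u)) * (\<Sum>j\<in>{1..n}. exp (- u) ^ j) = exp (- u) ^ 1 - exp (- u) ^ Suc n"
    using True by (subst sum_gp_multiplied) auto
  also have "\<dots> \<le> exp (- u)" by simp
  finally have *: "(1 - exp (- u)) * (\<Sum>j\<in>{1..n}. exp (- u) ^ j) \<le> exp (- u)" .
  have "(1 + u) * exp (- u) \<le> exp u * exp (- u)"
    by (intro mult_right_mono) (auto simp: exp_ge_add_one_self)
  then have "u * exp (- u) \<le> 1 - exp (- u)" using \<open>exp u * exp (- u) = 1\<close> by (simp add: algebra_simps)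
  then have "(u * exp (- u)) * (\<Sum>j\<in>{1..n}. exp (- u) ^ j) \<le> (1 - exp (- u)) * (\<Sum>j\<in>{1..n}. exp (- u) ^ j)"
    by (intro mult_right_mono sum_nonneg) auto
  with * have "exp (- u) * (u * (\<Sum>j\<in>{1..n}. exp (- u) ^ j)) \<le> exp (- u) * 1"
    by (simp only: mult_ac mult_1_right)
  then have "u * (\<Sum>j\<in>{1..n}. exp (- u) ^ j) \<le> 1"
    by (rule mult_left_le_imp_le) simp
  then show ?thesis using assms by (subst pos_le_divide_eq) (auto simp: mult.commute)
qed (use assms in auto)

text \<open>The full geometric series is \<open>1 / (exp u - 1)\<close>, which lies between
  \<open>1 / u - 1\<close> and \<open>1 / u\<close>. Both sides are needed because sieve
  coefficients of either sign multiply it.\<close>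

lemma exp_geometric_limit_bounds:
  fixes u :: real
  assumes "u > 0"
  shows "\<bar>exp (- u) / (1 - exp (- u)) - 1 / u\<bar> \<le> 1"
proof -
  have lt: "exp (- u) < 1" using assms by simp
  have "exp u * exp (- u) = 1" by (simp add: exp_minus)
  have "(1 + u) * exp (- u) \<le> exp u * exp (- u)"
    by (intro mult_right_mono) (auto simp: exp_ge_add_one_self)
  then have "u * exp (- u) \<le> 1 - exp (- u)" using \<open>exp u * exp (- u) = 1\<close> by (simp add: algebra_simps)
  then have "exp (- u) / (1 - exp (- u)) \<le> 1 / u" using assms lt by (simp add: field_simps)
  moreover have "exp (- u) / (1 - exp (- u)) = 1 / (1 - exp (- u)) - 1" using lt by (simp add: field_simps)
  moreover have "1 - u \<le> exp (- u)" using exp_ge_add_one_self [of "- u"] by simp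
  then have "1 / u \<le> 1 / (1 - exp (- u))" using lt assms by (intro divide_left_mono) auto
  ultimately show ?thesis by linarith
qed

text \<open>Splitting off the weight \<open>norm z ^ (a * P)\<close> makes the first factor converge without a cutoff in \<open>a\<close>,
  and for \<open>P \<le> b, b'\<close> what remains in the second factor still decays, as \<open>b + b' - P \<ge> P\<close>.\<close>

lemma bilinear_cauchy:
  fixes w :: "nat \<Rightarrow> real" and c :: "nat \<Rightarrow> complex" and z :: complex
  assumes w: "\<And>a. w a \<ge> 0" and B: "finite B" and z: "z \<noteq> 0"
  shows "(\<Sum>a\<in>{1..N}. w a * norm (\<Sum>b\<in>{b\<in>B. a * b \<le> N}. c b * z ^ (a * b)))\<^sup>2
    \<le> (\<Sum>a\<in>{1..N}. w a * norm z ^ (a * P)) *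
       (\<Sum>b\<in>B. \<Sum>b'\<in>B. norm (c b) * norm (c b') *
          norm (\<Sum>a\<in>{a\<in>{1..N}. a * b \<le> N \<and> a * b' \<le> N}.
             of_real (w a) * (z ^ b * cnj z ^ b' / of_real (norm z) ^ P) ^ a))"
proof -
  define r where "r = norm z"
  have r: "r > 0" using z by (simp add: r_def)
  define F where "F a = (\<Sum>b\<in>{b\<in>B. a * b \<le> N}. c b * z ^ (a * b))" for a
  define v where "v b b' = z ^ b * cnj z ^ b' / of_real r ^ P" for b b'
  have "(\<Sum>a\<in>{1..N}. w a * norm (F a)) =
        (\<Sum>a\<in>{1..N}. sqrt (w a * r ^ (a * P)) * (sqrt (w a / r ^ (a * P)) * norm (F a)))"
  proof (intro sum.cong refl)
    fix a
    have "sqrt (w a * r ^ (a * P)) * sqrt (w a / r ^ (a * P)) = sqrt (w a * w a)"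
      unfolding real_sqrt_mult [symmetric] using r by simp
    then show "w a * norm (F a) = sqrt (w a * r ^ (a * P)) * (sqrt (w a / r ^ (a * P)) * norm (F a))"
      using w [of a] by (simp add: mult.assoc [symmetric] del: real_sqrt_mult)
  qed
  then have "(\<Sum>a\<in>{1..N}. w a * norm (F a))\<^sup>2 =
      (\<Sum>a\<in>{1..N}. sqrt (w a * r ^ (a * P)) * (sqrt (w a / r ^ (a * P)) * norm (F a)))\<^sup>2"
    by (rule arg_cong)
  also have "\<dots> \<le>
      (\<Sum>a\<in>{1..N}. (sqrt (w a * r ^ (a * P)))\<^sup>2) *
      (\<Sum>a\<in>{1..N}. (sqrt (w a / r ^ (a * P)) * norm (F a))\<^sup>2)"
    by (rule Cauchy_Schwarz_ineq_sum)
  also have "(\<Sum>a\<in>{1..N}. (sqrt (w a * r ^ (a * P)))\<^sup>2) = (\<Sum>a\<in>{1..N}. w a * r ^ (a * P))"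
    using w r by (intro sum.cong refl real_sqrt_pow2) auto
  also have "(\<Sum>a\<in>{1..N}. (sqrt (w a / r ^ (a * P)) * norm (F a))\<^sup>2)
      = (\<Sum>a\<in>{1..N}. w a / r ^ (a * P) * (norm (F a))\<^sup>2)"
    unfolding power_mult_distrib using w r
    by (intro sum.cong refl arg_cong2 [where f = "(*)"] real_sqrt_pow2) auto
  also have "\<dots> \<le> (\<Sum>b\<in>B. \<Sum>b'\<in>B. norm (c b) * norm (c b') *
          norm (\<Sum>a\<in>{a\<in>{1..N}. a * b \<le> N \<and> a * b' \<le> N}. of_real (w a) * v b b' ^ a))"
  proof -
    have trm: "complex_of_real (w a / r ^ (a * P) * (norm (F a))\<^sup>2) =
        (\<Sum>b\<in>B. \<Sum>b'\<in>B. if a * b \<le> N \<and> a * b' \<le> N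
            then c b * cnj (c b') * (of_real (w a) * v b b' ^ a) else 0)" for a
    proof -
      have F: "F a = (\<Sum>b\<in>B. if a * b \<le> N then c b * z ^ (a * b) else 0)"
        unfolding F_def using B by (simp add: sum.inter_filter)
      have "complex_of_real ((norm (F a))\<^sup>2) = F a * cnj (F a)"
        by (simp add: complex_norm_square [symmetric])
      also have "\<dots> = (\<Sum>b\<in>B. \<Sum>b'\<in>B. (if a * b \<le> N then c b * z ^ (a * b) else 0) *
                                cnj (if a * b' \<le> N then c b' * z ^ (a * b') else 0))"
        unfolding F by (simp only: cnj_sum sum_product)
      finally have "complex_of_real (w a / r ^ (a * P) * (norm (F a))\<^sup>2) =
          (\<Sum>b\<in>B. \<Sum>b'\<in>B. of_real (w a / r ^ (a * P)) * ((if a * b \<le> N then c b * z ^ (a * b) else 0) *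
                                cnj (if a * b' \<le> N then c b' * z ^ (a * b') else 0)))"
        unfolding of_real_mult [of "w a / r ^ (a * P)"] by (simp only: sum_distrib_left)
      also have "\<dots> = (\<Sum>b\<in>B. \<Sum>b'\<in>B. if a * b \<le> N \<and> a * b' \<le> N
            then c b * cnj (c b') * (of_real (w a) * v b b' ^ a) else 0)"
        by (intro sum.cong refl)
           (simp add: v_def power_mult_distrib power_divide power_mult [symmetric] mult.commute [of _ a]
              mult.commute [of P a])
      finally show ?thesis .
    qed
    have "complex_of_real (\<Sum>a\<in>{1..N}. w a / r ^ (a * P) * (norm (F a))\<^sup>2)
        = (\<Sum>a\<in>{1..N}. \<Sum>b\<in>B. \<Sum>b'\<in>B. if a * b \<le> N \<and> a * b' \<le> N
            then c b * cnj (c b') * (of_real (w a) * v b b' ^ a) else 0)"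
      unfolding of_real_sum trm ..
    also have "\<dots> = (\<Sum>b\<in>B. \<Sum>a\<in>{1..N}. \<Sum>b'\<in>B. if a * b \<le> N \<and> a * b' \<le> N
            then c b * cnj (c b') * (of_real (w a) * v b b' ^ a) else 0)"
      by (rule sum.swap)
    also have "\<dots> = (\<Sum>b\<in>B. \<Sum>b'\<in>B. \<Sum>a\<in>{1..N}. if a * b \<le> N \<and> a * b' \<le> N
            then c b * cnj (c b') * (of_real (w a) * v b b' ^ a) else 0)"
      by (rule sum.cong [OF refl], rule sum.swap)
    also have "\<dots> = (\<Sum>b\<in>B. \<Sum>b'\<in>B. c b * cnj (c b') *
          (\<Sum>a\<in>{a\<in>{1..N}. a * b \<le> N \<and> a * b' \<le> N}. of_real (w a) * v b b' ^ a))"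
      unfolding sum_distrib_left sum.inter_filter [OF finite_atLeastAtMost]
      by (intro sum.cong refl) simp
    finally have eq: "complex_of_real (\<Sum>a\<in>{1..N}. w a / r ^ (a * P) * (norm (F a))\<^sup>2) = \<dots>" .
    have "(\<Sum>a\<in>{1..N}. w a / r ^ (a * P) * (norm (F a))\<^sup>2)
        \<le> norm (complex_of_real (\<Sum>a\<in>{1..N}. w a / r ^ (a * P) * (norm (F a))\<^sup>2))"
      by (simp only: norm_of_real abs_ge_self)
    also have "\<dots> \<le> (\<Sum>b\<in>B. \<Sum>b'\<in>B. norm (c b * cnj (c b') *
          (\<Sum>a\<in>{a\<in>{1..N}. a * b \<le> N \<and> a * b' \<le> N}. of_real (w a) * v b b' ^ a)))"
      unfolding eq by (intro sum_norm_le order_refl)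
    finally show ?thesis by (simp add: norm_mult)
  qed
  finally show ?thesis
    using r w by (simp add: F_def v_def r_def [symmetric] mult_left_mono sum_nonneg)
qed

text \<open>Selberg's square. It is nonnegative whatever the coefficients, and it is 1 at each prime
  above \<open>D\<close> when \<open>c 1 = 1\<close>; so it majorises the indicator of those primes
  while remaining a divisor sum, accessible to geometric series.\<close>

definition sieve_weight :: "(nat \<Rightarrow> real) \<Rightarrow> nat \<Rightarrow> nat \<Rightarrow> real" where
  "sieve_weight c D a = (\<Sum>d\<in>{d\<in>{1..D}. d dvd a}. c d)\<^sup>2"

lemma sieve_weight_nonneg: "sieve_weight c D a \<ge> 0"
  by (simp add: sieve_weight_def)

lemma sieve_weight_prime:
  assumes "prime p" "D < p" "D \<ge> 1"
  shows "sieve_weight c D p = (c 1)\<^sup>2"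
proof -
  have "{d\<in>{1..D}. d dvd p} = {1}"
    using assms by (auto simp: prime_nat_iff)
  then show ?thesis unfolding sieve_weight_def by simp
qed

lemma sum_multiples:
  fixes g :: "nat \<Rightarrow> 'a::comm_monoid_add"
  assumes "L \<ge> 1"
  shows "(\<Sum>a\<in>{a\<in>{1..A}. L dvd a}. g a) = (\<Sum>j\<in>{1..A div L}. g (L * j))"
  using assms
  by (intro sum.reindex_bij_witness [where i = "\<lambda>j. L * j" and j = "\<lambda>a. a div L"])
     (auto simp: div_le_mono less_eq_div_iff_mult_less_eq mult.commute elim!: dvdE)

text \<open>\<open>d\<close> and \<open>e\<close> both divide \<open>a\<close> exactly when
  \<open>lcm d e\<close> does, so the expanded square becomes a sum over multiples of
  \<open>lcm d e\<close>. The field is left open because the diagonal needs real \<open>v\<close>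
  and the off-diagonal terms complex \<open>v\<close>.\<close>

lemma sieve_weight_power_sum:
  fixes v :: "'a::real_normed_field"
  shows "(\<Sum>a\<in>{1..A}. of_real (sieve_weight c D a) * v ^ a)
    = (\<Sum>d\<in>{1..D}. \<Sum>e\<in>{1..D}. of_real (c d * c e) * (\<Sum>j\<in>{1..A div lcm d e}. (v ^ lcm d e) ^ j))"
proof -
  have w: "of_real (sieve_weight c D a) * v ^ a
      = (\<Sum>d\<in>{1..D}. \<Sum>e\<in>{1..D}. if lcm d e dvd a then of_real (c d * c e) * v ^ a else 0)" for a
  proof -
    have "sieve_weight c D a = (\<Sum>d\<in>{1..D}. \<Sum>e\<in>{1..D}. (if d dvd a then c d else 0) * (if e dvd a then c e else 0))"
      unfolding sieve_weight_def power2_eq_square sum.inter_filter [OF finite_atLeastAtMost] sum_product ..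
    also have "\<dots> = (\<Sum>d\<in>{1..D}. \<Sum>e\<in>{1..D}. if lcm d e dvd a then c d * c e else 0)"
      by (intro sum.cong refl) (simp add: lcm_least_iff)
    finally show ?thesis
      by (simp only: of_real_sum sum_distrib_right) (intro sum.cong refl, simp)
  qed
  have "(\<Sum>a\<in>{1..A}. of_real (sieve_weight c D a) * v ^ a)
      = (\<Sum>d\<in>{1..D}. \<Sum>a\<in>{1..A}. \<Sum>e\<in>{1..D}. if lcm d e dvd a then of_real (c d * c e) * v ^ a else 0)"
    unfolding w by (rule sum.swap)
  also have "\<dots> = (\<Sum>d\<in>{1..D}. \<Sum>e\<in>{1..D}. \<Sum>a\<in>{1..A}. if lcm d e dvd a then of_real (c d * c e) * v ^ a else 0)"
    by (rule sum.cong [OF refl], rule sum.swap)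
  also have "\<dots> = (\<Sum>d\<in>{1..D}. \<Sum>e\<in>{1..D}. of_real (c d * c e) * (\<Sum>j\<in>{1..A div lcm d e}. (v ^ lcm d e) ^ j))"
  proof (intro sum.cong refl)
    fix d e assume "d \<in> {1..D}" "e \<in> {1..D}"
    then have "lcm d e \<ge> 1" by (simp add: Suc_le_eq lcm_pos_nat)
    then have "(\<Sum>a\<in>{a\<in>{1..A}. lcm d e dvd a}. of_real (c d * c e) * v ^ a)
        = (\<Sum>j\<in>{1..A div lcm d e}. of_real (c d * c e) * v ^ (lcm d e * j))"
      by (rule sum_multiples)
    then show "(\<Sum>a\<in>{1..A}. if lcm d e dvd a then of_real (c d * c e) * v ^ a else 0)
        = of_real (c d * c e) * (\<Sum>j\<in>{1..A div lcm d e}. (v ^ lcm d e) ^ j)"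
      unfolding sum.inter_filter [OF finite_atLeastAtMost] by (simp only: sum_distrib_left power_mult)
  qed
  finally show ?thesis .
qed

lemma sum_abs_products_le:
  fixes c :: "nat \<Rightarrow> real"
  assumes c: "\<And>d. d \<in> {1..D} \<Longrightarrow> \<bar>c d\<bar> \<le> K" and H: "\<And>d e. d \<in> {1..D} \<Longrightarrow> e \<in> {1..D} \<Longrightarrow> 0 \<le> H d e \<and> H d e \<le> T"
    and K: "K \<ge> 0"
  shows "(\<Sum>d\<in>{1..D}. \<Sum>e\<in>{1..D}. \<bar>c d * c e\<bar> * H d e) \<le> (real D * K)\<^sup>2 * T"
proof -
  have "(\<Sum>d\<in>{1..D}. \<Sum>e\<in>{1..D}. \<bar>c d * c e\<bar> * H d e) \<le> (\<Sum>d\<in>{1..D}. \<Sum>e\<in>{1..D}. K * K * T)"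
  proof (intro sum_mono)
    fix d e assume de: "d \<in> {1..D}" "e \<in> {1..D}"
    have "\<bar>c d * c e\<bar> \<le> K * K" unfolding abs_mult using c de K by (intro mult_mono) auto
    then show "\<bar>c d * c e\<bar> * H d e \<le> K * K * T"
      using H [OF de] K by (intro mult_mono) auto
  qed
  then show ?thesis by (simp add: power2_eq_square mult_ac)
qed

text \<open>Off the diagonal no cancellation among the coefficients is used: there are
  \<open>D^2\<close> pairs, each of weight at most \<open>K^2\<close>. Since
  \<open>lcm d e \<le> D^2\<close>, only the powers \<open>v ^ L\<close> with
  \<open>L \<le> D^2\<close> have to be controlled.\<close>

lemma norm_sieve_weight_sum_le:
  fixes v :: complex
  assumes c: "\<And>d. d \<in> {1..D} \<Longrightarrow> \<bar>c d\<bar> \<le> K" and K: "K \<ge> 0"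
    and H: "\<And>L n. L \<in> {1..D\<^sup>2} \<Longrightarrow> norm (\<Sum>j\<in>{1..n}. (v ^ L) ^ j) \<le> H"
  shows "norm (\<Sum>a\<in>{1..A}. of_real (sieve_weight c D a) * v ^ a) \<le> (real D * K)\<^sup>2 * H"
proof -
  have "norm (\<Sum>a\<in>{1..A}. of_real (sieve_weight c D a) * v ^ a)
      \<le> (\<Sum>d\<in>{1..D}. \<Sum>e\<in>{1..D}. norm (of_real (c d * c e) * (\<Sum>j\<in>{1..A div lcm d e}. (v ^ lcm d e) ^ j)))"
    unfolding sieve_weight_power_sum by (intro sum_norm_le order_refl)
  also have "\<dots> = (\<Sum>d\<in>{1..D}. \<Sum>e\<in>{1..D}. \<bar>c d * c e\<bar> * norm (\<Sum>j\<in>{1..A div lcm d e}. (v ^ lcm d e) ^ j))"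
    by (simp only: norm_mult norm_of_real)
  also have "\<dots> \<le> (real D * K)\<^sup>2 * H"
  proof (rule sum_abs_products_le [OF c])
    fix d e assume de: "d \<in> {1..D}" "e \<in> {1..D}"
    have "lcm d e dvd d * e" by simp
    then have "lcm d e \<le> d * e" using de by (intro dvd_imp_le) auto
    also have "\<dots> \<le> D * D" using de by (intro mult_mono) auto
    finally have "lcm d e \<in> {1..D\<^sup>2}"
      using de by (simp add: power2_eq_square Suc_le_eq lcm_pos_nat)
    then show "0 \<le> norm (\<Sum>j\<in>{1..A div lcm d e}. (v ^ lcm d e) ^ j) \<and>
               norm (\<Sum>j\<in>{1..A div lcm d e}. (v ^ lcm d e) ^ j) \<le> H"
      using H by simp
  qed (use K in auto)
  finally show ?thesis .
qed

text \<open>Signed coefficients forbid estimating the truncated inner series one by one from above.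
  But the weight is nonnegative, so the sum grows with \<open>A\<close> and is at most its limit;
  there each series is \<open>1 / (u * lcm d e)\<close> up to an error of at most 1, and the main
  terms reassemble into the quadratic form.\<close>

lemma sieve_weight_exp_sum_le:
  assumes c: "\<And>d. d \<in> {1..D} \<Longrightarrow> \<bar>c d\<bar> \<le> K" and K: "K \<ge> 0" and u: "u > 0"
  shows "(\<Sum>a\<in>{1..A}. sieve_weight c D a * exp (- u) ^ a)
     \<le> (\<Sum>d\<in>{1..D}. \<Sum>e\<in>{1..D}. c d * c e / real (lcm d e)) / u + (real D * K)\<^sup>2"
proof -
  define f where "f n = (\<Sum>a\<in>{1..n}. sieve_weight c D a * exp (- u) ^ a)" for n
  define h where "h L = exp (- (u * real L)) / (1 - exp (- (u * real L)))" for L :: nat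
  have f: "f n = (\<Sum>d\<in>{1..D}. \<Sum>e\<in>{1..D}. c d * c e * (\<Sum>j\<in>{1..n div lcm d e}. (exp (- (u * real (lcm d e)))) ^ j))" for n
    using sieve_weight_power_sum [where v = "exp (- u)" and c = c and D = D and A = n]
    by (simp add: f_def exp_of_nat_mult [symmetric] mult_ac)
  have "incseq f" unfolding f_def
    by (intro incseq_SucI) (simp add: sieve_weight_nonneg)
  have lim: "(\<lambda>n. \<Sum>j\<in>{1..n div L}. (exp (- (u * real L))) ^ j) \<longlonglongrightarrow> h L" if "L \<ge> 1" for L
  proof -
    define x where "x = exp (- (u * real L))"
    have x: "0 < x" "x < 1" using u that by (auto simp: x_def)
    have "(\<lambda>n. x ^ Suc n) \<longlonglongrightarrow> 0" using x by (intro LIMSEQ_Suc LIMSEQ_power_zero) auto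
    moreover have "filterlim (\<lambda>n. n div L) sequentially sequentially"
      unfolding filterlim_at_top
    proof
      fix Z
      show "\<forall>\<^sub>F n in sequentially. Z \<le> n div L"
        using that by (intro eventually_sequentiallyI [of "Z * L"]) (simp add: less_eq_div_iff_mult_less_eq)
    qed
    ultimately have "(\<lambda>n. x ^ Suc (n div L)) \<longlonglongrightarrow> 0" by (rule filterlim_compose)
    then have "(\<lambda>n. (x - x ^ Suc (n div L)) / (1 - x)) \<longlonglongrightarrow> (x - 0) / (1 - x)"
      using x by (intro tendsto_intros) auto
    moreover have "(x - x ^ Suc m) / (1 - x) = (\<Sum>j\<in>{1..m}. x ^ j)" for m
    proof (cases "m \<ge> 1")
      case True
      then have "(1 - x) * (\<Sum>j\<in>{1..m}. x ^ j) = x ^ 1 - x ^ Suc m" by (rule sum_gp_multiplied)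
      then show ?thesis using x by (subst divide_eq_eq) (auto simp: mult.commute)
    next
      case False
      then have "m = 0" by simp
      then show ?thesis by simp
    qed
    ultimately show ?thesis by (simp add: h_def x_def)
  qed
  have "f \<longlonglongrightarrow> (\<Sum>d\<in>{1..D}. \<Sum>e\<in>{1..D}. c d * c e * h (lcm d e))"
    unfolding f
    by (intro tendsto_sum tendsto_mult tendsto_const lim) (auto simp: Suc_le_eq lcm_pos_nat)
  then have "f A \<le> (\<Sum>d\<in>{1..D}. \<Sum>e\<in>{1..D}. c d * c e * h (lcm d e))"
    using \<open>incseq f\<close> by (rule incseq_le [rotated])
  also have "\<dots> \<le> (\<Sum>d\<in>{1..D}. \<Sum>e\<in>{1..D}. c d * c e / real (lcm d e) / u + \<bar>c d * c e\<bar> * 1)"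
  proof (intro sum_mono)
    fix d e assume de: "d \<in> {1..D}" "e \<in> {1..D}"
    then have "lcm d e \<ge> 1" by (simp add: Suc_le_eq lcm_pos_nat)
    then have "\<bar>h (lcm d e) - 1 / (u * real (lcm d e))\<bar> \<le> 1"
      unfolding h_def using u by (intro exp_geometric_limit_bounds) auto
    then have "\<bar>c d * c e\<bar> * \<bar>h (lcm d e) - 1 / (u * real (lcm d e))\<bar> \<le> \<bar>c d * c e\<bar> * 1"
      by (intro mult_left_mono) auto
    then have "c d * c e * (h (lcm d e) - 1 / (u * real (lcm d e))) \<le> \<bar>c d * c e\<bar> * 1"
      unfolding abs_mult [symmetric] by linarith
    then show "c d * c e * h (lcm d e) \<le> c d * c e / real (lcm d e) / u + \<bar>c d * c e\<bar> * 1"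
      by (simp add: right_diff_distrib mult.commute)
  qed
  also have "\<dots> = (\<Sum>d\<in>{1..D}. \<Sum>e\<in>{1..D}. c d * c e / real (lcm d e)) / u
      + (\<Sum>d\<in>{1..D}. \<Sum>e\<in>{1..D}. \<bar>c d * c e\<bar> * 1)"
    by (simp only: sum.distrib sum_divide_distrib)
  also have "(\<Sum>d\<in>{1..D}. \<Sum>e\<in>{1..D}. \<bar>c d * c e\<bar> * 1) \<le> (real D * K)\<^sup>2 * 1"
    by (rule sum_abs_products_le [OF c]) (use K in auto)
  finally show ?thesis by (simp add: f_def)
qed

section \<open>Multiples of a number with a large denominator\<close>

text \<open>All that is kept of a rational approximation \<open>a / q\<close>: the numerator has
  disappeared, and only multiples up to \<open>q / 2\<close> are considered, so that the error of
  the approximation takes away at most half of the gap \<open>1 / q\<close>.\<close>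

definition separated :: "real \<Rightarrow> nat \<Rightarrow> bool" where
  "separated \<alpha> q \<longleftrightarrow> q > 0 \<and> (\<forall>l::nat. 0 < l \<and> 2 * l \<le> q \<longrightarrow> 1 / (2 * real q) \<le> nint_dist (real l * \<alpha>))"

text \<open>For \<open>n\<close> the integer nearest to \<open>l * \<alpha>\<close>, the integer
  \<open>l * a - q * n\<close> is nonzero because \<open>q\<close> does not divide \<open>l\<close>.
  It equals \<open>q * (l * \<alpha> - n) - l * (q * \<alpha> - a)\<close>, whose second part is at
  most \<open>l / M \<le> 1 / 2\<close>.\<close>

lemma separatedI:
  fixes a :: int
  assumes "coprime a (int q)" "0 < q" "real q \<le> M" "\<bar>real q * \<alpha> - of_int a\<bar> < 1 / M"
  shows "separated \<alpha> q"
  unfolding separated_def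
proof (intro conjI allI impI)
  fix l :: nat
  assume l: "0 < l \<and> 2 * l \<le> q"
  define n where "n = round (real l * \<alpha>)"
  have M: "M > 0" using assms by linarith
  have ne: "int l * a - int q * n \<noteq> 0"
  proof
    assume "int l * a - int q * n = 0"
    then have "int q dvd int l * a" by (metis dvd_triv_left eq_iff_diff_eq_0)
    then have "int q dvd int l"
      using assms(1) by (simp add: coprime_commute coprime_dvd_mult_left_iff)
    then have "q dvd l" by simp
    then show False using l by (auto dest: dvd_imp_le)
  qed
  have "1 \<le> \<bar>real_of_int (int l * a - int q * n)\<bar>" using ne by linarith
  also have "real_of_int (int l * a - int q * n) = real q * (real l * \<alpha> - of_int n) - real l * (real q * \<alpha> - of_int a)"
    by (simp add: algebra_simps)
  also have "\<bar>\<dots>\<bar> \<le> real q * \<bar>real l * \<alpha> - of_int n\<bar> + real l * \<bar>real q * \<alpha> - of_int a\<bar>"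
    by (rule order_trans [OF abs_triangle_ineq4]) (simp add: abs_mult)
  also have "real l * \<bar>real q * \<alpha> - of_int a\<bar> \<le> real l * (1 / M)"
    using assms by (intro mult_left_mono) auto
  also have "\<dots> \<le> 1 / 2" using l assms M by (simp add: field_simps)
  finally have "1 / 2 \<le> real q * \<bar>real l * \<alpha> - of_int n\<bar>" by simp
  then show "1 / (2 * real q) \<le> nint_dist (real l * \<alpha>)"
    using assms(2) by (simp add: nint_dist_def n_def field_simps)
qed (use assms in simp)

text \<open>Points of \<open>[0, 1/2]\<close> with gaps at least \<open>1 / (2 * q)\<close> fall
  into different cells of length \<open>1 / (2 * q)\<close>. In cell 0 the bound \<open>T\<close> is
  used; in cell \<open>j > 0\<close> the point is at least \<open>j / (2 * q)\<close>, and these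
  terms add up to a harmonic sum.\<close>

lemma sum_residues_one_side:
  fixes G s :: "nat \<Rightarrow> real"
  assumes fin: "finite I" and q: "q > 0" and T: "T \<ge> 0" and E: "E \<ge> 0"
    and s: "\<And>l. l \<in> I \<Longrightarrow> 0 \<le> s l \<and> s l \<le> 1 / 2"
    and sep: "\<And>l l'. l \<in> I \<Longrightarrow> l' \<in> I \<Longrightarrow> l \<noteq> l' \<Longrightarrow> 1 / (2 * real q) \<le> \<bar>s l - s l'\<bar>"
    and GT: "\<And>l. l \<in> I \<Longrightarrow> G l \<le> T" and GE: "\<And>l. l \<in> I \<Longrightarrow> s l > 0 \<Longrightarrow> G l \<le> E / s l"
  shows "sum G I \<le> T + 2 * real q * E * harm q"
proof -
  define m where "m l = nat \<lfloor>2 * real q * s l\<rfloor>" for l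
  have fl: "real (m l) = of_int \<lfloor>2 * real q * s l\<rfloor>" if "l \<in> I" for l
    using s [OF that] q by (simp add: m_def)
  have inj: "inj_on m I"
  proof (rule inj_onI, rule ccontr)
    fix l l' assume l: "l \<in> I" "l' \<in> I" "m l = m l'" "l \<noteq> l'"
    then have "real_of_int \<lfloor>2 * real q * s l\<rfloor> = of_int \<lfloor>2 * real q * s l'\<rfloor>" using fl by metis
    then have "\<bar>2 * real q * s l - 2 * real q * s l'\<bar> < 1" by linarith
    moreover have "\<bar>2 * real q * s l - 2 * real q * s l'\<bar> = 2 * real q * \<bar>s l - s l'\<bar>"
      by (simp add: right_diff_distrib [symmetric] abs_mult)
    moreover have "2 * real q * (1 / (2 * real q)) \<le> 2 * real q * \<bar>s l - s l'\<bar>"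
      using sep l by (intro mult_left_mono) auto
    ultimately show False using q by simp
  qed
  define g where "g j = (if j = 0 then T else 2 * real q * E / real j)" for j :: nat
  have "sum G I \<le> (\<Sum>l\<in>I. g (m l))"
  proof (rule sum_mono)
    fix l assume l: "l \<in> I"
    show "G l \<le> g (m l)"
    proof (cases "m l = 0")
      case True
      then show ?thesis using GT l by (simp add: g_def)
    next
      case False
      have le: "real (m l) \<le> 2 * real q * s l" using fl [OF l] by linarith
      have sp: "s l > 0"
      proof (rule ccontr)
        assume "\<not> s l > 0"
        then have "s l = 0" using s l by force
        then show False using le False by simp
      qed
      have "G l \<le> E / s l" using GE l sp by blast
      also have "E / s l = 2 * real q * E / (2 * real q * s l)" using q by simp
      also have "\<dots> \<le> 2 * real q * E / real (m l)"
        using le sp q E False by (intro divide_left_mono) auto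
      finally show ?thesis using False by (simp add: g_def)
    qed
  qed
  also have "\<dots> = sum g (m ` I)" using inj by (simp add: sum.reindex)
  also have "\<dots> \<le> sum g {0..q}"
  proof (rule sum_mono2)
    show "m ` I \<subseteq> {0..q}"
    proof
      fix j assume "j \<in> m ` I"
      then obtain l where l: "l \<in> I" "j = m l" by auto
      have "2 * real q * s l \<le> 2 * real q * (1 / 2)" using s l by (intro mult_left_mono) auto
      then have "real (m l) \<le> real q" using fl [OF l(1)] by linarith
      then show "j \<in> {0..q}" using l by simp
    qed
  qed (use T E in \<open>auto simp: g_def\<close>)
  also have "\<dots> = T + (\<Sum>j\<in>{1..q}. 2 * real q * E / real j)"
    by (subst sum.atLeast_Suc_atMost) (auto simp: g_def intro!: sum.cong)
  also have "(\<Sum>j\<in>{1..q}. 2 * real q * E / real j) = 2 * real q * E * harm q"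
    by (simp add: harm_def sum_distrib_left divide_inverse)
  finally show ?thesis .
qed

text \<open>The signed residues inherit the spacing from \<open>separated\<close>, but their
  absolute values need not: two points on opposite sides of an integer may be equally far from it.
  Hence the split by sign, and the factor 2.\<close>

lemma sum_reciprocal_nint_dist_block:
  fixes G :: "nat \<Rightarrow> real"
  assumes sep: "separated \<alpha> q" and fin: "finite I"
    and I: "\<And>l l'. l \<in> I \<Longrightarrow> l' \<in> I \<Longrightarrow> l < l' \<Longrightarrow> 2 * (l' - l) \<le> q"
    and T: "T \<ge> 0" and E: "E \<ge> 0" and GT: "\<And>l. l \<in> I \<Longrightarrow> G l \<le> T"
    and GE: "\<And>l. l \<in> I \<Longrightarrow> nint_dist (real l * \<alpha>) > 0 \<Longrightarrow> G l \<le> E / nint_dist (real l * \<alpha>)"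
  shows "sum G I \<le> 2 * (T + 2 * real q * E * harm q)"
proof -
  define s where "s l = real l * \<alpha> - of_int (round (real l * \<alpha>))" for l :: nat
  have q: "q > 0" using sep by (simp add: separated_def)
  have abs_s: "\<bar>s l\<bar> = nint_dist (real l * \<alpha>)" for l by (simp add: s_def nint_dist_def)
  have half: "\<bar>s l\<bar> \<le> 1 / 2" for l
    using of_int_round_abs_le [of "real l * \<alpha>"] by (simp add: s_def abs_minus_commute)
  have diff: "1 / (2 * real q) \<le> \<bar>s l - s l'\<bar>" if "l \<in> I" "l' \<in> I" "l \<noteq> l'" for l l'
  proof -
    have *: "1 / (2 * real q) \<le> \<bar>s l - s l'\<bar>" if l: "l \<in> I" "l' \<in> I" "l < l'" for l l'
    proof -
      have "1 / (2 * real q) \<le> nint_dist (real (l' - l) * \<alpha>)"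
        using sep I [OF l] l unfolding separated_def by (metis zero_less_diff)
      also have "\<dots> \<le> \<bar>real (l' - l) * \<alpha> - of_int (round (real l' * \<alpha>) - round (real l * \<alpha>))\<bar>"
        by (rule nint_dist_le)
      also have "real (l' - l) * \<alpha> - of_int (round (real l' * \<alpha>) - round (real l * \<alpha>)) = s l' - s l"
        using l by (simp add: s_def of_nat_diff algebra_simps)
      finally show ?thesis by (simp add: abs_minus_commute)
    qed
    show ?thesis using * [of l l'] * [of l' l] that by (cases l l' rule: linorder_cases) (auto simp: abs_minus_commute)
  qed
  have 1: "sum G {l\<in>I. s l \<ge> 0} \<le> T + 2 * real q * E * harm q"
  proof (rule sum_residues_one_side [where s = s])
    fix l assume "l \<in> {l\<in>I. s l \<ge> 0}"
    then have l: "s l = nint_dist (real l * \<alpha>)" "l \<in> I" "0 \<le> s l" using abs_s [of l] by auto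
    then show "s l > 0 \<Longrightarrow> G l \<le> E / s l" using GE by metis
    show "0 \<le> s l \<and> s l \<le> 1 / 2" using half [of l] l(3) by linarith
    show "G l \<le> T" using GT \<open>l \<in> I\<close> .
  next
    fix l l' assume "l \<in> {l\<in>I. s l \<ge> 0}" "l' \<in> {l\<in>I. s l \<ge> 0}" "l \<noteq> l'"
    then show "1 / (2 * real q) \<le> \<bar>s l - s l'\<bar>" using diff [of l l'] by simp
  qed (use fin q T E in auto)
  have 2: "sum G {l\<in>I. \<not> s l \<ge> 0} \<le> T + 2 * real q * E * harm q"
  proof (rule sum_residues_one_side [where s = "\<lambda>l. - s l"])
    fix l assume neg: "l \<in> {l\<in>I. \<not> s l \<ge> 0}"
    then have "- s l = nint_dist (real l * \<alpha>)" "l \<in> I" using abs_s [of l] by auto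
    then show "- s l > 0 \<Longrightarrow> G l \<le> E / (- s l)" using GE by metis
    show "0 \<le> - s l \<and> - s l \<le> 1 / 2" using half [of l] neg by auto
    show "G l \<le> T" using GT \<open>l \<in> I\<close> .
  next
    fix l l' assume l: "l \<in> {l\<in>I. \<not> s l \<ge> 0}" "l' \<in> {l\<in>I. \<not> s l \<ge> 0}" "l \<noteq> l'"
    have "\<bar>- s l - - s l'\<bar> = \<bar>s l - s l'\<bar>" by linarith
    then show "1 / (2 * real q) \<le> \<bar>- s l - - s l'\<bar>" using diff [of l l'] l by simp
  qed (use fin q T E in auto)
  have "sum G I = sum G {l\<in>I. s l \<ge> 0} + sum G {l\<in>I. \<not> s l \<ge> 0}"
    using fin by (subst sum.union_disjoint [symmetric]) (auto intro!: sum.cong)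
  also have "\<dots> \<le> (T + 2 * real q * E * harm q) + (T + 2 * real q * E * harm q)"
    using 1 2 by (rule add_mono)
  finally show ?thesis by (simp only: mult_2)
qed

text \<open>Among \<open>q div 2 + 1\<close> consecutive indices any two differ by at most
  \<open>q / 2\<close>, so the spacing applies within such a block; there are at most
  \<open>2 * H / q + 1\<close> blocks.\<close>

lemma sum_reciprocal_nint_dist:
  fixes G :: "nat \<Rightarrow> real"
  assumes sep: "separated \<alpha> q" and T: "T \<ge> 0" and E: "E \<ge> 0" and GT: "\<And>l. G l \<le> T"
    and GE: "\<And>l. nint_dist (real l * \<alpha>) > 0 \<Longrightarrow> G l \<le> E / nint_dist (real l * \<alpha>)"
  shows "sum G {1..H} \<le> (2 * real H / real q + 1) * (2 * (T + 2 * real q * E * harm q))"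
proof -
  define w where "w = q div 2 + 1"
  have q: "q > 0" using sep by (simp add: separated_def)
  have "q \<le> 2 * w" unfolding w_def by presburger
  then have "real q \<le> real (2 * w)" by (rule of_nat_mono)
  then have w: "w > 0" "real q \<le> 2 * real w" by (simp_all add: w_def)
  have "sum G {1..H} = (\<Sum>i\<in>{0..H div w}. sum G {l\<in>{1..H}. l div w = i})"
  proof (rule sum.group [symmetric])
    show "(\<lambda>l. l div w) ` {1..H} \<subseteq> {0..H div w}"
      by (rule image_subsetI) (simp add: div_le_mono)
  qed simp_all
  also have "\<dots> \<le> (\<Sum>i\<in>{0..H div w}. 2 * (T + 2 * real q * E * harm q))"
  proof (intro sum_mono sum_reciprocal_nint_dist_block [OF sep _ _ T E])
    fix i l l' assume l: "l \<in> {l\<in>{1..H}. l div w = i}" "l' \<in> {l\<in>{1..H}. l div w = i}" "l < l'"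
    have "l' - l < w"
    proof -
      have "l' div w < i + 1" "i \<le> l div w" using l by auto
      then have "l' < (i + 1) * w" "i * w \<le> l"
        using w(1) by (simp_all only: div_less_iff_less_mult less_eq_div_iff_mult_less_eq)
      then show ?thesis using l(3) by (simp add: algebra_simps)
    qed
    then show "2 * (l' - l) \<le> q" by (simp add: w_def)
  qed (use GT GE in auto)
  also have "\<dots> = (real (H div w) + 1) * (2 * (T + 2 * real q * E * harm q))" by simp
  also have "\<dots> \<le> (2 * real H / real q + 1) * (2 * (T + 2 * real q * E * harm q))"
  proof (rule mult_right_mono)
    have "real (H div w) \<le> real H / real w" by (rule of_nat_div_le_of_nat)
    also have "\<dots> \<le> real H / (real q / 2)" using w q by (intro divide_left_mono) auto
    finally show "real (H div w) + 1 \<le> 2 * real H / real q + 1" by (simp add: mult.commute)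
  qed (use T E in \<open>auto intro!: add_nonneg_nonneg mult_nonneg_nonneg simp: harm_nonneg\<close>)
  finally show ?thesis .
qed

section \<open>Bilinear sums over a dyadic block\<close>

text \<open>For fixed \<open>b\<close> each positive difference occurs at most once on either side
  of \<open>b\<close>, and \<open>B\<close> has at most \<open>P\<close> elements. The absolute
  difference appears as \<open>max b b' - min b b'\<close> because subtraction of naturals is
  truncated.\<close>

lemma sum_pair_differences_le:
  fixes g :: "nat \<Rightarrow> real"
  assumes B: "B \<subseteq> {P..<2 * P}" and g: "\<And>h. g h \<ge> 0"
  shows "(\<Sum>b\<in>B. \<Sum>b'\<in>B - {b}. g (max b b' - min b b')) \<le> 2 * real P * (\<Sum>h\<in>{1..P}. g h)"
proof -
  have fin: "finite B" using B by (rule finite_subset) simp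
  have card: "real (card B) \<le> real P" using card_mono [OF _ B] by simp
  have "(\<Sum>b'\<in>B - {b}. g (max b b' - min b b')) \<le> 2 * (\<Sum>h\<in>{1..P}. g h)" if b: "b \<in> B" for b
  proof -
    have side: "(\<Sum>b'\<in>S. g (max b b' - min b b')) \<le> (\<Sum>h\<in>{1..P}. g h)"
      if S: "S \<subseteq> B - {b}" and inj: "inj_on (\<lambda>b'. max b b' - min b b') S" for S
    proof -
      have "(\<Sum>b'\<in>S. g (max b b' - min b b')) = sum g ((\<lambda>b'. max b b' - min b b') ` S)"
        using inj by (simp add: sum.reindex)
      also have "\<dots> \<le> sum g {1..P}"
      proof (rule sum_mono2)
        show "(\<lambda>b'. max b b' - min b b') ` S \<subseteq> {1..P}"
        proof (rule image_subsetI)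
          fix b' assume "b' \<in> S"
          then have "b' \<in> {P..<2 * P}" "b \<in> {P..<2 * P}" "b \<noteq> b'" using S B b by auto
          then show "max b b' - min b b' \<in> {1..P}" by (auto simp: max_def min_def)
        qed
      qed (use g in auto)
      finally show ?thesis .
    qed
    have "(\<Sum>b'\<in>B - {b}. g (max b b' - min b b'))
        = (\<Sum>b'\<in>{b'\<in>B. b' < b}. g (max b b' - min b b')) + (\<Sum>b'\<in>{b'\<in>B. b < b'}. g (max b b' - min b b'))"
      using fin by (subst sum.union_disjoint [symmetric]) (auto intro!: sum.cong)
    also have "\<dots> \<le> (\<Sum>h\<in>{1..P}. g h) + (\<Sum>h\<in>{1..P}. g h)"
      by (intro add_mono side) (auto simp: inj_on_def max_def min_def)
    finally show ?thesis by simp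
  qed
  then have "(\<Sum>b\<in>B. \<Sum>b'\<in>B - {b}. g (max b b' - min b b')) \<le> (\<Sum>b\<in>B. 2 * (\<Sum>h\<in>{1..P}. g h))"
    by (rule sum_mono)
  also have "\<dots> = real (card B) * (2 * (\<Sum>h\<in>{1..P}. g h))" by simp
  also have "\<dots> \<le> real P * (2 * (\<Sum>h\<in>{1..P}. g h))"
    using card g by (intro mult_right_mono) (auto intro: sum_nonneg)
  finally show ?thesis by (simp add: mult_ac)
qed

text \<open>The two cutoffs \<open>a * b \<le> N\<close> and \<open>a * b' \<le> N\<close> amount to
  \<open>a \<le> N div max b b'\<close>. So estimates uniform in a cutoff \<open>A\<close> are
  enough, with one bound \<open>\<Delta>\<close> for \<open>b = b'\<close> and otherwise a bound
  that depends only on the difference.\<close>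

lemma bilinear_sum_le:
  fixes w :: "nat \<Rightarrow> real" and c :: "nat \<Rightarrow> complex" and r K \<Delta> :: real and g :: "nat \<Rightarrow> real"
  assumes w: "\<And>a. w a \<ge> 0" and B: "B \<subseteq> {P..<2 * P}" and z: "z \<noteq> 0"
    and c: "\<And>b. b \<in> B \<Longrightarrow> norm (c b) \<le> K"
    and diag: "\<And>b A. b \<in> B \<Longrightarrow> norm (\<Sum>a\<in>{1..A}. of_real (w a) * (z ^ b * cnj z ^ b / of_real (norm z) ^ P) ^ a) \<le> \<Delta>"
    and off: "\<And>b b' A. b \<in> B \<Longrightarrow> b' \<in> B \<Longrightarrow> b \<noteq> b' \<Longrightarrow>
      norm (\<Sum>a\<in>{1..A}. of_real (w a) * (z ^ b * cnj z ^ b' / of_real (norm z) ^ P) ^ a) \<le> g (max b b' - min b b')"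
    and g: "\<And>h. g h \<ge> 0" and K: "K \<ge> 0" and \<Delta>: "\<Delta> \<ge> 0" and P: "P > 0"
  shows "(\<Sum>a\<in>{1..N}. w a * norm (\<Sum>b\<in>{b\<in>B. a * b \<le> N}. c b * z ^ (a * b)))\<^sup>2
    \<le> (\<Sum>a\<in>{1..N}. w a * (norm z ^ P) ^ a) * (K\<^sup>2 * (real P * \<Delta> + 2 * real P * (\<Sum>h\<in>{1..P}. g h)))"
proof -
  have fin: "finite B" using B by (rule finite_subset) simp
  have card: "real (card B) \<le> real P" using card_mono [OF _ B] by simp
  define v where "v b b' = z ^ b * cnj z ^ b' / of_real (norm z) ^ P" for b b'
  define R where "R b b' = norm (\<Sum>a\<in>{a\<in>{1..N}. a * b \<le> N \<and> a * b' \<le> N}. of_real (w a) * v b b' ^ a)" for b b'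
  have set: "{a\<in>{1..N}. a * b \<le> N \<and> a * b' \<le> N} = {1..N div max b b'}" if "b \<in> B" "b' \<in> B" for b b'
  proof -
    have "b > 0" "b' > 0" using that B P by force+
    then have iff: "a * b \<le> N \<and> a * b' \<le> N \<longleftrightarrow> a \<le> N div max b b'" for a
      by (simp add: less_eq_div_iff_mult_less_eq max_def) (meson le_trans mult_le_mono2 nat_le_linear)
    have "N div max b b' \<le> N" by simp
    then show ?thesis
      unfolding set_eq_iff mem_Collect_eq atLeastAtMost_iff iff using order_trans by blast
  qed
  have Rd: "R b b \<le> \<Delta>" if "b \<in> B" for b
    unfolding R_def set [OF that that] v_def using diag that by blast
  have Ro: "R b b' \<le> g (max b b' - min b b')" if "b \<in> B" "b' \<in> B" "b \<noteq> b'" for b b'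
    unfolding R_def set [OF that(1,2)] v_def using off that by blast
  have "(\<Sum>b\<in>B. \<Sum>b'\<in>B. norm (c b) * norm (c b') * R b b') \<le> (\<Sum>b\<in>B. \<Sum>b'\<in>B. K * K * R b b')"
    using c K by (intro sum_mono mult_right_mono mult_mono) (auto simp: R_def)
  also have "\<dots> = K\<^sup>2 * (\<Sum>b\<in>B. R b b + (\<Sum>b'\<in>B - {b}. R b b'))"
    using fin by (simp add: sum_distrib_left [symmetric] power2_eq_square sum.remove [symmetric])
  also have "(\<Sum>b\<in>B. R b b + (\<Sum>b'\<in>B - {b}. R b b'))
      \<le> (\<Sum>b\<in>B. \<Delta>) + (\<Sum>b\<in>B. \<Sum>b'\<in>B - {b}. g (max b b' - min b b'))"
    unfolding sum.distrib using Rd Ro by (intro add_mono sum_mono) auto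
  also have "\<dots> \<le> real P * \<Delta> + 2 * real P * (\<Sum>h\<in>{1..P}. g h)"
    using card \<Delta> sum_pair_differences_le [OF B, of g] g by (intro add_mono) (auto intro: mult_right_mono)
  finally have main: "(\<Sum>b\<in>B. \<Sum>b'\<in>B. norm (c b) * norm (c b') * R b b')
      \<le> K\<^sup>2 * (real P * \<Delta> + 2 * real P * (\<Sum>h\<in>{1..P}. g h))"
    by (simp add: mult_left_mono)
  have "(\<Sum>a\<in>{1..N}. w a * norm (\<Sum>b\<in>{b\<in>B. a * b \<le> N}. c b * z ^ (a * b)))\<^sup>2
      \<le> (\<Sum>a\<in>{1..N}. w a * norm z ^ (a * P)) * (\<Sum>b\<in>B. \<Sum>b'\<in>B. norm (c b) * norm (c b') * R b b')"
    unfolding R_def v_def using w fin z by (rule bilinear_cauchy)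
  also have "(\<Sum>a\<in>{1..N}. w a * norm z ^ (a * P)) = (\<Sum>a\<in>{1..N}. w a * (norm z ^ P) ^ a)"
    by (simp add: power_mult [symmetric] mult.commute)
  also have "\<dots> * (\<Sum>b\<in>B. \<Sum>b'\<in>B. norm (c b) * norm (c b') * R b b')
      \<le> \<dots> * (K\<^sup>2 * (real P * \<Delta> + 2 * real P * (\<Sum>h\<in>{1..P}. g h)))"
    using w main by (intro mult_left_mono sum_nonneg) auto
  finally show ?thesis .
qed

lemma ratio_polar_form:
  assumes z: "z = of_real (exp (- 1 / Y)) * ee \<beta>"
  shows "z ^ b * cnj z ^ b' / of_real (norm z) ^ P
       = of_real (exp (- ((real b + real b' - real P) / Y))) * ee ((real b - real b') * \<beta>)"
proof -
  have n: "norm z = exp (- 1 / Y)" by (simp add: z norm_mult)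
  have zb: "z ^ b = of_real (exp (- (real b / Y))) * ee (real b * \<beta>)" for b
    by (simp add: z power_mult_distrib ee_power of_real_power [symmetric] exp_of_nat_mult [symmetric] del: of_real_power)
  have cz: "cnj z ^ b' = of_real (exp (- (real b' / Y))) * ee (- real b' * \<beta>)"
    using arg_cong [OF zb [of b'], of cnj] by (simp add: cnj_ee)
  have nP: "complex_of_real (norm z) ^ P = of_real (exp (- (real P / Y)))"
    unfolding n by (simp add: of_real_power [symmetric] exp_of_nat_mult [symmetric] del: of_real_power)
  have "exp (- ((real b + real b' - real P) / Y)) = exp (- (real b / Y)) * exp (- (real b' / Y)) / exp (- (real P / Y))"
    by (simp add: exp_add [symmetric] exp_diff [symmetric] diff_divide_distrib add_divide_distrib)
  then show ?thesis
    unfolding zb cz nP by (simp add: left_diff_distrib ee_add [symmetric] del: of_real_exp)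
qed

lemma nint_dist_difference:
  "nint_dist ((real b - real b') * \<beta>) = nint_dist (real (max b b' - min b b') * \<beta>)"
proof (cases "b' \<le> b")
  case True
  then show ?thesis by (simp add: of_nat_diff max_def min_def)
next
  case False
  then have "(real b - real b') * \<beta> = - (real (max b b' - min b b') * \<beta>)"
    by (simp add: of_nat_diff max_def min_def algebra_simps)
  then show ?thesis by (simp add: nint_dist_minus)
qed

text \<open>With unit weights both the first factor and the diagonal series are at most
  \<open>Y / P\<close>. The case distinction in \<open>G\<close> guards against
  \<open>2 / 0 = 0\<close>, which would make the minimum a false bound where the multiple of
  \<open>\<beta>\<close> is an integer.\<close>

lemma bilinear_block_le:
  fixes c :: "nat \<Rightarrow> complex" and G :: "nat \<Rightarrow> real"
  assumes z: "z = of_real (exp (- 1 / Y)) * ee \<beta>" and Y: "Y > 0"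
    and B: "B \<subseteq> {P..<2 * P}" and P: "P > 0"
    and c: "\<And>b. b \<in> B \<Longrightarrow> norm (c b) \<le> K" and K: "K \<ge> 0"
    and G: "\<And>h. G h = (if nint_dist (real h * \<beta>) = 0 then Y / real P else min (Y / real P) (2 / nint_dist (real h * \<beta>)))"
  shows "(\<Sum>a\<in>{1..N}. norm (\<Sum>b\<in>{b\<in>B. a * b \<le> N}. c b * z ^ (a * b)))\<^sup>2
    \<le> K\<^sup>2 * (Y\<^sup>2 / real P + 2 * Y * (\<Sum>h\<in>{1..P}. G h))"
proof -
  have n: "norm z = exp (- 1 / Y)" by (simp add: z norm_mult)
  then have z0: "z \<noteq> 0" by auto
  have G0: "G h \<ge> 0" for h
    using Y by (simp add: G nint_dist_nonneg)
  have triv: "norm (\<Sum>a\<in>{1..A}. (of_real (exp (- ((real b + real b' - real P) / Y))) * ee \<theta>) ^ a) \<le> Y / real P"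
    if "b \<in> B" "b' \<in> B" for b b' A \<theta>
  proof -
    define u where "u = (real b + real b' - real P) / Y"
    have "real P \<le> real b" "real P \<le> real b'" using that B by auto
    then have "real P / Y \<le> u" unfolding u_def using Y by (intro divide_right_mono) auto
    moreover have "real P / Y > 0" using P Y by simp
    ultimately have u: "u > 0" "real P / Y \<le> u" "real P / Y > 0" by linarith+
    have "1 / u \<le> 1 / (real P / Y)"
      by (rule divide_left_mono [OF u(2) _ mult_pos_pos [OF u(1,3)]]) simp
    then have "1 / u \<le> Y / real P" by simp
    have "norm (\<Sum>a\<in>{1..A}. (of_real (exp (- u)) * ee \<theta>) ^ a) \<le> (\<Sum>a\<in>{1..A}. exp (- u) ^ a)"
      by (rule order_trans [OF norm_sum]) (simp add: norm_power norm_mult)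
    also have "\<dots> \<le> 1 / u" using u by (intro exp_geometric_sum_le)
    finally show ?thesis using \<open>1 / u \<le> Y / real P\<close> unfolding u_def by linarith
  qed
  have "(\<Sum>a\<in>{1..N}. 1 * norm (\<Sum>b\<in>{b\<in>B. a * b \<le> N}. c b * z ^ (a * b)))\<^sup>2
    \<le> (\<Sum>a\<in>{1..N}. 1 * (norm z ^ P) ^ a) * (K\<^sup>2 * (real P * (Y / real P) + 2 * real P * (\<Sum>h\<in>{1..P}. G h)))"
  proof (rule bilinear_sum_le [where w = "\<lambda>_. 1"])
    fix b A assume "b \<in> B"
    then show "norm (\<Sum>a\<in>{1..A}. of_real 1 * (z ^ b * cnj z ^ b / of_real (norm z) ^ P) ^ a) \<le> Y / real P"
      unfolding ratio_polar_form [OF z] of_real_1 mult_1 by (intro triv)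
  next
    fix b b' A assume b: "b \<in> B" "b' \<in> B" "b \<noteq> b'"
    define s where "s = exp (- ((real b + real b' - real P) / Y))"
    define \<theta> where "\<theta> = (real b - real b') * \<beta>"
    have \<theta>: "nint_dist \<theta> = nint_dist (real (max b b' - min b b') * \<beta>)"
      unfolding \<theta>_def by (rule nint_dist_difference)
    have "real P \<le> real b" "real P \<le> real b'" using b B by auto
    then have s: "s \<le> 1" unfolding s_def using Y by simp
    have "norm (\<Sum>a\<in>{1..A}. (of_real s * ee \<theta>) ^ a) \<le> G (max b b' - min b b')"
    proof (cases "nint_dist \<theta> = 0")
      case True
      then show ?thesis using triv [OF b(1,2)] \<theta> by (simp add: G s_def)
    next
      case False
      then have "nint_dist \<theta> > 0" using nint_dist_nonneg [of \<theta>] by linarith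
      then have "norm (\<Sum>a\<in>{1..A}. (of_real s * ee \<theta>) ^ a) \<le> 2 / nint_dist \<theta>"
        using s by (intro norm_geometric_sum_nint_dist [where s = s]) (auto simp: norm_mult s_def)
      then show ?thesis using triv [OF b(1,2)] \<theta> False by (simp add: G s_def)
    qed
    then show "norm (\<Sum>a\<in>{1..A}. of_real 1 * (z ^ b * cnj z ^ b' / of_real (norm z) ^ P) ^ a) \<le> G (max b b' - min b b')"
      unfolding ratio_polar_form [OF z] of_real_1 mult_1 s_def \<theta>_def .
  qed (use B z0 c G0 K Y P in auto)
  also have "\<dots> \<le> Y / real P * (K\<^sup>2 * (real P * (Y / real P) + 2 * real P * (\<Sum>h\<in>{1..P}. G h)))"
  proof (rule mult_right_mono)
    have "norm z ^ P = exp (- (real P / Y))" by (simp add: n exp_of_nat_mult [symmetric])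
    then have "(\<Sum>a\<in>{1..N}. 1 * (norm z ^ P) ^ a) \<le> 1 / (real P / Y)"
      using exp_geometric_sum_le [of "real P / Y" N] P Y by simp
    then show "(\<Sum>a\<in>{1..N}. 1 * (norm z ^ P) ^ a) \<le> Y / real P" by simp
  qed (use Y G0 in \<open>auto intro!: mult_nonneg_nonneg add_nonneg_nonneg sum_nonneg\<close>)
  also have "\<dots> = K\<^sup>2 * (Y\<^sup>2 / real P + 2 * Y * (\<Sum>h\<in>{1..P}. G h))"
    using P by (simp add: field_simps power2_eq_square)
  finally show ?thesis by simp
qed

text \<open>All indices \<open>h * k\<close> with \<open>h \<le> P\<close> stay within
  \<open>q / 2\<close>, so every off-diagonal series is at most \<open>4 * q\<close>, with no term
  of size \<open>Y / P\<close>. This serves the smallest primes.\<close>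

lemma bilinear_block_short:
  assumes z: "z = of_real (exp (- 1 / Y)) * ee (real k * \<alpha>)" and Y: "Y > 0"
    and B: "B \<subseteq> {P..<2 * P}" and P: "P > 0" and k: "k > 0"
    and c: "\<And>b. b \<in> B \<Longrightarrow> norm (c b) \<le> K" and K: "K \<ge> 0"
    and sep: "separated \<alpha> q" and kP: "2 * (k * P) \<le> q"
  shows "(\<Sum>a\<in>{1..N}. norm (\<Sum>b\<in>{b\<in>B. a * b \<le> N}. c b * z ^ (a * b)))\<^sup>2
    \<le> K\<^sup>2 * (Y\<^sup>2 / real P + 8 * Y * real P * real q)"
proof -
  define G where "G h = (if nint_dist (real h * (real k * \<alpha>)) = 0 then Y / real P
      else min (Y / real P) (2 / nint_dist (real h * (real k * \<alpha>))))" for h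
  have q: "q > 0" using sep by (simp add: separated_def)
  have "(\<Sum>h\<in>{1..P}. G h) \<le> (\<Sum>h\<in>{1..P}. 4 * real q)"
  proof (rule sum_mono)
    fix h assume h: "h \<in> {1..P}"
    then have "2 * (h * k) \<le> 2 * (k * P)" by simp
    then have "2 * (h * k) \<le> q" using kP by linarith
    then have "1 / (2 * real q) \<le> nint_dist (real (h * k) * \<alpha>)"
      using sep h k unfolding separated_def by (metis atLeastAtMost_iff less_eq_Suc_le mult_pos_pos One_nat_def)
    then have d: "1 / (2 * real q) \<le> nint_dist (real h * (real k * \<alpha>))" by (simp add: mult.assoc)
    moreover have "1 / (2 * real q) > 0" using q by simp
    ultimately have pos: "nint_dist (real h * (real k * \<alpha>)) > 0" by (rule less_le_trans [rotated])
    have "2 / nint_dist (real h * (real k * \<alpha>)) \<le> 2 / (1 / (2 * real q))"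
      by (rule divide_left_mono [OF d _ mult_pos_pos [OF pos]]) (use q in auto)
    then show "G h \<le> 4 * real q" using pos by (simp add: G_def)
  qed
  then have le: "(\<Sum>h\<in>{1..P}. G h) \<le> real P * (4 * real q)" by simp
  have "(\<Sum>a\<in>{1..N}. norm (\<Sum>b\<in>{b\<in>B. a * b \<le> N}. c b * z ^ (a * b)))\<^sup>2
      \<le> K\<^sup>2 * (Y\<^sup>2 / real P + 2 * Y * (\<Sum>h\<in>{1..P}. G h))"
    by (rule bilinear_block_le [OF z Y B P c K G_def])
  also have "\<dots> \<le> K\<^sup>2 * (Y\<^sup>2 / real P + 2 * Y * (real P * (4 * real q)))"
    using le Y by (intro mult_left_mono add_left_mono) auto
  finally show ?thesis by (simp add: mult_ac)
qed

text \<open>The multiples \<open>h * k\<close> with \<open>h \<le> P\<close> are enlarged to all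
  \<open>l \<le> k * P\<close>. Nonnegativity of the terms permits this, and the spacing of the
  multiples of \<open>\<alpha>\<close> itself becomes applicable.\<close>

lemma bilinear_block_long:
  assumes z: "z = of_real (exp (- 1 / Y)) * ee (real k * \<alpha>)" and Y: "Y > 0"
    and B: "B \<subseteq> {P..<2 * P}" and P: "P > 0" and k: "k > 0"
    and c: "\<And>b. b \<in> B \<Longrightarrow> norm (c b) \<le> K" and K: "K \<ge> 0"
    and sep: "separated \<alpha> q"
  shows "(\<Sum>a\<in>{1..N}. norm (\<Sum>b\<in>{b\<in>B. a * b \<le> N}. c b * z ^ (a * b)))\<^sup>2
    \<le> K\<^sup>2 * (Y\<^sup>2 / real P + 2 * Y * ((2 * (real k * real P) / real q + 1) * (2 * (Y / real P + 4 * real q * harm q))))"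
proof -
  define G where "G l = (if nint_dist (real l * \<alpha>) = 0 then Y / real P
      else min (Y / real P) (2 / nint_dist (real l * \<alpha>)))" for l
  have G0: "G h \<ge> 0" for h using Y by (simp add: G_def nint_dist_nonneg)
  have "(\<Sum>h\<in>{1..P}. G (h * k)) = sum G ((\<lambda>h. h * k) ` {1..P})"
    using k by (subst sum.reindex) (auto simp: inj_on_def)
  also have "\<dots> \<le> sum G {1..k * P}"
    using G0 k by (intro sum_mono2) auto
  also have "\<dots> \<le> (2 * real (k * P) / real q + 1) * (2 * (Y / real P + 2 * real q * 2 * harm q))"
    by (rule sum_reciprocal_nint_dist [OF sep]) (use Y in \<open>auto simp: G_def\<close>)
  finally have le: "(\<Sum>h\<in>{1..P}. G (h * k)) \<le> (2 * (real k * real P) / real q + 1) * (2 * (Y / real P + 4 * real q * harm q))"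
    by (simp add: mult_ac)
  have "(\<Sum>a\<in>{1..N}. norm (\<Sum>b\<in>{b\<in>B. a * b \<le> N}. c b * z ^ (a * b)))\<^sup>2
      \<le> K\<^sup>2 * (Y\<^sup>2 / real P + 2 * Y * (\<Sum>h\<in>{1..P}. G (h * k)))"
    by (rule bilinear_block_le [OF z Y B P c K]) (simp_all add: G_def mult.assoc)
  also have "\<dots> \<le> K\<^sup>2 * (Y\<^sup>2 / real P + 2 * Y * ((2 * (real k * real P) / real q + 1) * (2 * (Y / real P + 4 * real q * harm q))))"
    using le Y by (intro mult_left_mono add_left_mono) auto
  finally show ?thesis .
qed

text \<open>The sieved sum occurs twice, in the first factor of Cauchy--Schwarz and on the diagonal;
  so the main part carries \<open>V^2\<close> and the square root saves a full \<open>V\<close>. The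
  term \<open>D^6\<close> comes from \<open>D^2\<close> pairs of coefficients, each coefficient of
  size at most \<open>D^2\<close>. Off the diagonal the multiples of \<open>\<alpha>\<close> have
  index \<open>L * h * k\<close> with \<open>L \<le> D^2\<close> and \<open>h \<le> P\<close>, hence
  the assumption on \<open>k * (D^2 * P)\<close>.\<close>

lemma bilinear_block_sieved:
  fixes \<mu> :: "nat \<Rightarrow> real"
  assumes z: "z = of_real (exp (- 1 / Y)) * ee (real k * \<alpha>)" and Y: "Y > 0"
    and B: "B \<subseteq> {P..<2 * P}" and P: "P > 0" and k: "k > 0"
    and c: "\<And>b. b \<in> B \<Longrightarrow> norm (c b) \<le> 1"
    and sep: "separated \<alpha> q" and kP: "2 * (k * (D\<^sup>2 * P)) \<le> q"
    and \<mu>: "\<And>d. d \<in> {1..D} \<Longrightarrow> \<bar>\<mu> d\<bar> \<le> real D ^ 2"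
    and V: "(\<Sum>d\<in>{1..D}. \<Sum>e\<in>{1..D}. \<mu> d * \<mu> e / real (lcm d e)) \<le> V" "V \<ge> 0"
  shows "(\<Sum>a\<in>{1..N}. sieve_weight \<mu> D a * norm (\<Sum>b\<in>{b\<in>B. a * b \<le> N}. c b * z ^ (a * b)))\<^sup>2
    \<le> (V * Y / real P + real D ^ 6) * (real P * (V * Y / real P + real D ^ 6) + 8 * real P * real P * real D ^ 6 * real q)"
proof -
  have n: "norm z = exp (- 1 / Y)" by (simp add: z norm_mult)
  then have z0: "z \<noteq> 0" by auto
  have q: "q > 0" using sep by (simp add: separated_def)
  have D6: "(real D * real D ^ 2)\<^sup>2 = real D ^ 6" by (simp add: power_mult_distrib power_mult [symmetric] power_add [symmetric])
  have real_sum: "(\<Sum>a\<in>{1..A}. sieve_weight \<mu> D a * exp (- u) ^ a) \<le> V * Y / real P + real D ^ 6"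
    if u: "real P / Y \<le> u" for u A
  proof -
    have PY: "real P / Y > 0" using P Y by simp
    then have u0: "u > 0" using u by linarith
    have "(\<Sum>a\<in>{1..A}. sieve_weight \<mu> D a * exp (- u) ^ a)
        \<le> (\<Sum>d\<in>{1..D}. \<Sum>e\<in>{1..D}. \<mu> d * \<mu> e / real (lcm d e)) / u + (real D * real D ^ 2)\<^sup>2"
      by (rule sieve_weight_exp_sum_le) (use \<mu> u0 in auto)
    also have "\<dots> \<le> V / u + real D ^ 6"
      unfolding D6 using V u0 by (intro add_right_mono divide_right_mono) auto
    also have "V / u \<le> V / (real P / Y)"
      by (rule divide_left_mono [OF u V(2) mult_pos_pos [OF u0 PY]])
    finally show ?thesis by simp
  qed
  have nonneg: "V * Y / real P + real D ^ 6 \<ge> 0" using V Y by simp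
  have "(\<Sum>a\<in>{1..N}. sieve_weight \<mu> D a * norm (\<Sum>b\<in>{b\<in>B. a * b \<le> N}. c b * z ^ (a * b)))\<^sup>2
    \<le> (\<Sum>a\<in>{1..N}. sieve_weight \<mu> D a * (norm z ^ P) ^ a) *
       (1\<^sup>2 * (real P * (V * Y / real P + real D ^ 6) + 2 * real P * (\<Sum>h\<in>{1..P}. real D ^ 6 * (4 * real q))))"
  proof (rule bilinear_sum_le [where g = "\<lambda>_. real D ^ 6 * (4 * real q)"])
    fix b A assume b: "b \<in> B"
    define u where "u = (real b + real b - real P) / Y"
    have "real P \<le> real b" using b B by auto
    then have u: "real P / Y \<le> u" unfolding u_def using Y by (intro divide_right_mono) auto
    have "(\<Sum>a\<in>{1..A}. of_real (sieve_weight \<mu> D a) * (z ^ b * cnj z ^ b / of_real (norm z) ^ P) ^ a)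
        = complex_of_real (\<Sum>a\<in>{1..A}. sieve_weight \<mu> D a * exp (- u) ^ a)"
      unfolding ratio_polar_form [OF z] u_def [symmetric] by (simp add: ee_eq_cis)
    moreover have "(\<Sum>a\<in>{1..A}. sieve_weight \<mu> D a * exp (- u) ^ a) \<ge> 0"
      by (intro sum_nonneg) (simp add: sieve_weight_nonneg)
    ultimately show "norm (\<Sum>a\<in>{1..A}. of_real (sieve_weight \<mu> D a) * (z ^ b * cnj z ^ b / of_real (norm z) ^ P) ^ a)
        \<le> V * Y / real P + real D ^ 6"
      using real_sum [OF u, of A] by (simp only: norm_of_real abs_of_nonneg)
  next
    fix b b' A assume b: "b \<in> B" "b' \<in> B" "b \<noteq> b'"
    define h where "h = max b b' - min b b'"
    define s where "s = exp (- ((real b + real b' - real P) / Y))"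
    define \<theta> where "\<theta> = (real b - real b') * (real k * \<alpha>)"
    have "real P \<le> real b" "real P \<le> real b'" using b B by auto
    then have s: "0 \<le> s" "s \<le> 1" unfolding s_def using Y by simp_all
    have "b \<in> {P..<2 * P}" "b' \<in> {P..<2 * P}" using b B by auto
    then have h: "h > 0" "h \<le> P" using b(3) by (auto simp: h_def max_def min_def)
    have "norm (\<Sum>a\<in>{1..A}. of_real (sieve_weight \<mu> D a) * (of_real s * ee \<theta>) ^ a) \<le> (real D * real D ^ 2)\<^sup>2 * (4 * real q)"
    proof (rule norm_sieve_weight_sum_le)
      fix L m assume L: "L \<in> {1..D\<^sup>2}"
      have "L * (h * k) \<le> D\<^sup>2 * (P * k)" using L h by (intro mult_mono) auto
      moreover have "2 * (D\<^sup>2 * (P * k)) \<le> q" using kP by (simp add: mult_ac)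
      ultimately have "2 * (L * (h * k)) \<le> q" by linarith
      moreover have "L * (h * k) > 0" using L h k by simp
      ultimately have "1 / (2 * real q) \<le> nint_dist (real (L * (h * k)) * \<alpha>)"
        using sep unfolding separated_def by blast
      also have "real (L * (h * k)) * \<alpha> = real h * (real L * (real k * \<alpha>))" by simp
      also have "nint_dist \<dots> = nint_dist ((real b - real b') * (real L * (real k * \<alpha>)))"
        unfolding h_def by (rule nint_dist_difference [symmetric])
      also have "(real b - real b') * (real L * (real k * \<alpha>)) = real L * \<theta>" by (simp add: \<theta>_def)
      finally have d: "1 / (2 * real q) \<le> nint_dist (real L * \<theta>)" .
      moreover have "1 / (2 * real q) > 0" using q by simp
      ultimately have pos: "nint_dist (real L * \<theta>) > 0" by linarith
      have v: "(of_real s * ee \<theta>) ^ L = of_real (s ^ L) * ee (real L * \<theta>)"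
        by (simp add: power_mult_distrib ee_power)
      have "norm (\<Sum>j\<in>{1..m}. ((of_real s * ee \<theta>) ^ L) ^ j) \<le> 2 / nint_dist (real L * \<theta>)"
        by (rule norm_geometric_sum_nint_dist [where s = "s ^ L", OF _ _ v pos])
           (use s in \<open>simp_all add: norm_mult norm_power power_le_one\<close>)
      also have "\<dots> \<le> 2 / (1 / (2 * real q))"
        by (rule divide_left_mono [OF d _ mult_pos_pos [OF pos]]) (use q in auto)
      finally show "norm (\<Sum>j\<in>{1..m}. ((of_real s * ee \<theta>) ^ L) ^ j) \<le> 4 * real q" by simp
    qed (use \<mu> in auto)
    then show "norm (\<Sum>a\<in>{1..A}. of_real (sieve_weight \<mu> D a) * (z ^ b * cnj z ^ b' / of_real (norm z) ^ P) ^ a)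
        \<le> real D ^ 6 * (4 * real q)"
      unfolding ratio_polar_form [OF z] s_def \<theta>_def D6 .
  qed (use B z0 c P nonneg in \<open>auto simp: sieve_weight_nonneg\<close>)
  also have "\<dots> \<le> (V * Y / real P + real D ^ 6) *
       (1\<^sup>2 * (real P * (V * Y / real P + real D ^ 6) + 2 * real P * (\<Sum>h\<in>{1..P}. real D ^ 6 * (4 * real q))))"
  proof (rule mult_right_mono)
    have "norm z ^ P = exp (- (real P / Y))" by (simp add: n exp_of_nat_mult [symmetric])
    then show "(\<Sum>a\<in>{1..N}. sieve_weight \<mu> D a * (norm z ^ P) ^ a) \<le> V * Y / real P + real D ^ 6"
      using real_sum [of "real P / Y" N] by simp
  qed (use nonneg in \<open>auto intro!: mult_nonneg_nonneg add_nonneg_nonneg sum_nonneg\<close>)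
  finally show ?thesis by (simp add: mult_ac)
qed

section \<open>Inserting the logarithmic weight\<close>

text \<open>Each prime counts once regardless of its multiplicity. Summed against a function of
  \<open>n\<close>, this gives exactly the sum over primes \<open>p\<close> and cofactors
  \<open>m\<close> with \<open>n = p * m\<close>, free of higher prime powers.\<close>

definition log_radical :: "nat \<Rightarrow> real" where
  "log_radical n = (\<Sum>p\<in>prime_factors n. ln (real p))"

lemma ln_eq_sum_multiplicity:
  assumes "n > 0"
  shows "ln (real n) = (\<Sum>p\<in>prime_factors n. real (multiplicity p n) * ln (real p))"
proof -
  have "real n = (\<Prod>p\<in>prime_factors n. real p ^ multiplicity p n)"
    using prime_factorization_nat [OF assms] by (metis (no_types, lifting) of_nat_power of_nat_prod prod.cong)
  moreover have "ln (\<Prod>p\<in>prime_factors n. real p ^ multiplicity p n)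
      = (\<Sum>p\<in>prime_factors n. ln (real p ^ multiplicity p n))"
    by (rule ln_prod) (auto simp: in_prime_factors_iff prime_gt_0_nat)
  ultimately have "ln (real n) = (\<Sum>p\<in>prime_factors n. ln (real p ^ multiplicity p n))" by simp
  also have "\<dots> = (\<Sum>p\<in>prime_factors n. real (multiplicity p n) * ln (real p))"
    by (intro sum.cong refl ln_realpow)
  finally show ?thesis .
qed

lemma ln_prime_factor_nonneg: "p \<in> prime_factors n \<Longrightarrow> 0 \<le> ln (real p)"
  using prime_ge_1_nat [of p] by (auto simp: in_prime_factors_iff)

lemma log_radical_le:
  assumes "n > 0"
  shows "log_radical n \<le> ln (real n)"
  unfolding log_radical_def ln_eq_sum_multiplicity [OF assms]
proof (rule sum_mono)
  fix p assume p: "p \<in> prime_factors n"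
  then have "multiplicity p n \<ge> 1" by (simp add: prime_factors_multiplicity Suc_le_eq)
  then have "1 * ln (real p) \<le> real (multiplicity p n) * ln (real p)"
    using ln_prime_factor_nonneg [OF p] by (intro mult_right_mono) auto
  then show "ln (real p) \<le> real (multiplicity p n) * ln (real p)" by simp
qed

text \<open>Prime powers \<open>p ^ a\<close> with \<open>a \<ge> 2\<close> are absorbed by the largest square dividing \<open>n\<close>.\<close>

lemma ln_le_log_radical_plus_squares:
  assumes "n > 0"
  shows "ln (real n) \<le> log_radical n + 2 * (\<Sum>d\<in>{d\<in>{1..n}. d\<^sup>2 dvd n}. ln (real d))"
proof -
  define s where "s = square_part n"
  define t where "t = squarefree_part n"
  have nst: "n = t * s\<^sup>2" unfolding s_def t_def by (rule squarefree_decompose)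
  have "t \<noteq> 0" "s \<noteq> 0" using assms by (simp_all add: s_def t_def)
  then have pos: "t > 0" "s > 0" by (simp_all only: neq0_conv)
  have "ln (real t) = (\<Sum>p\<in>prime_factors t. real (multiplicity p t) * ln (real p))"
    using pos by (intro ln_eq_sum_multiplicity)
  also have "\<dots> \<le> (\<Sum>p\<in>prime_factors t. 1 * ln (real p))"
  proof (intro sum_mono mult_right_mono)
    fix p assume p: "p \<in> prime_factors t"
    then have "multiplicity p t \<le> Suc 0"
      unfolding t_def by (intro prime_multiplicity_squarefree_part_le_Suc_0) (auto simp: in_prime_factors_iff)
    then show "real (multiplicity p t) \<le> 1" by simp
    show "0 \<le> ln (real p)" using p by (rule ln_prime_factor_nonneg)
  qed
  also have "\<dots> \<le> (\<Sum>p\<in>prime_factors n. 1 * ln (real p))"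
  proof (rule sum_mono2)
    show "prime_factors t \<subseteq> prime_factors n"
      using assms nst by (intro dvd_prime_factors) auto
  qed (use ln_prime_factor_nonneg in auto)
  finally have t: "ln (real t) \<le> log_radical n" by (simp add: log_radical_def)
  have "s\<^sup>2 dvd n" using nst by simp
  moreover have "s \<le> n"
  proof -
    have "s * 1 \<le> s * (s * t)" using pos by (intro mult_le_mono2) (simp add: Suc_le_eq)
    then show ?thesis using nst by (simp add: power2_eq_square mult_ac)
  qed
  ultimately have "ln (real s) \<le> (\<Sum>d\<in>{d\<in>{1..n}. d\<^sup>2 dvd n}. ln (real d))"
    using pos by (intro member_le_sum) auto
  moreover have "ln (real n) = ln (real t) + 2 * ln (real s)"
  proof -
    have "real n = real t * real s ^ 2" using nst by (metis of_nat_mult of_nat_power)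
    then show ?thesis using pos by (simp add: ln_mult ln_realpow)
  qed
  ultimately show ?thesis using t by linarith
qed

lemma ln_over_square_sum_bounded:
  "\<exists>C::real. C \<ge> 0 \<and> (\<forall>A. finite A \<longrightarrow> (\<Sum>d\<in>A. ln (real d) / real d ^ 2) \<le> C)"
proof -
  have "summable (\<lambda>d::nat. ln (real d) / real d ^ 2)"
  proof (rule summable_comparison_test_bigo)
    show "summable (\<lambda>d::nat. norm (real d powr (- 3 / 2)))"
      by (simp add: summable_real_powr_iff)
    show "(\<lambda>d::nat. ln (real d) / real d ^ 2) \<in> O(\<lambda>d. real d powr (- 3 / 2))"
      by real_asymp
  qed
  moreover have nn: "ln (real d) / real d ^ 2 \<ge> 0" for d :: nat
    by (cases "d = 0") auto
  ultimately show ?thesis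
    by (intro exI [of _ "suminf (\<lambda>d::nat. ln (real d) / real d ^ 2)"] conjI allI impI suminf_nonneg sum_le_suminf) auto
qed

lemma exp_sum_multiples_le:
  assumes "Y > 0" "L \<ge> 1"
  shows "(\<Sum>n\<in>{n\<in>{1..N}. L dvd n}. exp (- 1 / Y) ^ n) \<le> Y / real L"
proof -
  have "(\<Sum>n\<in>{n\<in>{1..N}. L dvd n}. exp (- 1 / Y) ^ n) = (\<Sum>j\<in>{1..N div L}. exp (- 1 / Y) ^ (L * j))"
    using assms by (intro sum_multiples)
  also have "\<dots> = (\<Sum>j\<in>{1..N div L}. exp (- (real L / Y)) ^ j)"
    by (simp add: power_mult exp_of_nat_mult [symmetric])
  also have "\<dots> \<le> 1 / (real L / Y)" using assms by (intro exp_geometric_sum_le) auto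
  finally show ?thesis by simp
qed

text \<open>The defect at \<open>n\<close> is at most twice the sum of \<open>ln d\<close> over
  \<open>d^2\<close> dividing \<open>n\<close>. After exchanging the sums, the multiples of
  \<open>d^2\<close> have total weight at most \<open>Y / d^2\<close>, and the sum of
  \<open>ln d / d^2\<close> converges.\<close>

lemma log_radical_error_sum:
  "\<exists>C\<ge>0. \<forall>Y>0. \<forall>N. (\<Sum>n\<in>{1..N}. exp (- 1 / Y) ^ n * (ln (real n) - log_radical n)) \<le> C * Y"
proof -
  obtain C where C: "C \<ge> 0" "\<And>A. finite A \<Longrightarrow> (\<Sum>d\<in>A. ln (real d) / real d ^ 2) \<le> C"
    using ln_over_square_sum_bounded by blast
  have "(\<Sum>n\<in>{1..N}. exp (- 1 / Y) ^ n * (ln (real n) - log_radical n)) \<le> 2 * C * Y" if Y: "Y > 0" for Y N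
  proof -
    define x where "x = exp (- 1 / Y)"
    have "(\<Sum>n\<in>{1..N}. x ^ n * (ln (real n) - log_radical n))
        \<le> (\<Sum>n\<in>{1..N}. x ^ n * (2 * (\<Sum>d\<in>{d\<in>{1..N}. d\<^sup>2 dvd n}. ln (real d))))"
    proof (intro sum_mono mult_left_mono)
      fix n assume n: "n \<in> {1..N}"
      have "(\<Sum>d\<in>{d\<in>{1..n}. d\<^sup>2 dvd n}. ln (real d)) \<le> (\<Sum>d\<in>{d\<in>{1..N}. d\<^sup>2 dvd n}. ln (real d))"
        using n by (intro sum_mono2) auto
      then show "ln (real n) - log_radical n \<le> 2 * (\<Sum>d\<in>{d\<in>{1..N}. d\<^sup>2 dvd n}. ln (real d))"
        using ln_le_log_radical_plus_squares [of n] n by simp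
    qed (simp add: x_def)
    also have "\<dots> = (\<Sum>n\<in>{1..N}. \<Sum>d\<in>{d\<in>{1..N}. d\<^sup>2 dvd n}. 2 * ln (real d) * x ^ n)"
      by (simp add: sum_distrib_left mult_ac)
    also have "\<dots> = (\<Sum>d\<in>{1..N}. \<Sum>n\<in>{n\<in>{1..N}. d\<^sup>2 dvd n}. 2 * ln (real d) * x ^ n)"
      by (rule sum.swap_restrict) auto
    also have "\<dots> = (\<Sum>d\<in>{1..N}. 2 * ln (real d) * (\<Sum>n\<in>{n\<in>{1..N}. d\<^sup>2 dvd n}. x ^ n))"
      by (simp only: sum_distrib_left)
    also have "\<dots> \<le> (\<Sum>d\<in>{1..N}. 2 * ln (real d) * (Y / real (d\<^sup>2)))"
      unfolding x_def using Y by (intro sum_mono mult_left_mono exp_sum_multiples_le) auto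
    also have "\<dots> = 2 * Y * (\<Sum>d\<in>{1..N}. ln (real d) / real d ^ 2)"
      by (simp add: sum_distrib_left mult_ac)
    also have "\<dots> \<le> 2 * Y * C" using C(2) [of "{1..N}"] Y by (intro mult_left_mono) auto
    finally show ?thesis by (simp add: x_def mult_ac)
  qed
  then show ?thesis using C(1) by (intro exI [of _ "2 * C"]) auto
qed

section \<open>Averages of the logarithm under exponential damping\<close>

lemma abs_ln_le_sum:
  assumes "x > 0"
  shows "\<bar>ln x\<bar> \<le> x + 2 / sqrt x"
proof (cases "x \<ge> 1")
  case True
  then have "\<bar>ln x\<bar> \<le> x" using ln_le_minus_one [of x] by simp
  moreover have "0 \<le> 2 / sqrt x" using assms by simp
  ultimately show ?thesis by linarith
next
  case False
  then have "ln x \<le> 0" using assms by simp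
  have "ln (1 / sqrt x) \<le> 1 / sqrt x - 1" using assms by (intro ln_le_minus_one) auto
  moreover have "ln (1 / sqrt x) = - (ln x / 2)" using assms by (simp add: ln_div ln_sqrt)
  ultimately show ?thesis using \<open>ln x \<le> 0\<close> assms by simp
qed

lemma sum_inverse_sqrt_le: "(\<Sum>n\<in>{1..M::nat}. 1 / sqrt (real n)) \<le> 2 * sqrt (real M)"
proof (induction M)
  case (Suc M)
  have "1 / sqrt (real (Suc M)) \<le> 2 * sqrt (real (Suc M)) - 2 * sqrt (real M)"
  proof -
    define a b where "a = sqrt (real M)" and "b = sqrt (real (Suc M))"
    have ab: "a \<ge> 0" "b > 0" "b * b = a * a + 1" by (simp_all add: a_def b_def)
    have "0 \<le> (b - a) * (b - a)" by simp
    then have "1 \<le> (2 * b - 2 * a) * b" using ab by (simp add: algebra_simps)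
    then have "1 / b \<le> 2 * b - 2 * a" using ab by (simp add: pos_divide_le_eq)
    then show ?thesis unfolding a_def b_def .
  qed
  with Suc show ?case by simp
qed simp

text \<open>In the variable \<open>u = n / Y\<close> this is a Riemann sum for the convergent
  integral of \<open>exp (- u) * \<bar>ln u\<bar>\<close>. The growth is absorbed by
  \<open>u \<le> exp (u / 2)\<close>, the singularity at 0 by \<open>2 / sqrt u\<close>, kept only
  for \<open>n \<le> Y\<close>. The constant is \<open>2 + 2 + 4\<close>.\<close>

lemma exp_sum_abs_ln_le:
  assumes Y: "Y > 0"
  shows "(\<Sum>n\<in>{1..N}. exp (- 1 / Y) ^ n * \<bar>ln (real n) - ln Y\<bar>) \<le> 8 * Y"
proof -
  define M where "M = nat \<lfloor>Y\<rfloor>"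
  have "(\<Sum>n\<in>{1..N}. exp (- 1 / Y) ^ n * \<bar>ln (real n) - ln Y\<bar>)
      \<le> (\<Sum>n\<in>{1..N}. exp (- (1 / (2 * Y))) ^ n + 2 * exp (- (1 / Y)) ^ n + (if n \<le> M then 2 * sqrt Y * (1 / sqrt (real n)) else 0))"
  proof (rule sum_mono)
    fix n assume n: "n \<in> {1..N}"
    define u where "u = real n / Y"
    have u: "u > 0" using n Y by (simp add: u_def)
    have "\<bar>ln (real n) - ln Y\<bar> \<le> u + 2 / sqrt u"
      using abs_ln_le_sum [OF u] n Y by (simp add: u_def ln_div)
    then have "exp (- u) * \<bar>ln (real n) - ln Y\<bar> \<le> exp (- u) * u + exp (- u) * (2 / sqrt u)"
      unfolding distrib_left [symmetric] by (intro mult_left_mono) auto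
    moreover have "exp (- u) * u \<le> exp (- (u / 2))"
    proof -
      have "1 + u / 4 \<le> exp (u / 4)" by (rule exp_ge_add_one_self)
      then have "(1 + u / 4) * (1 + u / 4) \<le> exp (u / 4) * exp (u / 4)" using u by (intro mult_mono) auto
      moreover have "0 \<le> (1 - u / 4) * (1 - u / 4)" by simp
      ultimately have "u \<le> exp (u / 2)" by (simp add: exp_add [symmetric] algebra_simps)
      then have "exp (- u) * u \<le> exp (- u) * exp (u / 2)" by (intro mult_left_mono) auto
      then show ?thesis by (simp add: exp_add [symmetric])
    qed
    moreover have "exp (- u) * (2 / sqrt u) \<le> 2 * exp (- u) + (if n \<le> M then 2 * sqrt Y * (1 / sqrt (real n)) else 0)"
    proof (cases "n \<le> M")
      case True
      have "exp (- u) * (2 / sqrt u) \<le> 1 * (2 / sqrt u)" using u by (intro mult_right_mono) auto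
      also have "\<dots> = 2 * sqrt Y * (1 / sqrt (real n))" by (simp add: u_def real_sqrt_divide)
      finally show ?thesis using True by (simp add: add_increasing)
    next
      case False
      then have "Y < real n" unfolding M_def using Y by linarith
      then have "u \<ge> 1" using Y by (simp add: u_def)
      then have "2 / sqrt u \<le> 2" by (simp add: divide_le_eq)
      then have "exp (- u) * (2 / sqrt u) \<le> exp (- u) * 2" by (intro mult_left_mono) auto
      then show ?thesis using False by simp
    qed
    moreover have pws: "exp (- (1 / (2 * Y))) ^ n = exp (- (u / 2))" "exp (- (1 / Y)) ^ n = exp (- u)" "exp (- 1 / Y) ^ n = exp (- u)"
      by (simp_all add: u_def exp_of_nat_mult [symmetric])
    ultimately show "exp (- 1 / Y) ^ n * \<bar>ln (real n) - ln Y\<bar>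
      \<le> exp (- (1 / (2 * Y))) ^ n + 2 * exp (- (1 / Y)) ^ n + (if n \<le> M then 2 * sqrt Y * (1 / sqrt (real n)) else 0)"
      unfolding pws by linarith
  qed
  also have "\<dots> = (\<Sum>n\<in>{1..N}. exp (- (1 / (2 * Y))) ^ n) + 2 * (\<Sum>n\<in>{1..N}. exp (- (1 / Y)) ^ n)
      + (\<Sum>n\<in>{1..N}. if n \<le> M then 2 * sqrt Y * (1 / sqrt (real n)) else 0)"
    by (simp only: sum.distrib sum_distrib_left)
  also have "(\<Sum>n\<in>{1..N}. exp (- (1 / (2 * Y))) ^ n) \<le> 1 / (1 / (2 * Y))"
    using Y by (intro exp_geometric_sum_le) auto
  also have "(\<Sum>n\<in>{1..N}. exp (- (1 / Y)) ^ n) \<le> 1 / (1 / Y)"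
    using Y by (intro exp_geometric_sum_le) auto
  also have "(\<Sum>n\<in>{1..N}. if n \<le> M then 2 * sqrt Y * (1 / sqrt (real n)) else 0) \<le> 4 * Y"
  proof -
    have "(\<Sum>n\<in>{1..N}. if n \<le> M then 2 * sqrt Y * (1 / sqrt (real n)) else 0)
        = (\<Sum>n\<in>{n\<in>{1..N}. n \<le> M}. 2 * sqrt Y * (1 / sqrt (real n)))"
      by (rule sum.inter_filter [symmetric]) simp
    also have "\<dots> \<le> (\<Sum>n\<in>{1..M}. 2 * sqrt Y * (1 / sqrt (real n)))"
      using Y by (intro sum_mono2) auto
    also have "\<dots> \<le> 2 * sqrt Y * (2 * sqrt (real M))"
      unfolding sum_distrib_left [symmetric] using Y by (intro mult_left_mono sum_inverse_sqrt_le) auto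
    also have "\<dots> \<le> 2 * sqrt Y * (2 * sqrt Y)"
      using Y by (intro mult_left_mono) (auto simp: M_def)
    finally show ?thesis using Y by simp
  qed
  finally show ?thesis by simp
qed

lemma norm_multiplicative_defect_le:
  assumes g: "multiplicative g" "unit_bounded g" and p: "prime p" and m: "m > 0"
  shows "norm (g (p * m) - g p * g m) \<le> (if p dvd m then 2 else 0)"
proof (cases "p dvd m")
  case True
  have "p > 0" using p by (rule prime_gt_0_nat)
  then have "norm (g (p * m)) \<le> 1" "norm (g p) \<le> 1" "norm (g m) \<le> 1"
    using g(2) m by (simp_all add: unit_bounded_def Suc_le_eq)
  moreover from this have "norm (g p) * norm (g m) \<le> 1 * 1" by (intro mult_mono) auto
  ultimately show ?thesis using True norm_triangle_ineq4 [of "g (p * m)" "g p * g m"] by (simp add: norm_mult)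
next
  case False
  then have "g (p * m) = g p * g m"
    using g(1) p m by (simp add: multiplicative_def prime_imp_coprime prime_gt_0_nat)
  then show ?thesis by simp
qed

text \<open>Three replacements, each at a cost \<open>O(Y)\<close>: \<open>ln Y\<close> by
  \<open>ln n\<close>, \<open>ln n\<close> by \<open>log_radical n\<close>, and
  \<open>g (p * m)\<close> by \<open>g p * g m\<close>. The last is exact unless \<open>p\<close>
  divides \<open>m\<close>. One constant serves all \<open>Y\<close>, \<open>N\<close>,
  \<open>z\<close> and \<open>g\<close>, which prepares the uniformity in \<open>f\<close>.\<close>

lemma weighted_sum_reduction:
  "\<exists>C\<ge>0. \<forall>Y>0. \<forall>N z g. norm z = exp (- 1 / Y) \<longrightarrow> multiplicative g \<longrightarrow> unit_bounded g \<longrightarrow>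
     \<bar>ln Y\<bar> * norm (\<Sum>n\<in>{1..N}. g n * z ^ n)
       \<le> norm (\<Sum>p\<in>{p\<in>{1..N}. prime p}. \<Sum>m\<in>{m\<in>{1..N}. p * m \<le> N}. of_real (ln (real p)) * g p * g m * z ^ (p * m)) + C * Y"
proof -
  obtain C1 where C1: "C1 \<ge> 0" "\<And>A. finite A \<Longrightarrow> (\<Sum>d\<in>A. ln (real d) / real d ^ 2) \<le> C1"
    using ln_over_square_sum_bounded by blast
  obtain C2 where C2: "C2 \<ge> 0" "\<And>Y N. Y > 0 \<Longrightarrow> (\<Sum>n\<in>{1..N}. exp (- 1 / Y) ^ n * (ln (real n) - log_radical n)) \<le> C2 * Y"
    using log_radical_error_sum by blast
  have "\<bar>ln Y\<bar> * norm (\<Sum>n\<in>{1..N}. g n * z ^ n)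
       \<le> norm (\<Sum>p\<in>{p\<in>{1..N}. prime p}. \<Sum>m\<in>{m\<in>{1..N}. p * m \<le> N}. of_real (ln (real p)) * g p * g m * z ^ (p * m)) + (8 + C2 + 2 * C1) * Y"
    if Y: "Y > 0" and z: "norm z = exp (- 1 / Y)" and g: "multiplicative g" "unit_bounded g" for Y N z g
  proof -
    define x where "x = exp (- 1 / Y)"
    have x: "x > 0" "norm z = x" by (simp_all add: x_def z)
    have gz: "norm (g n * z ^ n) \<le> x ^ n" if "n \<in> {1..N}" for n
      using g(2) that x by (simp add: norm_mult norm_power unit_bounded_def mult_left_le_one_le)
    define S1 where "S1 = (\<Sum>n\<in>{1..N}. of_real (ln (real n)) * (g n * z ^ n))"
    define S2 where "S2 = (\<Sum>n\<in>{1..N}. of_real (log_radical n) * (g n * z ^ n))"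
    define S3 where "S3 = (\<Sum>p\<in>{p\<in>{1..N}. prime p}. \<Sum>m\<in>{m\<in>{1..N}. p * m \<le> N}. of_real (ln (real p)) * g p * g m * z ^ (p * m))"
    have "norm (of_real (ln Y) * (\<Sum>n\<in>{1..N}. g n * z ^ n) - S1)
        = norm (\<Sum>n\<in>{1..N}. of_real (ln Y - ln (real n)) * (g n * z ^ n))"
      by (simp add: S1_def sum_distrib_left sum_subtractf left_diff_distrib)
    also have "\<dots> \<le> (\<Sum>n\<in>{1..N}. x ^ n * \<bar>ln (real n) - ln Y\<bar>)"
    proof (rule sum_norm_le)
      fix n assume "n \<in> {1..N}"
      then have "\<bar>ln Y - ln (real n)\<bar> * norm (g n * z ^ n) \<le> \<bar>ln Y - ln (real n)\<bar> * x ^ n"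
        using gz by (intro mult_left_mono) auto
      then show "norm (of_real (ln Y - ln (real n)) * (g n * z ^ n)) \<le> x ^ n * \<bar>ln (real n) - ln Y\<bar>"
        by (simp only: norm_mult norm_of_real abs_minus_commute mult.commute)
    qed
    also have "\<dots> \<le> 8 * Y" unfolding x_def by (rule exp_sum_abs_ln_le [OF Y])
    finally have 1: "norm (of_real (ln Y) * (\<Sum>n\<in>{1..N}. g n * z ^ n) - S1) \<le> 8 * Y" .
    have "norm (S1 - S2) = norm (\<Sum>n\<in>{1..N}. of_real (ln (real n) - log_radical n) * (g n * z ^ n))"
      by (simp add: S1_def S2_def sum_subtractf left_diff_distrib)
    also have "\<dots> \<le> (\<Sum>n\<in>{1..N}. x ^ n * (ln (real n) - log_radical n))"
    proof (rule sum_norm_le)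
      fix n assume n: "n \<in> {1..N}"
      then have nn: "0 \<le> ln (real n) - log_radical n" using log_radical_le [of n] by simp
      then have "(ln (real n) - log_radical n) * norm (g n * z ^ n) \<le> (ln (real n) - log_radical n) * x ^ n"
        using gz n by (intro mult_left_mono) auto
      then show "norm (of_real (ln (real n) - log_radical n) * (g n * z ^ n)) \<le> x ^ n * (ln (real n) - log_radical n)"
        using nn by (simp only: norm_mult norm_of_real abs_of_nonneg mult.commute)
    qed
    also have "\<dots> \<le> C2 * Y" unfolding x_def by (rule C2(2) [OF Y])
    finally have 2: "norm (S1 - S2) \<le> C2 * Y" .
    have S2: "S2 = (\<Sum>p\<in>{p\<in>{1..N}. prime p}. \<Sum>m\<in>{m\<in>{1..N}. p * m \<le> N}. of_real (ln (real p)) * (g (p * m) * z ^ (p * m)))"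
    proof -
      have "S2 = (\<Sum>n\<in>{1..N}. \<Sum>p\<in>{p\<in>{p\<in>{1..N}. prime p}. p dvd n}. of_real (ln (real p)) * (g n * z ^ n))"
        unfolding S2_def
      proof (rule sum.cong [OF refl])
        fix n assume n: "n \<in> {1..N}"
        have "prime_factors n = {p\<in>{p\<in>{1..N}. prime p}. p dvd n}"
          using n by (auto simp: in_prime_factors_iff prime_ge_Suc_0_nat intro: dvd_imp_le [THEN order_trans])
        then show "of_real (log_radical n) * (g n * z ^ n)
            = (\<Sum>p\<in>{p\<in>{p\<in>{1..N}. prime p}. p dvd n}. of_real (ln (real p)) * (g n * z ^ n))"
          by (simp only: log_radical_def of_real_sum sum_distrib_right)
      qed
      also have "\<dots> = (\<Sum>p\<in>{p\<in>{1..N}. prime p}. \<Sum>n\<in>{n\<in>{1..N}. p dvd n}. of_real (ln (real p)) * (g n * z ^ n))"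
        by (rule sum.swap_restrict) auto
      also have "\<dots> = (\<Sum>p\<in>{p\<in>{1..N}. prime p}. \<Sum>m\<in>{m\<in>{1..N}. p * m \<le> N}. of_real (ln (real p)) * (g (p * m) * z ^ (p * m)))"
      proof (rule sum.cong [OF refl])
        fix p assume p: "p \<in> {p\<in>{1..N}. prime p}"
        then have p1: "p > 0" by auto
        have "{m\<in>{1..N}. p * m \<le> N} = {1..N div p}"
        proof -
          have iff: "p * m \<le> N \<longleftrightarrow> m \<le> N div p" for m
            using p1 by (simp add: less_eq_div_iff_mult_less_eq mult.commute)
          have "N div p \<le> N" by simp
          then show ?thesis unfolding set_eq_iff mem_Collect_eq atLeastAtMost_iff iff using order_trans by blast
        qed
        then show "(\<Sum>n\<in>{n\<in>{1..N}. p dvd n}. of_real (ln (real p)) * (g n * z ^ n))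
            = (\<Sum>m\<in>{m\<in>{1..N}. p * m \<le> N}. of_real (ln (real p)) * (g (p * m) * z ^ (p * m)))"
          using p1 by (simp only:) (rule sum_multiples, simp)
      qed
      finally show ?thesis .
    qed
    have "norm (S2 - S3) \<le> (\<Sum>p\<in>{p\<in>{1..N}. prime p}. 2 * Y * (ln (real p) / real p ^ 2))"
      unfolding S2 S3_def sum_subtractf [symmetric]
    proof (rule sum_norm_le)
      fix p assume p: "p \<in> {p\<in>{1..N}. prime p}"
      then have p1: "p > 0" "prime p" by auto
      then have lnp: "ln (real p) \<ge> 0" by (simp add: Suc_le_eq)
      have "norm (\<Sum>m\<in>{m\<in>{1..N}. p * m \<le> N}. of_real (ln (real p)) * (g (p * m) * z ^ (p * m)) - of_real (ln (real p)) * g p * g m * z ^ (p * m))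
          \<le> (\<Sum>m\<in>{m\<in>{1..N}. p * m \<le> N}. ln (real p) * ((if p dvd m then 2 else 0) * (x ^ p) ^ m))"
      proof (rule sum_norm_le)
        fix m assume m: "m \<in> {m\<in>{1..N}. p * m \<le> N}"
        have "of_real (ln (real p)) * (g (p * m) * z ^ (p * m)) - of_real (ln (real p)) * g p * g m * z ^ (p * m)
            = of_real (ln (real p)) * ((g (p * m) - g p * g m) * z ^ (p * m))"
          by (simp add: left_diff_distrib right_diff_distrib mult.assoc)
        also have "norm \<dots> = ln (real p) * (norm (g (p * m) - g p * g m) * (x ^ p) ^ m)"
          using lnp by (simp only: norm_mult norm_of_real abs_of_nonneg norm_power x(2) power_mult)
        also have "\<dots> \<le> ln (real p) * ((if p dvd m then 2 else 0) * (x ^ p) ^ m)"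
          using m x lnp p1 g by (intro mult_left_mono mult_right_mono norm_multiplicative_defect_le) auto
        finally show "norm (of_real (ln (real p)) * (g (p * m) * z ^ (p * m)) - of_real (ln (real p)) * g p * g m * z ^ (p * m))
            \<le> ln (real p) * ((if p dvd m then 2 else 0) * (x ^ p) ^ m)" .
      qed
      also have "\<dots> \<le> (\<Sum>m\<in>{1..N}. ln (real p) * ((if p dvd m then 2 else 0) * (x ^ p) ^ m))"
        using lnp x by (intro sum_mono2) auto
      also have "\<dots> = 2 * ln (real p) * (\<Sum>m\<in>{m\<in>{1..N}. p dvd m}. (x ^ p) ^ m)"
        unfolding sum_distrib_left sum.inter_filter [OF finite_atLeastAtMost] by (intro sum.cong) auto
      \<comment> \<open>Two factors \<open>1 / p\<close> arise: the ratio \<open>x ^ p\<close>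
        shortens the effective length from \<open>Y\<close> to \<open>Y / p\<close>, and only
        multiples \<open>m\<close> of \<open>p\<close> are counted. So the sum over primes is
        bounded by one over \<open>ln p / p^2\<close>.\<close>
      also have "x ^ p = exp (- 1 / (Y / real p))"
        using p1 by (simp add: x_def exp_of_nat_mult [symmetric])
      also have "2 * ln (real p) * (\<Sum>m\<in>{m\<in>{1..N}. p dvd m}. exp (- 1 / (Y / real p)) ^ m) \<le> 2 * ln (real p) * ((Y / real p) / real p)"
        using lnp Y p1 by (intro mult_left_mono exp_sum_multiples_le) auto
      finally show "norm (\<Sum>m\<in>{m\<in>{1..N}. p * m \<le> N}. of_real (ln (real p)) * (g (p * m) * z ^ (p * m)) - of_real (ln (real p)) * g p * g m * z ^ (p * m))
          \<le> 2 * Y * (ln (real p) / real p ^ 2)"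
        by (simp add: power2_eq_square mult_ac)
    qed
    also have "\<dots> \<le> 2 * Y * C1"
      unfolding sum_distrib_left [symmetric] using C1(2) Y by (intro mult_left_mono) auto
    finally have 3: "norm (S2 - S3) \<le> 2 * Y * C1" .
    have "\<bar>ln Y\<bar> * norm (\<Sum>n\<in>{1..N}. g n * z ^ n) = norm (of_real (ln Y) * (\<Sum>n\<in>{1..N}. g n * z ^ n))"
      by (simp only: norm_mult norm_of_real)
    also have "\<dots> = norm ((of_real (ln Y) * (\<Sum>n\<in>{1..N}. g n * z ^ n) - S1) + (S1 - S2) + (S2 - S3) + S3)" by simp
    also have "\<dots> \<le> norm (of_real (ln Y) * (\<Sum>n\<in>{1..N}. g n * z ^ n) - S1) + norm (S1 - S2) + norm (S2 - S3) + norm S3"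
      by (intro norm_triangle_le add_mono order_refl)
    also have "\<dots> \<le> 8 * Y + C2 * Y + 2 * Y * C1 + norm S3" using 1 2 3 by (intro add_mono) auto
    finally show ?thesis by (simp add: S3_def algebra_simps)
  qed
  then show ?thesis using C1 C2 by (intro exI [of _ "8 + C2 + 2 * C1"]) auto
qed

section \<open>Small and large primes\<close>

lemma sum_dyadic:
  fixes F :: "nat \<Rightarrow> 'a::comm_monoid_add"
  assumes "finite S" "0 \<notin> S"
  shows "(\<Sum>b\<in>{b\<in>S. b < 2 ^ J}. F b) = (\<Sum>j<J. \<Sum>b\<in>{b\<in>S. 2 ^ j \<le> b \<and> b < 2 * 2 ^ j}. F b)"
proof (induction J)
  case 0
  have empty: "{b\<in>S. b < 2 ^ 0} = {}" using assms by (auto intro: gr0I)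
  show ?case unfolding empty by simp
next
  case (Suc J)
  have "sum F {b\<in>S. b < 2 * P} = sum F {b\<in>S. b < P} + sum F {b\<in>S. P \<le> b \<and> b < 2 * P}" for P
  proof -
    have un: "{b\<in>S. b < 2 * P} = {b\<in>S. b < P} \<union> {b\<in>S. P \<le> b \<and> b < 2 * P}" by auto
    have dis: "{b\<in>S. b < P} \<inter> {b\<in>S. P \<le> b \<and> b < 2 * P} = {}" by auto
    show ?thesis unfolding un using assms(1) by (intro sum.union_disjoint dis) simp_all
  qed
  from this [of "2 ^ J"] Suc show ?case by (simp only: power_Suc sum.lessThan_Suc)
qed

lemma norm_sum_dyadic_le:
  fixes F :: "nat \<Rightarrow> complex"
  assumes "finite S" "0 \<notin> S" "\<And>b. b \<in> S \<Longrightarrow> b < 2 ^ J"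
  shows "norm (\<Sum>b\<in>{b\<in>S. Q b}. F b)
     \<le> (\<Sum>j<J. norm (\<Sum>b\<in>{b\<in>{b\<in>S. 2 ^ j \<le> b \<and> b < 2 * 2 ^ j}. Q b}. F b))"
proof -
  have "(\<Sum>b\<in>{b\<in>S. Q b}. F b) = (\<Sum>b\<in>{b\<in>{b\<in>S. Q b}. b < 2 ^ J}. F b)"
    using assms(3) by (intro sum.cong) auto
  also have "\<dots> = (\<Sum>j<J. \<Sum>b\<in>{b\<in>{b\<in>S. Q b}. 2 ^ j \<le> b \<and> b < 2 * 2 ^ j}. F b)"
    using assms by (intro sum_dyadic) auto
  also have "\<dots> = (\<Sum>j<J. \<Sum>b\<in>{b\<in>{b\<in>S. 2 ^ j \<le> b \<and> b < 2 * 2 ^ j}. Q b}. F b)"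
    by (intro sum.cong) auto
  finally show ?thesis by (simp only: norm_sum)
qed

text \<open>The value of the sum of \<open>(j + 1) * x ^ j\<close> at \<open>x = 1 / sqrt 2\<close>,
  that is, of \<open>ln P / sqrt P\<close> over powers of two with the logarithm replaced by
  \<open>j + 1\<close>.\<close>

definition dyadic_const :: real where
  "dyadic_const = 1 / (1 - 1 / sqrt 2)\<^sup>2"

lemma sum_dyadic_weights_le:
  "(\<Sum>j<J. real (Suc j) * (1 / sqrt (2 ^ j))) \<le> dyadic_const"
proof -
  have lt: "norm (1 / sqrt 2 :: real) < 1" by simp
  have sums: "(\<lambda>j. of_nat (Suc j) * (1 / sqrt 2) ^ j) sums dyadic_const"
    unfolding dyadic_const_def by (rule geometric_deriv_sums [OF lt])
  have eq: "(1 / sqrt 2) ^ j = 1 / sqrt (2 ^ j)" for j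
    by (simp add: power_divide real_sqrt_power)
  have "(\<Sum>j<J. real (Suc j) * (1 / sqrt 2) ^ j) \<le> (\<Sum>j. real (Suc j) * (1 / sqrt 2) ^ j)"
    using sums by (intro sum_le_suminf) (auto simp: sums_iff)
  also have "\<dots> = dyadic_const" using sums by (simp add: sums_iff)
  finally show ?thesis unfolding eq .
qed

lemma dyadic_const_nonneg: "dyadic_const \<ge> 0"
  by (simp add: dyadic_const_def)

lemma le_sum_of_square_le:
  fixes s x y :: real
  assumes "s\<^sup>2 \<le> x\<^sup>2 + y\<^sup>2" "x \<ge> 0" "y \<ge> 0"
  shows "s \<le> x + y"
proof (rule power2_le_imp_le)
  have "0 \<le> 2 * x * y" using assms by simp
  then show "s\<^sup>2 \<le> (x + y)\<^sup>2" unfolding power2_sum using assms(1) by linarith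
qed (use assms in auto)

text \<open>All scales are powers of \<open>U = X powr (1/96)\<close>: sums are cut at \<open>X powr (13/12)\<close>, primes are called small
  up to \<open>X powr (5/6)\<close>, and the sieve has level \<open>U\<close>. Only \<open>k \<le> U\<close> needs cancellation;
  \<open>Y\<close> is the effective length of the \<open>k\<close>-th series, \<open>g\<close> stands for the \<open>k\<close>-th power of \<open>f\<close>,
  and \<open>J\<close> is the number of dyadic blocks.\<close>

locale minor_arc_sum =
  fixes U \<alpha> Y :: real and k q J N :: nat and z :: complex and g :: "nat \<Rightarrow> complex"
  assumes U1000: "U \<ge> 1000"
    and U_J: "9 * (real J + 1)\<^sup>2 \<le> sqrt U"
    and U_ln: "1 + ln (2 * U ^ 64) \<le> U"
    and U_lnJ: "832 * ln U * real J \<le> sqrt U"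
    and J_large: "U ^ 80 < 2 ^ J"
    and k: "k > 0" "real k \<le> U"
    and Y_def: "Y = U ^ 96 / real k"
    and sep: "separated \<alpha> q"
    and q: "U ^ 32 < real q" "real q \<le> 2 * U ^ 64"
    and z_def: "z = of_real (exp (- 1 / Y)) * ee (real k * \<alpha>)"
    and N_def: "N = nat \<lfloor>U ^ 104\<rfloor>"
    and g: "multiplicative g" "unit_bounded g"
begin

lemma U_pos: "U > 0" "U \<ge> 1"
  using U1000 by auto

lemma U_power_mono: "m \<le> n \<Longrightarrow> U ^ m \<le> U ^ n"
  using U_pos by (intro power_increasing) auto

lemma Y_bounds: "U ^ 95 \<le> Y" "Y \<le> U ^ 96" "Y > 0"
proof -
  have "U ^ 95 * real k \<le> U ^ 95 * U" using k U_pos by (intro mult_left_mono) auto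
  then show "U ^ 95 \<le> Y" using k by (simp add: Y_def pos_le_divide_eq mult.commute flip: power_Suc)
  then show "Y > 0" using U_pos by (meson less_le_trans zero_less_power)
  have "U ^ 96 / real k \<le> U ^ 96 / 1" using k U_pos by (intro divide_left_mono) auto
  then show "Y \<le> U ^ 96" by (simp add: Y_def)
qed

lemma harm_q_le: "harm q \<le> U"
proof -
  have "q > 0" using sep by (simp add: separated_def)
  then have "harm q \<le> ln (real q) + 1"
    using euler_mascheroni_sequence_decreasing [of 1 q] by (simp add: harm_def)
  also have "ln (real q) \<le> ln (2 * U ^ 64)" using q(2) \<open>q > 0\<close> by (intro ln_mono) auto
  finally show ?thesis using U_ln by linarith
qed

lemma unit_g: "n > 0 \<Longrightarrow> norm (g n) \<le> 1"
  using g(2) by (simp add: unit_bounded_def Suc_le_eq)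

text \<open>For \<open>p\<close> in the block \<open>ln p \<le> j + 1\<close>, which supplies the
  coefficient bound. The diagonal gives \<open>1 / sqrt (2 ^ j)\<close>; everything off the diagonal
  is kept below a constant times \<open>Y^2 / U\<close>, by the short-range estimate for
  \<open>P \<le> U\<close> and by the long-range one for larger \<open>P\<close>, where
  \<open>Y / P\<close> is at most \<open>Y / U\<close>.\<close>

lemma small_prime_block_le:
  assumes B: "B \<subseteq> {p. 2 ^ j \<le> p \<and> p < 2 * 2 ^ j \<and> real p \<le> U ^ 80}"
  shows "(\<Sum>m\<in>{1..N}. norm (\<Sum>p\<in>{p\<in>B. m * p \<le> N}. (of_real (ln (real p)) * g p) * z ^ (m * p)))
     \<le> real (Suc j) * Y * (1 / sqrt (2 ^ j) + 9 / sqrt U)"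
proof (cases "B = {}")
  case True
  then show ?thesis using Y_bounds U_pos by simp
next
  case False
  define P :: nat where "P = 2 ^ j"
  have P: "P > 0" "real P = 2 ^ j" by (simp_all add: P_def)
  have BP: "B \<subseteq> {P..<2 * P}" using B by (auto simp: P_def)
  obtain p0 where "p0 \<in> B" using False by blast
  then have "real P \<le> real p0" "real p0 \<le> U ^ 80" using B BP by auto
  then have PU: "real P \<le> U ^ 80" by linarith
  define S where "S = (\<Sum>m\<in>{1..N}. norm (\<Sum>p\<in>{p\<in>B. m * p \<le> N}. (of_real (ln (real p)) * g p) * z ^ (m * p)))"
  have cf: "norm (of_real (ln (real p)) * g p) \<le> real (Suc j)" if "p \<in> B" for p
  proof -
    have p: "1 \<le> p" "p < 2 * P" using that BP P by auto
    then have "real p < real (2 * P)" using of_nat_less_iff by blast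
    then have "real p \<le> 2 ^ Suc j" using P by simp
    then have "ln (real p) \<le> ln (2 ^ Suc j)" using p by (intro ln_mono) auto
    also have "\<dots> = real (Suc j) * ln 2" by (rule ln_realpow)
    also have "\<dots> \<le> real (Suc j) * 1" using ln_2_less_1 by (intro mult_left_mono) auto
    finally have "ln (real p) \<le> real (Suc j)" by simp
    moreover have "0 \<le> ln (real p)" using p by simp
    ultimately have "\<bar>ln (real p)\<bar> * norm (g p) \<le> real (Suc j) * 1"
      using unit_g [of p] p by (intro mult_mono) auto
    then show ?thesis by (simp add: norm_mult)
  qed
  have "S\<^sup>2 \<le> (real (Suc j))\<^sup>2 * (Y\<^sup>2 / real P + 76 * Y\<^sup>2 / U)"
  proof (cases "real P \<le> U")
    case True
    have "real (2 * (k * P)) \<le> real q"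
    proof -
      have "real k * real P \<le> U * U" using k True U_pos by (intro mult_mono) auto
      then have "real (2 * (k * P)) \<le> 2 * U ^ 2" by (simp add: power2_eq_square)
      also have "\<dots> \<le> U * U ^ 2" using U1000 by (intro mult_right_mono) auto
      also have "\<dots> \<le> U ^ 32" using U_power_mono [of 3 32] by (simp add: power3_eq_cube power2_eq_square)
      finally show ?thesis using q by linarith
    qed
    then have kP: "2 * (k * P) \<le> q" by (simp only: of_nat_le_iff)
    have "S\<^sup>2 \<le> (real (Suc j))\<^sup>2 * (Y\<^sup>2 / real P + 8 * Y * real P * real q)"
      unfolding S_def by (rule bilinear_block_short [OF z_def Y_bounds(3) BP P(1) k(1) cf _ sep kP]) auto
    also have "\<dots> \<le> (real (Suc j))\<^sup>2 * (Y\<^sup>2 / real P + 76 * Y\<^sup>2 / U)"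
    proof (intro mult_left_mono add_left_mono)
      have "real P * real q \<le> U * (2 * U ^ 64)" using True q U_pos by (intro mult_mono) auto
      also have "\<dots> = 2 * U ^ 65" by (simp flip: power_Suc)
      also have "\<dots> \<le> 2 * U ^ 94" using U_power_mono [of 65 94] by simp
      also have "U ^ 94 = U ^ 95 / U" using U_pos by (simp add: power_eq_if)
      also have "\<dots> \<le> Y / U" using Y_bounds U_pos by (intro divide_right_mono) auto
      finally have "8 * Y * (real P * real q) \<le> 8 * Y * (2 * (Y / U))"
        using Y_bounds by (intro mult_left_mono) auto
      also have "\<dots> = 16 * Y\<^sup>2 / U" by (simp add: power2_eq_square)
      also have "\<dots> \<le> 76 * Y\<^sup>2 / U" using U_pos by (intro divide_right_mono) auto
      finally show "8 * Y * real P * real q \<le> 76 * Y\<^sup>2 / U" by (simp add: mult.assoc)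
    qed auto
    finally show ?thesis .
  next
    case False
    have "S\<^sup>2 \<le> (real (Suc j))\<^sup>2 * (Y\<^sup>2 / real P + 2 * Y * ((2 * (real k * real P) / real q + 1) * (2 * (Y / real P + 4 * real q * harm q))))"
      unfolding S_def by (rule bilinear_block_long [OF z_def Y_bounds(3) BP P(1) k(1) cf _ sep]) auto
    also have "\<dots> \<le> (real (Suc j))\<^sup>2 * (Y\<^sup>2 / real P + 76 * Y\<^sup>2 / U)"
    proof (intro mult_left_mono add_left_mono)
      have q0: "real q > 0" using q U_pos by (meson less_trans zero_less_power)
      have YU: "U ^ 94 \<le> Y / U" using Y_bounds U_pos by (simp add: pos_le_divide_eq mult.commute flip: power_Suc)
      have t1: "real k * Y / real q \<le> Y / U"
      proof -
        have "real k * U \<le> U * U" using k U_pos by (intro mult_right_mono) auto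
        also have "\<dots> \<le> U ^ 32" using U_power_mono [of 2 32] by (simp add: power2_eq_square)
        also have "\<dots> \<le> real q" using q by simp
        finally have "Y * (real k * U) \<le> Y * real q" using Y_bounds by (intro mult_left_mono) auto
        then show ?thesis using q0 U_pos by (simp add: field_simps)
      qed
      have t2: "real k * real P * harm q \<le> Y / U"
      proof -
        have "real k * real P * harm q \<le> U * U ^ 80 * U"
          using k PU harm_q_le U_pos by (intro mult_mono) (auto simp: harm_nonneg)
        also have "\<dots> = U ^ 82" by (simp add: power_add [symmetric] flip: power_Suc power_Suc2)
        also have "\<dots> \<le> U ^ 94" by (rule U_power_mono) simp
        finally show ?thesis using YU by linarith
      qed
      have t3: "Y / real P \<le> Y / U" using False U_pos Y_bounds by (intro divide_left_mono) auto
      have t4: "real q * harm q \<le> 2 * (Y / U)"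
      proof -
        have "real q * harm q \<le> (2 * U ^ 64) * U"
          using q harm_q_le U_pos by (intro mult_mono) (auto simp: harm_nonneg)
        also have "\<dots> = 2 * U ^ 65" by (simp flip: power_Suc2)
        also have "\<dots> \<le> 2 * U ^ 94" using U_power_mono [of 65 94] by simp
        finally show ?thesis using YU by linarith
      qed
      \<comment> \<open>The product splits into four terms, each at most a constant times
        \<open>Y / U\<close>. Only the second grows with \<open>P\<close>; it is the reason for
        ending the small primes at a power of \<open>U\<close> well below \<open>Y\<close>.\<close>
      have "(2 * (real k * real P) / real q + 1) * (2 * (Y / real P + 4 * real q * harm q))
          = 4 * (real k * Y / real q) + 16 * (real k * real P * harm q) + 2 * (Y / real P) + 8 * (real q * harm q)"
        using q0 P(1) by (simp add: field_simps)
      also have "\<dots> \<le> 4 * (Y / U) + 16 * (Y / U) + 2 * (Y / U) + 8 * (2 * (Y / U))"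
        using t1 t2 t3 t4 by (intro add_mono mult_left_mono) auto
      also have "\<dots> = 38 * (Y / U)" by simp
      finally have "2 * Y * ((2 * (real k * real P) / real q + 1) * (2 * (Y / real P + 4 * real q * harm q)))
          \<le> 2 * Y * (38 * (Y / U))" using Y_bounds by (intro mult_left_mono) auto
      then show "2 * Y * ((2 * (real k * real P) / real q + 1) * (2 * (Y / real P + 4 * real q * harm q)))
          \<le> 76 * Y\<^sup>2 / U" by (simp add: power2_eq_square)
    qed auto
    finally show ?thesis .
  qed
  also have "\<dots> \<le> (real (Suc j))\<^sup>2 * (Y\<^sup>2 / real P + 81 * Y\<^sup>2 / U)"
    using U_pos by (intro mult_left_mono add_left_mono divide_right_mono) auto
  also have "\<dots> = (real (Suc j) * Y * (1 / sqrt (2 ^ j)))\<^sup>2 + (real (Suc j) * Y * (9 / sqrt U))\<^sup>2"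
  proof -
    have a: "(1 / sqrt (2 ^ j))\<^sup>2 = 1 / real P" by (simp add: power_divide P(2))
    have b: "(9 / sqrt U)\<^sup>2 = 81 / U" using U_pos by (simp add: power_divide)
    show ?thesis unfolding power_mult_distrib a b distrib_left by simp
  qed
  finally have sq: "S\<^sup>2 \<le> (real (Suc j) * Y * (1 / sqrt (2 ^ j)))\<^sup>2 + (real (Suc j) * Y * (9 / sqrt U))\<^sup>2" .
  have "S \<le> real (Suc j) * Y * (1 / sqrt (2 ^ j)) + real (Suc j) * Y * (9 / sqrt U)"
    using U_pos Y_bounds(3) by (intro le_sum_of_square_le [OF sq] mult_nonneg_nonneg) simp_all
  then show ?thesis by (simp add: S_def distrib_left)
qed

text \<open>Exchanging the sums puts \<open>m\<close> outside, where
  \<open>norm (g m) \<le> 1\<close> removes \<open>g m\<close>. The first parts of the block bounds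
  add up to \<open>dyadic_const\<close>; the second parts cost about \<open>J^2 / sqrt U\<close>
  over \<open>J\<close> blocks, which explains the requirement \<open>U_J\<close>.\<close>

lemma small_primes_sum_le:
  "norm (\<Sum>p\<in>{p\<in>{1..N}. prime p \<and> real p \<le> U ^ 80}. \<Sum>m\<in>{m\<in>{1..N}. p * m \<le> N}.
      of_real (ln (real p)) * g p * g m * z ^ (p * m)) \<le> (dyadic_const + 1) * Y"
proof -
  define S where "S = {p\<in>{1..N}. prime p \<and> real p \<le> U ^ 80}"
  define B where "B j = {p\<in>S. 2 ^ j \<le> p \<and> p < 2 * 2 ^ j}" for j :: nat
  define c where "c p = of_real (ln (real p)) * g p" for p
  have SJ: "p < 2 ^ J" if "p \<in> S" for p
  proof -
    have "real p \<le> U ^ 80" using that by (simp add: S_def)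
    then have "real p < 2 ^ J" using J_large by linarith
    then have "real p < real (2 ^ J)" by (simp only: of_nat_power of_nat_numeral)
    then show ?thesis by (simp only: of_nat_less_iff)
  qed
  have "(\<Sum>p\<in>S. \<Sum>m\<in>{m\<in>{1..N}. p * m \<le> N}. of_real (ln (real p)) * g p * g m * z ^ (p * m))
      = (\<Sum>m\<in>{1..N}. \<Sum>p\<in>{p\<in>S. m * p \<le> N}. g m * (c p * z ^ (m * p)))"
    by (subst sum.swap_restrict) (auto simp: S_def c_def mult_ac intro!: sum.cong)
  also have "norm \<dots> \<le> (\<Sum>m\<in>{1..N}. \<Sum>j<J. norm (\<Sum>p\<in>{p\<in>B j. m * p \<le> N}. c p * z ^ (m * p)))"
  proof (rule sum_norm_le)
    fix m assume m: "m \<in> {1..N}"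
    have "norm (\<Sum>p\<in>{p\<in>S. m * p \<le> N}. g m * (c p * z ^ (m * p)))
        = norm (g m) * norm (\<Sum>p\<in>{p\<in>S. m * p \<le> N}. c p * z ^ (m * p))"
      by (simp only: sum_distrib_left [symmetric] norm_mult)
    also have "\<dots> \<le> 1 * norm (\<Sum>p\<in>{p\<in>S. m * p \<le> N}. c p * z ^ (m * p))"
      using unit_g [of m] m by (intro mult_right_mono) auto
    also have "\<dots> \<le> (\<Sum>j<J. norm (\<Sum>p\<in>{p\<in>B j. m * p \<le> N}. c p * z ^ (m * p)))"
      unfolding B_def mult_1 by (rule norm_sum_dyadic_le) (use SJ in \<open>auto simp: S_def\<close>)
    finally show "norm (\<Sum>p\<in>{p\<in>S. m * p \<le> N}. g m * (c p * z ^ (m * p)))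
        \<le> (\<Sum>j<J. norm (\<Sum>p\<in>{p\<in>B j. m * p \<le> N}. c p * z ^ (m * p)))" .
  qed
  also have "\<dots> = (\<Sum>j<J. \<Sum>m\<in>{1..N}. norm (\<Sum>p\<in>{p\<in>B j. m * p \<le> N}. c p * z ^ (m * p)))"
    by (rule sum.swap)
  also have "\<dots> \<le> (\<Sum>j<J. real (Suc j) * Y * (1 / sqrt (2 ^ j) + 9 / sqrt U))"
    unfolding c_def by (intro sum_mono small_prime_block_le) (auto simp: B_def S_def)
  also have "\<dots> \<le> (\<Sum>j<J. Y * (real (Suc j) * (1 / sqrt (2 ^ j))) + Y * ((real J + 1) * (9 / sqrt U)))"
  proof (rule sum_mono)
    fix j assume "j \<in> {..<J}"
    then have "Y * (real (Suc j) * (9 / sqrt U)) \<le> Y * ((real J + 1) * (9 / sqrt U))"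
      using Y_bounds U_pos by (intro mult_left_mono mult_right_mono) auto
    then show "real (Suc j) * Y * (1 / sqrt (2 ^ j) + 9 / sqrt U)
        \<le> Y * (real (Suc j) * (1 / sqrt (2 ^ j))) + Y * ((real J + 1) * (9 / sqrt U))"
      by (simp only: distrib_left mult_ac add_left_mono)
  qed
  also have "\<dots> = Y * (\<Sum>j<J. real (Suc j) * (1 / sqrt (2 ^ j))) + Y * (real J * ((real J + 1) * (9 / sqrt U)))"
    by (simp add: sum.distrib sum_distrib_left)
  also have "\<dots> \<le> Y * dyadic_const + Y * 1"
  proof (intro add_mono mult_left_mono sum_dyadic_weights_le)
    have "real J * (real J + 1) * 9 \<le> (real J + 1) * (real J + 1) * 9" by (intro mult_right_mono) auto
    also have "\<dots> \<le> sqrt U" using U_J by (simp add: power2_eq_square)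
    finally show "real J * ((real J + 1) * (9 / sqrt U)) \<le> 1"
      using U_pos by (simp add: field_simps)
  qed (use Y_bounds in auto)
  finally show ?thesis by (simp add: S_def algebra_simps)
qed

text \<open>The upper bound forces \<open>m \<le> U ^ 24\<close> as soon as
  \<open>p > U ^ 80\<close> and \<open>p * m \<le> N\<close>; the lower bound exceeds the effective
  length \<open>Y \<le> U ^ 96\<close> by a factor \<open>U ^ 7\<close>, so that the tail beyond
  \<open>N\<close> is negligible.\<close>

lemma N_le: "real N \<le> U ^ 104" "U ^ 103 \<le> real N"
proof -
  have pos: "U ^ 104 \<ge> 0" using U_pos by simp
  show "real N \<le> U ^ 104" unfolding N_def using pos by simp
  have "U ^ 103 + 1 \<le> U ^ 103 + U ^ 103" using U_power_mono [of 0 103] by simp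
  also have "\<dots> \<le> U * U ^ 103" using U1000 by (subst mult_2 [symmetric]) (intro mult_right_mono, auto)
  also have "\<dots> = U ^ 104" by (simp flip: power_Suc)
  finally show "U ^ 103 \<le> real N" unfolding N_def using pos by linarith
qed

text \<open>On primes above \<open>D\<close> the sieve weight is 1, so \<open>p\<close> may run over
  all integers with that weight. The resulting factor \<open>V\<close> is at most
  \<open>2 / ln U\<close> and cancels the \<open>ln U\<close> in front.\<close>

lemma large_prime_block_le:
  assumes S: "S \<subseteq> {p\<in>{1..N}. prime p \<and> \<not> real p \<le> U ^ 80}"
    and B: "B \<subseteq> {m. 2 ^ j \<le> m \<and> m < 2 * 2 ^ j \<and> real m \<le> U ^ 24}"
  shows "ln U * (\<Sum>p\<in>S. norm (\<Sum>m\<in>{m\<in>B. p * m \<le> N}. g m * z ^ (p * m)))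
     \<le> Y * (4 / sqrt (2 ^ j) + 8 * ln U / sqrt U)"
proof (cases "B = {}")
  case True
  have "ln U \<ge> 0" using U_pos by simp
  then show ?thesis using True Y_bounds U_pos by simp
next
  case False
  define P :: nat where "P = 2 ^ j"
  define D where "D = nat \<lfloor>U\<rfloor>"
  define V where "V = 2 / ln (real D + 1)"
  have P: "P > 0" "real P = 2 ^ j" by (simp_all add: P_def)
  have BP: "B \<subseteq> {P..<2 * P}" using B by (auto simp: P_def)
  obtain m0 where "m0 \<in> B" using False by blast
  then have "real P \<le> real m0" "real m0 \<le> U ^ 24" using B BP by auto
  then have PU: "real P \<le> U ^ 24" by linarith
  have D: "real D \<le> U" "U < real D + 1" "D \<ge> 1" unfolding D_def using U1000 by linarith+
  obtain \<mu> :: "nat \<Rightarrow> real" where \<mu>: "\<mu> 1 = 1" "\<And>d. d \<in> {1..D} \<Longrightarrow> \<bar>\<mu> d\<bar> \<le> real D ^ 2"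
      "(\<Sum>d\<in>{1..D}. \<Sum>e\<in>{1..D}. \<mu> d * \<mu> e / real (lcm d e)) \<le> V"
    using selberg_weights_exist [OF D(3)] unfolding V_def by blast
  have lnU: "ln U \<ge> 0" "ln U > 0" using U1000 by (simp_all add: ln_ge_zero)
  have lnD: "ln U \<le> ln (real D + 1)" using D U_pos by (intro ln_mono) auto
  have lnD0: "0 < ln (real D + 1)" using lnD lnU by linarith
  have V: "0 \<le> V" "V * ln U \<le> 2" "V \<le> 2 / ln U" "1 / U \<le> V"
  proof -
    show "0 \<le> V" using lnD0 unfolding V_def by (intro divide_nonneg_pos) simp_all
    show "V \<le> 2 / ln U" unfolding V_def by (rule divide_left_mono [OF lnD _ mult_pos_pos [OF lnD0 lnU(2)]]) simp
    then show "V * ln U \<le> 2" using lnU by (simp add: pos_le_divide_eq)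
    have "ln (real D + 1) \<le> real D" using ln_le_minus_one [of "real D + 1"] by simp
    then have le: "ln (real D + 1) \<le> 2 * U" using D U_pos by linarith
    have "2 / (2 * U) \<le> V" unfolding V_def
      by (rule divide_left_mono [OF le _ mult_pos_pos [OF _ lnD0]]) (use U_pos in simp_all)
    then show "1 / U \<le> V" by simp
  qed
  define R where "R = (\<Sum>p\<in>{1..N}. sieve_weight \<mu> D p * norm (\<Sum>m\<in>{m\<in>B. p * m \<le> N}. g m * z ^ (p * m)))"
  have "(\<Sum>p\<in>S. norm (\<Sum>m\<in>{m\<in>B. p * m \<le> N}. g m * z ^ (p * m)))
      = (\<Sum>p\<in>S. sieve_weight \<mu> D p * norm (\<Sum>m\<in>{m\<in>B. p * m \<le> N}. g m * z ^ (p * m)))"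
  proof (rule sum.cong [OF refl])
    fix p assume "p \<in> S"
    then have p: "prime p" "U ^ 80 < real p" using S by auto
    have "real D \<le> U ^ 80" using D U_power_mono [of 1 80] by simp
    then have "D < p" using p by linarith
    then have "sieve_weight \<mu> D p = 1" using p D \<mu> by (simp add: sieve_weight_prime)
    then show "norm (\<Sum>m\<in>{m\<in>B. p * m \<le> N}. g m * z ^ (p * m))
        = sieve_weight \<mu> D p * norm (\<Sum>m\<in>{m\<in>B. p * m \<le> N}. g m * z ^ (p * m))" by simp
  qed
  also have "\<dots> \<le> R" unfolding R_def
    using S by (intro sum_mono2) (auto simp: sieve_weight_nonneg)
  finally have SR: "(\<Sum>p\<in>S. norm (\<Sum>m\<in>{m\<in>B. p * m \<le> N}. g m * z ^ (p * m))) \<le> R" .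
  \<comment> \<open>Here the range of \<open>m\<close> meets the minor arc condition:
    \<open>k * D^2 * P\<close> is at most \<open>U ^ 27\<close>, while \<open>q\<close> exceeds
    \<open>U ^ 32\<close>.\<close>
  have kP: "2 * (k * (D\<^sup>2 * P)) \<le> q"
  proof -
    have "real k * ((real D)\<^sup>2 * real P) \<le> U * (U\<^sup>2 * U ^ 24)"
      using k D PU U_pos by (intro mult_mono power_mono) auto
    then have "2 * (real k * ((real D)\<^sup>2 * real P)) \<le> 2 * (U * (U\<^sup>2 * U ^ 24))"
      by (rule mult_left_mono) simp
    also have "\<dots> \<le> U * (U * (U\<^sup>2 * U ^ 24))" by (rule mult_right_mono) (use U1000 in simp_all)
    also have "\<dots> = U ^ 28" by (simp flip: power_Suc power_add)
    also have "\<dots> \<le> U ^ 32" by (rule U_power_mono) simp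
    also have "\<dots> \<le> real q" using q by simp
    finally have "real (2 * (k * (D\<^sup>2 * P))) \<le> real q" by simp
    then show ?thesis by (simp only: of_nat_le_iff)
  qed
  have cf: "norm (g m) \<le> 1" if "m \<in> B" for m using that BP P by (intro unit_g) auto
  have D6: "real D ^ 6 \<le> U ^ 6" using D by (intro power_mono) auto
  have YP: "U ^ 71 \<le> Y / real P"
  proof -
    have "U ^ 71 * real P \<le> U ^ 71 * U ^ 24" using PU U_pos by (intro mult_left_mono) auto
    also have "\<dots> = U ^ 95" by (simp flip: power_add)
    also have "\<dots> \<le> Y" by (rule Y_bounds)
    finally show ?thesis using P by (simp add: pos_le_divide_eq)
  qed
  \<comment> \<open>The lower bound \<open>1 / U \<le> V\<close> serves this comparison: the error
    \<open>D^6\<close> of the sieve is at most the main term, as \<open>Y / P\<close> is still a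
    large power of \<open>U\<close>.\<close>
  have D6V: "real D ^ 6 \<le> V * Y / real P"
  proof -
    have "U ^ 6 \<le> U ^ 70" by (rule U_power_mono) simp
    also have "\<dots> = (1 / U) * U ^ 71" using U_pos by (simp add: power_eq_if)
    also have "\<dots> \<le> V * (Y / real P)" using V YP U_pos by (intro mult_mono) auto
    finally show ?thesis using D6 by simp
  qed
  have q6: "real P * real D ^ 6 * real q \<le> 2 * (Y / U)"
  proof -
    have "real P * real D ^ 6 * real q \<le> U ^ 24 * U ^ 6 * (2 * U ^ 64)"
      using PU D6 q U_pos by (intro mult_mono) auto
    also have "\<dots> = 2 * U ^ 94" by (simp flip: power_add)
    also have "U ^ 94 \<le> Y / U" using Y_bounds U_pos by (simp add: pos_le_divide_eq mult.commute flip: power_Suc)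
    finally show ?thesis by simp
  qed
  have "R\<^sup>2 \<le> (V * Y / real P + real D ^ 6) * (real P * (V * Y / real P + real D ^ 6) + 8 * real P * real P * real D ^ 6 * real q)"
    unfolding R_def
    by (rule bilinear_block_sieved [OF z_def Y_bounds(3) BP P(1) k(1) cf sep kP \<mu>(2,3) V(1)])
  also have "\<dots> \<le> (2 * (V * Y / real P)) * (real P * (2 * (V * Y / real P)) + 16 * real P * (Y / U))"
  proof -
    have "8 * real P * (real P * real D ^ 6 * real q) \<le> 8 * real P * (2 * (Y / U))"
      using q6 by (intro mult_left_mono) auto
    then have a: "8 * real P * real P * real D ^ 6 * real q \<le> 16 * real P * (Y / U)" by (simp add: mult_ac)
    have b: "V * Y / real P + real D ^ 6 \<le> 2 * (V * Y / real P)" using D6V by linarith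
    have c: "0 \<le> V * Y / real P" using V(1) Y_bounds(3) by simp
    show ?thesis
      by (rule mult_mono [OF b add_mono [OF mult_left_mono [OF b] a]]) (use c Y_bounds(3) in simp_all)
  qed
  also have "\<dots> = 4 * V\<^sup>2 * Y\<^sup>2 / real P + 32 * V * Y\<^sup>2 / U"
    using P by (simp add: field_simps power2_eq_square)
  \<comment> \<open>Because \<open>ln U \<ge> 1\<close>, \<open>V\<close> is at most 2; so
    \<open>32 * V\<close> is at most \<open>64 = 8^2\<close>, which gives \<open>8 / sqrt U\<close>
    after the root.\<close>
  also have "\<dots> \<le> (2 * V * Y / sqrt (2 ^ j))\<^sup>2 + (8 * Y / sqrt U)\<^sup>2"
  proof -
    have "1 \<le> ln U"
    proof -
      have "exp 1 \<le> U" using exp_le U1000 by linarith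
      then show ?thesis using U_pos by (subst ln_ge_iff) auto
    qed
    then have "V \<le> 2" using V(2) V(1) mult_left_mono [of 1 "ln U" V] by simp
    then have "32 * V * Y\<^sup>2 / U \<le> 64 * Y\<^sup>2 / U" using U_pos by (intro divide_right_mono mult_right_mono) auto
    then show ?thesis using U_pos P by (simp add: power_divide power_mult_distrib)
  qed
  finally have sq: "R\<^sup>2 \<le> (2 * V * Y / sqrt (2 ^ j))\<^sup>2 + (8 * Y / sqrt U)\<^sup>2" .
  have "R \<le> 2 * V * Y / sqrt (2 ^ j) + 8 * Y / sqrt U"
    by (rule le_sum_of_square_le [OF sq]) (use V Y_bounds U_pos in simp_all)
  then have "ln U * R \<le> ln U * (2 * V * Y / sqrt (2 ^ j) + 8 * Y / sqrt U)"
    using lnU by (intro mult_left_mono) auto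
  also have "\<dots> = (V * ln U) * (2 * Y / sqrt (2 ^ j)) + Y * (8 * ln U / sqrt U)"
    by (simp add: distrib_left mult_ac)
  also have "\<dots> \<le> 2 * (2 * Y / sqrt (2 ^ j)) + Y * (8 * ln U / sqrt U)"
    using V Y_bounds by (intro add_right_mono mult_right_mono) auto
  also have "\<dots> = Y * (4 / sqrt (2 ^ j) + 8 * ln U / sqrt U)" by (simp add: distrib_left)
  finally show ?thesis using mult_left_mono [OF SR lnU(1)] by linarith
qed

text \<open>Here \<open>p > U ^ 80\<close> leaves only \<open>m \<le> U ^ 24\<close>, and
  \<open>ln p \<le> 104 * ln U\<close> since \<open>p \<le> N\<close>. The dyadic blocks are taken
  in \<open>m\<close>, so the logarithm is a common factor of each block, and
  \<open>large_prime_block_le\<close> removes it.\<close>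

lemma large_primes_sum_le:
  "norm (\<Sum>p\<in>{p\<in>{1..N}. prime p \<and> \<not> real p \<le> U ^ 80}. \<Sum>m\<in>{m\<in>{1..N}. p * m \<le> N}.
      of_real (ln (real p)) * g p * g m * z ^ (p * m)) \<le> (416 * dyadic_const + 1) * Y"
proof -
  define S where "S = {p\<in>{1..N}. prime p \<and> \<not> real p \<le> U ^ 80}"
  define M where "M = {m\<in>{1..N}. real m \<le> U ^ 24}"
  define B where "B j = {m\<in>M. 2 ^ j \<le> m \<and> m < 2 * 2 ^ j}" for j :: nat
  have lnU: "ln U \<ge> 0" using U_pos by simp
  have MJ: "m < 2 ^ J" if "m \<in> M" for m
  proof -
    have "real m \<le> U ^ 24" using that by (simp add: M_def)
    also have "\<dots> \<le> U ^ 80" by (rule U_power_mono) simp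
    finally have "real m < 2 ^ J" using J_large by linarith
    then have "real m < real (2 ^ J)" by (simp only: of_nat_power of_nat_numeral)
    then show ?thesis by (simp only: of_nat_less_iff)
  qed
  have "norm (\<Sum>p\<in>S. \<Sum>m\<in>{m\<in>{1..N}. p * m \<le> N}. of_real (ln (real p)) * g p * g m * z ^ (p * m))
      \<le> (\<Sum>p\<in>S. 104 * ln U * (\<Sum>j<J. norm (\<Sum>m\<in>{m\<in>B j. p * m \<le> N}. g m * z ^ (p * m))))"
  proof (rule sum_norm_le)
    fix p assume p: "p \<in> S"
    then have p1: "p > 0" "U ^ 80 < real p" "p \<le> N" by (auto simp: S_def)
    have "real p \<le> U ^ 104" using p1 N_le by linarith
    then have "ln (real p) \<le> ln (U ^ 104)" using p1 by (intro ln_mono) auto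
    then have lnp: "ln (real p) \<le> 104 * ln U" using U_pos by (simp add: ln_realpow)
    have lnp0: "0 \<le> ln (real p)" using p1 by (simp add: Suc_le_eq)
    have set: "{m\<in>{1..N}. p * m \<le> N} = {m\<in>M. p * m \<le> N}"
    proof -
      have "real m \<le> U ^ 24" if m: "p * m \<le> N" for m
      proof (rule ccontr)
        assume "\<not> real m \<le> U ^ 24"
        then have "U ^ 80 * U ^ 24 < real p * real m" using p1 U_pos by (intro mult_strict_mono) auto
        also have "\<dots> = real (p * m)" by simp
        also have "\<dots> \<le> real N" using m by (simp only: of_nat_le_iff)
        also have "\<dots> \<le> U ^ 104" by (rule N_le)
        also have "\<dots> = U ^ 80 * U ^ 24" by (simp flip: power_add)
        finally show False by simp
      qed
      then show ?thesis by (auto simp: M_def)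
    qed
    have "norm (\<Sum>m\<in>{m\<in>{1..N}. p * m \<le> N}. of_real (ln (real p)) * g p * g m * z ^ (p * m))
        = norm (of_real (ln (real p)) * g p * (\<Sum>m\<in>{m\<in>M. p * m \<le> N}. g m * z ^ (p * m)))"
      unfolding set by (simp add: sum_distrib_left mult.assoc)
    also have "\<dots> = (ln (real p) * norm (g p)) * norm (\<Sum>m\<in>{m\<in>M. p * m \<le> N}. g m * z ^ (p * m))"
      using lnp0 by (simp only: norm_mult norm_of_real abs_of_nonneg)
    also have "\<dots> \<le> (104 * ln U * 1) * (\<Sum>j<J. norm (\<Sum>m\<in>{m\<in>B j. p * m \<le> N}. g m * z ^ (p * m)))"
    proof (intro mult_mono lnp unit_g p1)
      show "norm (\<Sum>m\<in>{m\<in>M. p * m \<le> N}. g m * z ^ (p * m))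
          \<le> (\<Sum>j<J. norm (\<Sum>m\<in>{m\<in>B j. p * m \<le> N}. g m * z ^ (p * m)))"
        unfolding B_def by (rule norm_sum_dyadic_le) (use MJ in \<open>auto simp: M_def\<close>)
    qed (use lnU in auto)
    finally show "norm (\<Sum>m\<in>{m\<in>{1..N}. p * m \<le> N}. of_real (ln (real p)) * g p * g m * z ^ (p * m))
        \<le> 104 * ln U * (\<Sum>j<J. norm (\<Sum>m\<in>{m\<in>B j. p * m \<le> N}. g m * z ^ (p * m)))" by simp
  qed
  also have "\<dots> = 104 * (\<Sum>j<J. ln U * (\<Sum>p\<in>S. norm (\<Sum>m\<in>{m\<in>B j. p * m \<le> N}. g m * z ^ (p * m))))"
    by (simp only: sum_distrib_left [symmetric] mult.assoc) (subst sum.swap, rule refl)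
  also have "\<dots> \<le> 104 * (\<Sum>j<J. Y * (4 / sqrt (2 ^ j) + 8 * ln U / sqrt U))"
    by (intro mult_left_mono sum_mono large_prime_block_le) (auto simp: S_def B_def M_def)
  also have "\<dots> \<le> 104 * (\<Sum>j<J. 4 * Y * (real (Suc j) * (1 / sqrt (2 ^ j))) + Y * (8 * ln U / sqrt U))"
  proof (intro mult_left_mono sum_mono)
    fix j
    have "1 * (1 / sqrt (2 ^ j)) \<le> real (Suc j) * (1 / sqrt (2 ^ j))" by (intro mult_right_mono) auto
    then have "4 * Y * (1 / sqrt (2 ^ j)) \<le> 4 * Y * (real (Suc j) * (1 / sqrt (2 ^ j)))"
      using Y_bounds by (intro mult_left_mono) auto
    then show "Y * (4 / sqrt (2 ^ j) + 8 * ln U / sqrt U)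
        \<le> 4 * Y * (real (Suc j) * (1 / sqrt (2 ^ j))) + Y * (8 * ln U / sqrt U)"
      by (simp add: distrib_left)
  qed auto
  \<comment> \<open>\<open>416 = 104 * 4\<close> and \<open>832 = 104 * 8\<close>; the second part,
    taken over \<open>J\<close> blocks, is what \<open>U_lnJ\<close> makes at most
    \<open>Y\<close>.\<close>
  also have "\<dots> = 416 * Y * (\<Sum>j<J. real (Suc j) * (1 / sqrt (2 ^ j))) + Y * (832 * ln U * real J / sqrt U)"
    unfolding sum.distrib sum_distrib_left [symmetric] by (simp add: distrib_left)
  also have "\<dots> \<le> 416 * Y * dyadic_const + Y * 1"
  proof (intro add_mono mult_left_mono sum_dyadic_weights_le)
    show "832 * ln U * real J / sqrt U \<le> 1" using U_lnJ U_pos by simp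
  qed (use Y_bounds in auto)
  finally show ?thesis by (simp add: S_def algebra_simps)
qed

end

section \<open>The sum over $k$\<close>

lemma minor_arc_sum_bound:
  "\<exists>C\<ge>0. \<forall>U \<alpha> Y k q J N z g. minor_arc_sum U \<alpha> Y k q J N z g \<longrightarrow>
      norm (\<Sum>n\<in>{1..N}. g n * z ^ n) \<le> C * (Y / ln U)"
proof -
  obtain C0 where C0: "C0 \<ge> 0" "\<forall>Y>0. \<forall>N z g. norm z = exp (- 1 / Y) \<longrightarrow> multiplicative g \<longrightarrow> unit_bounded g \<longrightarrow>
     \<bar>ln Y\<bar> * norm (\<Sum>n\<in>{1..N}. g n * z ^ n)
       \<le> norm (\<Sum>p\<in>{p\<in>{1..N}. prime p}. \<Sum>m\<in>{m\<in>{1..N}. p * m \<le> N}. of_real (ln (real p)) * g p * g m * z ^ (p * m)) + C0 * Y"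
    using weighted_sum_reduction by (elim exE conjE)
  define C where "C = (dyadic_const + 1) + (416 * dyadic_const + 1) + C0"
  have "norm (\<Sum>n\<in>{1..N}. g n * z ^ n) \<le> C * (Y / ln U)"
    if "minor_arc_sum U \<alpha> Y k q J N z g" for U \<alpha> Y k q J N z g
  proof -
    interpret minor_arc_sum U \<alpha> Y k q J N z g by fact
    define h where "h p = (\<Sum>m\<in>{m\<in>{1..N}. p * m \<le> N}. of_real (ln (real p)) * g p * g m * z ^ (p * m))" for p
    have lnU: "ln U > 0" using U1000 by simp
    have "ln (U ^ 95) \<le> ln Y" using Y_bounds U_pos by (intro ln_mono) auto
    then have "ln U \<le> \<bar>ln Y\<bar>" using lnU U_pos by (simp add: ln_realpow)
    then have "ln U * norm (\<Sum>n\<in>{1..N}. g n * z ^ n) \<le> \<bar>ln Y\<bar> * norm (\<Sum>n\<in>{1..N}. g n * z ^ n)"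
      by (intro mult_right_mono) auto
    also have "\<dots> \<le> norm (\<Sum>p\<in>{p\<in>{1..N}. prime p}. h p) + C0 * Y"
    proof -
      have "norm z = exp (- 1 / Y)" by (simp add: z_def norm_mult)
      with C0(2) Y_bounds(3) g show ?thesis unfolding h_def by blast
    qed
    also have "(\<Sum>p\<in>{p\<in>{1..N}. prime p}. h p)
        = (\<Sum>p\<in>{p\<in>{1..N}. prime p \<and> real p \<le> U ^ 80}. h p) + (\<Sum>p\<in>{p\<in>{1..N}. prime p \<and> \<not> real p \<le> U ^ 80}. h p)"
      by (subst sum.union_disjoint [symmetric]) (auto intro!: sum.cong)
    also have "norm \<dots> \<le> (dyadic_const + 1) * Y + (416 * dyadic_const + 1) * Y"
      unfolding h_def by (intro norm_triangle_le add_mono small_primes_sum_le large_primes_sum_le)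
    finally have "ln U * norm (\<Sum>n\<in>{1..N}. g n * z ^ n) \<le> C * Y" by (simp add: C_def algebra_simps)
    then show ?thesis using lnU by (simp add: pos_le_divide_eq mult.commute)
  qed
  moreover have "C \<ge> 0" using C0 dyadic_const_nonneg by (simp add: C_def)
  ultimately show ?thesis by (intro exI [of _ C]) blast
qed

section \<open>Infinite series and their tails\<close>

lemma norm_infsum_le:
  fixes F :: "nat \<Rightarrow> complex"
  assumes "\<And>A. finite A \<Longrightarrow> A \<subseteq> S \<Longrightarrow> (\<Sum>n\<in>A. norm (F n)) \<le> b"
  shows "F summable_on S" "norm (infsum F S) \<le> b"
proof -
  have abs: "(\<lambda>n. norm (F n)) summable_on S"
    using assms by (intro nonneg_bdd_above_summable_on bdd_aboveI2) auto
  then show "F summable_on S" by (rule abs_summable_summable)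
  have "norm (infsum F S) \<le> infsum (\<lambda>n. norm (F n)) S" using abs by (rule norm_infsum_bound)
  also have "\<dots> \<le> b" using assms abs by (intro infsum_le_finite_sums) auto
  finally show "norm (infsum F S) \<le> b" .
qed

lemma sum_exp_powers_beyond:
  assumes Y: "Y > 0" and A: "finite A" "A \<subseteq> {Suc N..}"
  shows "(\<Sum>n\<in>A. exp (- 1 / Y) ^ n) \<le> exp (- (real N / Y)) * Y"
proof -
  obtain M where M: "A \<subseteq> {..M}" using A(1) finite_nat_iff_bounded_le by blast
  have "A \<subseteq> {1 + N..M + N}"
  proof
    fix n assume "n \<in> A"
    then have "n \<in> {Suc N..}" "n \<in> {..M}" using A M by blast+
    then show "n \<in> {1 + N..M + N}" by simp
  qed
  then have "(\<Sum>n\<in>A. exp (- 1 / Y) ^ n) \<le> (\<Sum>n\<in>{1 + N..M + N}. exp (- 1 / Y) ^ n)"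
    by (intro sum_mono2) auto
  also have "\<dots> = exp (- 1 / Y) ^ N * (\<Sum>j\<in>{1..M}. exp (- (1 / Y)) ^ j)"
    by (simp only: sum.shift_bounds_cl_nat_ivl power_add sum_distrib_left) (simp add: mult.commute)
  also have "\<dots> \<le> exp (- 1 / Y) ^ N * (1 / (1 / Y))"
    using Y by (intro mult_left_mono exp_geometric_sum_le) auto
  also have "exp (- 1 / Y) ^ N = exp (- (real N / Y))" by (simp add: exp_of_nat_mult [symmetric])
  finally show ?thesis by simp
qed

lemma norm_power_series_le:
  fixes g :: "nat \<Rightarrow> complex"
  assumes Y: "Y > 0" and w: "norm w = exp (- 1 / Y)" and g: "\<And>n. n \<ge> 1 \<Longrightarrow> norm (g n) \<le> 1"
  shows "norm (\<Sum>\<^sub>\<infinity>n\<in>{1..}. c * (g n * w ^ n)) \<le> norm c * Y"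
    and "norm (\<Sum>\<^sub>\<infinity>n\<in>{1..}. c * (g n * w ^ n)) \<le> norm c * (norm (\<Sum>n\<in>{1..N}. g n * w ^ n) + exp (- (real N / Y)) * Y)"
proof -
  define F where "F n = c * (g n * w ^ n)" for n
  have F: "norm (F n) \<le> norm c * exp (- 1 / Y) ^ n" if "n \<ge> 1" for n
  proof -
    have "norm (g n) * norm w ^ n \<le> 1 * norm w ^ n" using g that by (intro mult_right_mono) auto
    then show ?thesis by (simp add: F_def norm_mult norm_power w mult_left_mono)
  qed
  have fin: "(\<Sum>n\<in>A. norm (F n)) \<le> norm c * (exp (- (real K / Y)) * Y)" if "finite A" "A \<subseteq> {Suc K..}" for A K
  proof -
    have "(\<Sum>n\<in>A. norm (F n)) \<le> (\<Sum>n\<in>A. norm c * exp (- 1 / Y) ^ n)"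
      using that by (intro sum_mono F) auto
    also have "\<dots> \<le> norm c * (exp (- (real K / Y)) * Y)"
      unfolding sum_distrib_left [symmetric] by (intro mult_left_mono sum_exp_powers_beyond Y that) auto
    finally show ?thesis .
  qed
  have tail: "F summable_on {Suc K..}" "norm (infsum F {Suc K..}) \<le> norm c * (exp (- (real K / Y)) * Y)" for K
    using norm_infsum_le [of "{Suc K..}" F] fin by blast+
  show "norm (\<Sum>\<^sub>\<infinity>n\<in>{1..}. c * (g n * w ^ n)) \<le> norm c * Y"
    using tail(2) [of 0] by (simp add: F_def [symmetric])
  have "infsum F {1..} = infsum F ({1..N} \<union> {Suc N..})" by (rule arg_cong [of _ _ "infsum F"]) auto
  also have "\<dots> = infsum F {1..N} + infsum F {Suc N..}"
    by (rule infsum_Un_disjoint) (use tail(1) in auto)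
  also have "infsum F {1..N} = c * (\<Sum>n\<in>{1..N}. g n * w ^ n)"
    by (simp add: F_def sum_distrib_left)
  finally have "norm (infsum F {1..}) \<le> norm (c * (\<Sum>n\<in>{1..N}. g n * w ^ n)) + norm (infsum F {Suc N..})"
    by (simp add: norm_triangle_ineq)
  also have "\<dots> \<le> norm c * norm (\<Sum>n\<in>{1..N}. g n * w ^ n) + norm c * (exp (- (real N / Y)) * Y)"
    using tail(2) by (intro add_mono) (auto simp: norm_mult)
  finally show "norm (\<Sum>\<^sub>\<infinity>n\<in>{1..}. c * (g n * w ^ n)) \<le> norm c * (norm (\<Sum>n\<in>{1..N}. g n * w ^ n) + exp (- (real N / Y)) * Y)"
    by (simp add: F_def [symmetric] distrib_left)
qed

lemma sum_inverse_squares_tail_le: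
  assumes "K \<ge> 1"
  shows "(\<Sum>k\<in>{Suc K..M}. 1 / real k ^ 2) \<le> 1 / real K"
proof -
  have "(\<Sum>k\<in>{Suc K..K + m}. 1 / real k ^ 2) \<le> 1 / real K - 1 / real (K + m)" for m
  proof (induction m)
    case (Suc m)
    have "1 / real (Suc (K + m)) ^ 2 \<le> 1 / real (K + m) - 1 / real (Suc (K + m))"
      using assms by (simp add: divide_simps power2_eq_square)
    with Suc show ?case by simp
  qed simp
  from this [of "M - K"] show ?thesis using assms
    by (cases "K \<le> M") (auto intro: order_trans)
qed

text \<open>Dirichlet's theorem with denominators up to about \<open>U ^ 64\<close> gives an
  approximation of the quality named in \<open>minor_arc\<close>, so its denominator exceeds
  \<open>U ^ 32\<close>. The factor 2 allows for rounding \<open>U ^ 64\<close> up to an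
  integer.\<close>

lemma Dirichlet_minor_arc:
  assumes U: "U \<ge> 1" and minor: "minor_arc (U ^ 96) \<alpha>"
  obtains q where "separated \<alpha> q" "U ^ 32 < real q" "real q \<le> 2 * U ^ 64"
proof -
  define M where "M = nat \<lceil>U ^ 64\<rceil>"
  have "U ^ 64 \<ge> 1" using U by simp
  then have M: "M > 0" "U ^ 64 \<le> real M" "real M \<le> 2 * U ^ 64" unfolding M_def by linarith+
  obtain a b where ab: "coprime a b" "0 < b" "b \<le> int M" "\<bar>of_int b * \<alpha> - of_int a\<bar> < 1 / real M"
    using Dirichlet_approx_coprime [OF M(1)] .
  define q where "q = nat b"
  have q: "int q = b" "q > 0" "real q = of_int b" "real q \<le> real M" using ab by (auto simp: q_def)
  have pw: "(U ^ 96) powr (2 / 3) = U ^ 64" "(U ^ 96) powr (1 / 3) = U ^ 32"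
  proof -
    have "(U ^ 96) powr t = U powr (96 * t)" for t
      using powr_realpow [of U 96] powr_powr [of U 96 t] U by simp
    from this [of "2 / 3"] this [of "1 / 3"]
    show "(U ^ 96) powr (2 / 3) = U ^ 64" "(U ^ 96) powr (1 / 3) = U ^ 32" using U by simp_all
  qed
  have "\<bar>\<alpha> - of_int a / real q\<bar> = \<bar>of_int b * \<alpha> - of_int a\<bar> / real q"
  proof -
    have "\<alpha> - of_int a / real q = (of_int b * \<alpha> - of_int a) / real q"
      unfolding q(3) [symmetric] using q(2) by (simp add: diff_divide_distrib)
    then show ?thesis by (simp only: abs_divide abs_of_nat)
  qed
  also have "\<dots> \<le> 1 / U ^ 64 / real q"
  proof (rule divide_right_mono)
    have "1 / real M \<le> 1 / U ^ 64" using M U by (intro divide_left_mono) auto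
    then show "\<bar>of_int b * \<alpha> - of_int a\<bar> \<le> 1 / U ^ 64" using ab by linarith
  qed simp
  finally have "\<bar>\<alpha> - of_int a / real q\<bar> \<le> 1 / (real q * (U ^ 96) powr (2 / 3))"
    by (simp add: pw mult.commute)
  then have "real q > (U ^ 96) powr (1 / 3)"
    using minor ab q unfolding minor_arc_def by blast
  moreover have "coprime a (int q)" "\<bar>real q * \<alpha> - of_int a\<bar> < 1 / real M"
    unfolding q(1,3) by (rule ab)+
  then have "separated \<alpha> q" using q(2,4) by (intro separatedI)
  ultimately show ?thesis using that q M pw by auto
qed

text \<open>As \<open>z ^ k\<close> has modulus \<open>exp (- k / X)\<close> and phase
  \<open>k * \<alpha>\<close>, the \<open>k\<close>-th series is a power series of effective length
  \<open>Y = X / k\<close> with coefficients \<open>f n ^ k\<close>, again multiplicative and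
  bounded by 1. With the factor \<open>1 / k\<close> in front it contributes at most a constant
  times \<open>X / k^2\<close>, and a further \<open>1 / ln U\<close> is saved for
  \<open>k \<le> U\<close>.\<close>

lemma Psi_bound:
  fixes C :: real
  assumes C: "C \<ge> 0"
    and bound: "\<And>U \<alpha> Y k q J N z g. minor_arc_sum U \<alpha> Y k q J N z g \<Longrightarrow>
      norm (\<Sum>n\<in>{1..N}. g n * z ^ n) \<le> C * (Y / ln U)"
    and U: "U \<ge> 1000" "9 * (121 * ln U + 2)\<^sup>2 \<le> sqrt U" "1 + ln (2 * U ^ 64) \<le> U"
      "832 * ln U * (121 * ln U + 1) \<le> sqrt U"
    and minor: "minor_arc (U ^ 96) \<alpha>" and f: "multiplicative f" "unit_bounded f"
  shows "norm (Psi (of_real (exp (- 1 / U ^ 96)) * ee \<alpha>) f) \<le> (2 * C + 4) * (U ^ 96 / ln U)"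
proof -
  define z where "z = of_real (exp (- 1 / U ^ 96)) * ee \<alpha>"
  define X where "X = U ^ 96"
  \<comment> \<open>The constant 121 exceeds 120, so that with \<open>ln 2 \<ge> 2 / 3\<close> the
    power \<open>2 ^ J\<close> passes \<open>U ^ 80\<close>.\<close>
  define J where "J = nat \<lceil>121 * ln U\<rceil>"
  define N where "N = nat \<lfloor>U ^ 104\<rfloor>"
  have U1: "U \<ge> 1" "U > 0" using U by auto
  have X: "X > 0" using U1 by (simp add: X_def)
  have lnU: "ln U > 0" using U by simp
  have lnU_le: "ln U \<le> U" using ln_le_minus_one [of U] U1 by simp
  obtain q where q: "separated \<alpha> q" "U ^ 32 < real q" "real q \<le> 2 * U ^ 64"
    using Dirichlet_minor_arc [OF U1(1) minor] .
  have J: "121 * ln U \<le> real J" "real J \<le> 121 * ln U + 1" unfolding J_def using lnU by linarith+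
  have J_large: "U ^ 80 < 2 ^ J"
  proof -
    have "ln (U ^ 80) = 80 * ln U" using U1 by (simp add: ln_realpow)
    also have "\<dots> < 121 * ln U * (2 / 3)" using lnU by simp
    also have "\<dots> \<le> real J * ln 2" using J lnU ln2_ge_two_thirds by (intro mult_mono) auto
    also have "\<dots> = ln (2 ^ J)" by (simp add: ln_realpow)
    finally show ?thesis using U1 by simp
  qed
  define I where "I k = (\<Sum>\<^sub>\<infinity>n\<in>{1..}. f n ^ k / of_nat k * z ^ (n * k))" for k :: nat
  have I: "norm (I k) \<le> (C + 1) * (X / ln U) * (1 / real k ^ 2) + (if real k \<le> U then 0 else X * (1 / real k ^ 2))"
    if k: "k \<ge> 1" for k
  proof -
    define Y where "Y = X / real k"
    define w where "w = of_real (exp (- 1 / Y)) * ee (real k * \<alpha>)"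
    define g where "g n = f n ^ k" for n
    have Y: "Y > 0" using X k by (simp add: Y_def)
    have zk: "z ^ k = w"
      by (simp add: z_def w_def Y_def X_def power_mult_distrib ee_power of_real_power [symmetric] exp_of_nat_mult [symmetric]
           del: of_real_power)
    have Ik: "I k = (\<Sum>\<^sub>\<infinity>n\<in>{1..}. (1 / of_nat k) * (g n * w ^ n))"
      unfolding I_def g_def zk [symmetric] by (intro infsum_cong) (simp add: power_mult [symmetric] mult.commute)
    have gb: "norm (g n) \<le> 1" if "n \<ge> 1" for n
      using f(2) that by (simp add: g_def norm_power unit_bounded_def power_le_one)
    have w: "norm w = exp (- 1 / Y)" by (simp add: w_def norm_mult)
    have nk: "norm (1 / of_nat k :: complex) = 1 / real k" by (simp add: norm_divide)
    show ?thesis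
    proof (cases "real k \<le> U")
      case True
      have "multiplicative g" using f(1) by (simp add: multiplicative_def g_def power_mult_distrib)
      moreover have "unit_bounded g" using gb by (simp add: unit_bounded_def)
      ultimately have arc: "minor_arc_sum U \<alpha> Y k q J N w g"
      proof unfold_locales
        have "(real J + 1)\<^sup>2 \<le> (121 * ln U + 2)\<^sup>2" using J by (intro power_mono) auto
        then show "9 * (real J + 1)\<^sup>2 \<le> sqrt U" using U(2) by linarith
        have "832 * ln U * real J \<le> 832 * ln U * (121 * ln U + 1)" using J lnU by (intro mult_left_mono) auto
        then show "832 * ln U * real J \<le> sqrt U" using U(4) by linarith
      qed (use U J_large k True q in \<open>simp_all add: Y_def X_def w_def N_def\<close>)
      then interpret minor_arc_sum U \<alpha> Y k q J N w g .
      \<comment> \<open>\<open>N\<close> is at least \<open>U ^ 7 * Y\<close>, hence at least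
        \<open>Y * ln U\<close>, and \<open>exp (- t) \<le> 1 / t\<close>; so the truncation error
        fits into the main bound.\<close>
      have "exp (- (real N / Y)) \<le> 1 / ln U"
      proof -
        have "ln U * Y \<le> U ^ 7 * U ^ 96"
          using lnU_le U_power_mono [of 1 7] Y_bounds U_pos lnU by (intro mult_mono) auto
        also have "\<dots> = U ^ 103" by (simp flip: power_add)
        also have "\<dots> \<le> real N" by (rule N_le)
        finally have "ln U \<le> real N / Y" using Y by (simp add: pos_le_divide_eq)
        also have "\<dots> \<le> exp (real N / Y)" using exp_ge_add_one_self [of "real N / Y"] by linarith
        finally have "1 / exp (real N / Y) \<le> 1 / ln U" using lnU by (intro divide_left_mono) auto
        then show ?thesis by (simp add: exp_minus inverse_eq_divide)
      qed
      then have "exp (- (real N / Y)) * Y \<le> 1 / ln U * Y" using Y by (intro mult_right_mono) auto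
      then have "norm (\<Sum>n\<in>{1..N}. g n * w ^ n) + exp (- (real N / Y)) * Y \<le> C * (Y / ln U) + Y / ln U"
        using bound [OF arc] by (intro add_mono) auto
      then have "norm (I k) \<le> 1 / real k * (C * (Y / ln U) + Y / ln U)"
        unfolding Ik using norm_power_series_le(2) [OF Y w gb, where c = "1 / of_nat k" and N = N] unfolding nk
        by (meson divide_nonneg_nonneg mult_left_mono of_nat_0_le_iff order_trans zero_le_one)
      also have "\<dots> = (C + 1) * (X / ln U) * (1 / real k ^ 2)"
        using k lnU by (simp add: Y_def X_def field_simps power2_eq_square)
      finally show ?thesis using True by simp
    next
      case False
      have "norm (I k) \<le> 1 / real k * Y"
        unfolding Ik using norm_power_series_le(1) [OF Y w gb, where c = "1 / of_nat k"] unfolding nk .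
      also have "\<dots> = X * (1 / real k ^ 2)" by (simp add: Y_def power2_eq_square)
      also have "\<dots> \<le> (C + 1) * (X / ln U) * (1 / real k ^ 2) + X * (1 / real k ^ 2)"
        using C X lnU by simp
      finally show ?thesis using False by simp
    qed
  qed
  have "norm (infsum I {1..}) \<le> (2 * C + 4) * (X / ln U)"
  proof (rule norm_infsum_le(2))
    fix A :: "nat set" assume A: "finite A" "A \<subseteq> {1..}"
    obtain M where M: "A \<subseteq> {..M}" using A(1) finite_nat_iff_bounded_le by blast
    \<comment> \<open>\<open>K\<close> separates the two ranges of \<open>k\<close>: the trivially
      bounded terms have \<open>k > K\<close>, hence add up to at most \<open>X / K\<close>, and
      \<open>K \<ge> U / 2 \<ge> ln U / 2\<close>.\<close>
    define K where "K = nat \<lfloor>U\<rfloor>"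
    have K: "K \<ge> 1" "U \<le> 2 * real K" "\<And>k. \<not> real k \<le> U \<Longrightarrow> k \<ge> Suc K"
      unfolding K_def using U by linarith+
    have "(\<Sum>k\<in>A. norm (I k)) \<le> (\<Sum>k\<in>A. (C + 1) * (X / ln U) * (1 / real k ^ 2) + (if real k \<le> U then 0 else X * (1 / real k ^ 2)))"
      using A by (intro sum_mono I) auto
    also have "\<dots> \<le> (\<Sum>k\<in>{1..M}. (C + 1) * (X / ln U) * (1 / real k ^ 2) + (if real k \<le> U then 0 else X * (1 / real k ^ 2)))"
      using A M C X lnU by (intro sum_mono2) auto
    also have "\<dots> = (C + 1) * (X / ln U) * (\<Sum>k\<in>{1..M}. 1 / real k ^ 2)
        + (\<Sum>k\<in>{1..M}. if real k \<le> U then 0 else X * (1 / real k ^ 2))"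
      by (simp only: sum.distrib sum_distrib_left)
    also have "\<dots> \<le> (C + 1) * (X / ln U) * 2 + 2 * (X / ln U)"
    proof (rule add_mono)
      show "(C + 1) * (X / ln U) * (\<Sum>k\<in>{1..M}. 1 / real k ^ 2) \<le> (C + 1) * (X / ln U) * 2"
        using C X lnU by (intro mult_left_mono sum_inverse_squares_le) auto
      have "(\<Sum>k\<in>{1..M}. if real k \<le> U then 0 else X * (1 / real k ^ 2))
          = (\<Sum>k\<in>{k\<in>{1..M}. \<not> real k \<le> U}. X * (1 / real k ^ 2))"
        unfolding sum.inter_filter [OF finite_atLeastAtMost] by (intro sum.cong) auto
      also have "\<dots> \<le> (\<Sum>k\<in>{Suc K..M}. X * (1 / real k ^ 2))"
        using X K(3) by (intro sum_mono2) auto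
      also have "\<dots> \<le> X * (1 / real K)"
        unfolding sum_distrib_left [symmetric] using X K by (intro mult_left_mono sum_inverse_squares_tail_le) auto
      also have "\<dots> \<le> X * (2 / ln U)"
      proof (rule mult_left_mono)
        have "ln U \<le> 2 * real K" using lnU_le K by linarith
        then show "1 / real K \<le> 2 / ln U" using lnU K by (simp add: field_simps)
      qed (use X in simp)
      finally show "(\<Sum>k\<in>{1..M}. if real k \<le> U then 0 else X * (1 / real k ^ 2)) \<le> 2 * (X / ln U)"
        by (simp add: mult.commute)
    qed
    also have "\<dots> = (2 * C + 4) * (X / ln U)"
    proof -
      have "(C + 1) * L * 2 + 2 * L = (2 * C + 4) * L" for L by (simp add: algebra_simps)
      then show ?thesis .
    qed
    finally show "(\<Sum>k\<in>A. norm (I k)) \<le> (2 * C + 4) * (X / ln U)" .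
  qed
  then show ?thesis
    unfolding Psi_def z_def [symmetric] I_def [symmetric] X_def .
qed

theorem theorem1p12:
  shows "\<exists>C::real. \<forall>\<^sub>F X::real in at_top.
           \<forall>(\<alpha>::real) (f::nat \<Rightarrow> complex).
             minor_arc X \<alpha> \<and> multiplicative f \<and> unit_bounded f \<longrightarrow>
             norm (Psi (of_real (exp (- 1 / X)) * ee \<alpha>) f) \<le> C * (X / ln X)"
proof -
  obtain C where C: "C \<ge> 0" "\<forall>U \<alpha> Y k q J N z g. minor_arc_sum U \<alpha> Y k q J N z g \<longrightarrow>
      norm (\<Sum>n\<in>{1..N}. g n * z ^ n) \<le> C * (Y / ln U)"
    using minor_arc_sum_bound by (elim exE conjE)
  \<comment> \<open>Beyond \<open>U \<ge> 1000\<close>, each condition compares a polynomial in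
    \<open>ln U\<close> with a power of \<open>U\<close>, so all hold for large \<open>U\<close>;
    they are then pulled back along \<open>X powr (1 / 96)\<close>.\<close>
  have "\<forall>\<^sub>F U::real in at_top. U \<ge> 1000 \<and> 9 * (121 * ln U + 2)\<^sup>2 \<le> sqrt U \<and>
      1 + ln (2 * U ^ 64) \<le> U \<and> 832 * ln U * (121 * ln U + 1) \<le> sqrt U"
    by (intro eventually_conj; real_asymp)
  moreover have "filterlim (\<lambda>X::real. X powr (1 / 96)) at_top at_top" by real_asymp
  ultimately have "\<forall>\<^sub>F X::real in at_top. X powr (1 / 96) \<ge> 1000 \<and> 9 * (121 * ln (X powr (1 / 96)) + 2)\<^sup>2 \<le> sqrt (X powr (1 / 96)) \<and>
      1 + ln (2 * (X powr (1 / 96)) ^ 64) \<le> X powr (1 / 96) \<and>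
      832 * ln (X powr (1 / 96)) * (121 * ln (X powr (1 / 96)) + 1) \<le> sqrt (X powr (1 / 96))"
    by (rule eventually_compose_filterlim)
  then have "\<forall>\<^sub>F X::real in at_top. \<forall>(\<alpha>::real) (f::nat \<Rightarrow> complex).
             minor_arc X \<alpha> \<and> multiplicative f \<and> unit_bounded f \<longrightarrow>
             norm (Psi (of_real (exp (- 1 / X)) * ee \<alpha>) f) \<le> 96 * (2 * C + 4) * (X / ln X)"
    using eventually_gt_at_top [of 0]
  proof eventually_elim
    case (elim X)
    define U where "U = X powr (1 / 96)"
    have X: "X = U ^ 96"
      using elim powr_realpow [of U 96] powr_powr [of X "1 / 96" 96] by (simp add: U_def)
    have lnX: "ln X = 96 * ln U" using elim by (simp add: U_def ln_powr)
    have eq: "(2 * C + 4) * (U ^ 96 / ln U) = 96 * (2 * C + 4) * (X / ln X)"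
    proof -
      have "a * (x / l) = 96 * a * (x / (96 * l))" for a x l :: real by simp
      then show ?thesis unfolding X [symmetric] lnX .
    qed
    show ?case
    proof (intro allI impI)
      fix \<alpha> :: real and f :: "nat \<Rightarrow> complex"
      assume "minor_arc X \<alpha> \<and> multiplicative f \<and> unit_bounded f"
      then have "norm (Psi (of_real (exp (- 1 / U ^ 96)) * ee \<alpha>) f) \<le> (2 * C + 4) * (U ^ 96 / ln U)"
        using elim X unfolding U_def [symmetric] by (intro Psi_bound C(1) C(2) [rule_format]) auto
      then show "norm (Psi (of_real (exp (- 1 / X)) * ee \<alpha>) f) \<le> 96 * (2 * C + 4) * (X / ln X)"
        unfolding eq unfolding X [symmetric] .
    qed
  qed
  then show ?thesis by blast
qed

end
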